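(* For every $n\geq 0$, the colorful exchange graph $\mathcal{H}^{c}_n$ given by a centrally symmetric convex $(2n+4)$-gon $K$ is the $1$-skeleton of a simple abstract polytope of rank $n+1$, namely its colorful polytope (called the colorful $(n+1)$-cyclohedron $\mathcal{Z}^{c}_n$).
   Context: Let $K$ be a centrally symmetric convex $(2n+4)$-gon with center $o$; a diagonal is central if it passes through $o$. Centrally symmetric triangulations of $K$ have exactly one central diagonal and $n$ centrally symmetric pairs of non-central diagonals. A colored such triangulation assigns colors from an $n$-element set $C(K)$ to the non-central diagonals, the two diagonals of a symmetric pair getting the same color and distinct pairs distinct colors. A flip either flips the central diagonal (replacing it by the other diagonal of the quadrilateral formed by its two adjacent triangles), or flips both diagonals of a symmetric pair simultaneously, preserving their color. $\mathcal{H}^{c}_n$ has as vertices the colored centrally symmetric triangulations, adjacency by single flips; each edge is colored by the color of the flipped pair, or by an extra color $c^*$ if the central diagonal is flipped, giving a proper edge coloring with color set $C(K)\cup\{c^*\}$ of size $n+1$. Colorful polytope: for a connected $m$-regular graph $\mathcal{G}$ with a proper edge coloring by an $m$-element set $R$, and $C\subseteq R$, write $v\sim_C w$ if there is a path from $v$ to $w$ using only edges with colors in $C$. The colorful polytope is the poset consisting of a least element (rank $-1$) together with the pairs $(C,X)$, $C\subseteq R$, $X$ a $\sim_C$-class, of rank $|C|$, ordered by $(C,X)\le(C',X')$ iff $C\subseteq C'$ and $X\subseteq X'$. Abstract polytopes are in the sense of McMullen–Schulte; a rank-$m$ abstract polytope is simple if its vertex-figures are isomorphic to $(m-1)$-simplices;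 its $1$-skeleton is the graph of its vertices and edges. *)

theory Defs
  imports "HOL-Analysis.Analysis"
begin

section \<open>Simple graphs and proper edge colorings\<close>

type_synonym 'v ugraph = "'v set \<times> 'v set set"

definition simple_graph :: "'v ugraph \<Rightarrow> bool" where
  "simple_graph G \<longleftrightarrow> (\<forall>e \<in> snd G. e \<subseteq> fst G \<and> card e = 2)"

definition connected_graph :: "'v ugraph \<Rightarrow> bool" where
  "connected_graph G \<longleftrightarrow> fst G \<noteq> {} \<and>
     (\<forall>v \<in> fst G. \<forall>w \<in> fst G. (v, w) \<in> {(x, y). {x, y} \<in> snd G}\<^sup>*)"

definition regular_graph :: "nat \<Rightarrow> 'v ugraph \<Rightarrow> bool" where
  "regular_graph m G \<longleftrightarrow> (\<forall>v \<in> fst G. finite {e \<in> snd G. v \<in> e} \<and> card {e \<in> snd G. v \<in> e} = m)"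

definition proper_edge_coloring :: "'v ugraph \<Rightarrow> ('v set \<Rightarrow> 'r) \<Rightarrow> 'r set \<Rightarrow> bool" where
  "proper_edge_coloring G \<kappa> R \<longleftrightarrow>
     \<kappa> ` snd G \<subseteq> R \<and>
     (\<forall>e \<in> snd G. \<forall>e' \<in> snd G. e \<noteq> e' \<and> e \<inter> e' \<noteq> {} \<longrightarrow> \<kappa> e \<noteq> \<kappa> e')"

definition graph_isomorphism :: "('v \<Rightarrow> 'w) \<Rightarrow> 'v ugraph \<Rightarrow> 'w ugraph \<Rightarrow> bool" where
  "graph_isomorphism f G H \<longleftrightarrow> bij_betw f (fst G) (fst H) \<and> (image f) ` snd G = snd H"


section \<open>Abstract polytopes\<close>

text \<open>A poset is given by its reflexive order relation \<open>r\<close>; its faces are the elements of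
  \<open>Field r\<close>, and \<open>(F, G) \<in> r\<close> means \<open>F \<le> G\<close>.\<close>

definition flags :: "'a rel \<Rightarrow> 'a set set" where
  "flags r = {\<Phi> \<in> Chains r. \<forall>\<Psi> \<in> Chains r. \<Phi> \<subseteq> \<Psi> \<longrightarrow> \<Psi> = \<Phi>}"

definition poset_section :: "'a rel \<Rightarrow> 'a \<Rightarrow> 'a \<Rightarrow> 'a rel" where
  "poset_section r F G = Restr r {H. (F, H) \<in> r \<and> (H, G) \<in> r}"

text \<open>Flags of a poset of rank \<open>k\<close> have \<open>k + 2\<close> elements (the improper faces of ranks \<open>-1\<close>
  and \<open>k\<close> are counted). The maximum is only there to select a value: in an abstract polytope
  all flags of a section have the same number of elements.\<close>

definition poset_rank :: "'a rel \<Rightarrow> int" where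
  "poset_rank r = int (Max (card ` flags r)) - 2"

definition face_rank :: "'a rel \<Rightarrow> 'a \<Rightarrow> int" where
  "face_rank r F = poset_rank (Restr r {H. (H, F) \<in> r})"

definition connected_section :: "'a rel \<Rightarrow> 'a \<Rightarrow> 'a \<Rightarrow> bool" where
  "connected_section r F G \<longleftrightarrow>
     (let S = poset_section r F G; P = Field S - {F, G}
      in poset_rank S \<le> 1 \<or>
         (\<forall>A \<in> P. \<forall>B \<in> P. (A, B) \<in> {(x, y). x \<in> P \<and> y \<in> P \<and> ((x, y) \<in> S \<or> (y, x) \<in> S)}\<^sup>*))"

text \<open>The axioms (P1)--(P4) of McMullen and Schulte, for rank \<open>m \<ge> 0\<close>.\<close>

definition abstract_polytope :: "nat \<Rightarrow> 'a rel \<Rightarrow> bool" where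
  "abstract_polytope m r \<longleftrightarrow>
     Partial_order r \<and>
     (\<exists>b \<in> Field r. \<forall>F \<in> Field r. (b, F) \<in> r) \<and>
     (\<exists>t \<in> Field r. \<forall>F \<in> Field r. (F, t) \<in> r) \<and>
     (\<forall>\<Phi> \<in> flags r. finite \<Phi> \<and> card \<Phi> = m + 2) \<and>
     (\<forall>(F, G) \<in> r. connected_section r F G) \<and>
     (\<forall>(F, G) \<in> r. face_rank r G = face_rank r F + 2 \<longrightarrow>
        card {H. face_rank r H = face_rank r F + 1 \<and> (F, H) \<in> r \<and> (H, G) \<in> r} = 2)"

definition vertex_figure :: "'a rel \<Rightarrow> 'a \<Rightarrow> 'a rel" where
  "vertex_figure r v = Restr r {H. (v, H) \<in> r}"

definition poset_isomorphic :: "'a rel \<Rightarrow> 'b rel \<Rightarrow> bool" where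
  "poset_isomorphic r s \<longleftrightarrow>
     (\<exists>f. bij_betw f (Field r) (Field s) \<and>
          (\<forall>x \<in> Field r. \<forall>y \<in> Field r. (x, y) \<in> r \<longleftrightarrow> (f x, f y) \<in> s))"

text \<open>The abstract \<open>(m - 1)\<close>-simplex: its faces are the subsets of its set of \<open>m\<close> vertices.\<close>

definition simplex_on :: "nat \<Rightarrow> nat set rel" where
  "simplex_on m = {(A, B). A \<subseteq> B \<and> B \<subseteq> {..<m}}"

definition simple_polytope :: "nat \<Rightarrow> 'a rel \<Rightarrow> bool" where
  "simple_polytope m r \<longleftrightarrow> abstract_polytope m r \<and>
     (\<forall>v \<in> Field r. face_rank r v = 0 \<longrightarrow> poset_isomorphic (vertex_figure r v) (simplex_on m))"

definition one_skeleton :: "'a rel \<Rightarrow> 'a ugraph" where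
  "one_skeleton r =
     ({v \<in> Field r. face_rank r v = 0},
      {{v \<in> Field r. face_rank r v = 0 \<and> (v, e) \<in> r} | e. e \<in> Field r \<and> face_rank r e = 1})"


section \<open>The colorful polytope of an edge-colored graph\<close>

datatype ('r, 'v) colorful_face = Least_Face | Face "'r set" "'v set"

fun colorful_le :: "('r, 'v) colorful_face \<Rightarrow> ('r, 'v) colorful_face \<Rightarrow> bool" where
  "colorful_le Least_Face _ = True"
| "colorful_le (Face C X) Least_Face = False"
| "colorful_le (Face C X) (Face D Y) = (C \<subseteq> D \<and> X \<subseteq> Y)"

fun colorful_rank :: "('r, 'v) colorful_face \<Rightarrow> int" where
  "colorful_rank Least_Face = - 1"
| "colorful_rank (Face C X) = int (card C)"

text \<open>\<open>v \<sim>\<^sub>C w\<close>: a path from \<open>v\<close> to \<open>w\<close> all of whose edges have colors in \<open>C\<close>.\<close>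

definition color_rel :: "'v ugraph \<Rightarrow> ('v set \<Rightarrow> 'r) \<Rightarrow> 'r set \<Rightarrow> 'v rel" where
  "color_rel G \<kappa> C = {(x, y). {x, y} \<in> snd G \<and> \<kappa> {x, y} \<in> C}\<^sup>*"

definition colorful_faces ::
    "'v ugraph \<Rightarrow> ('v set \<Rightarrow> 'r) \<Rightarrow> 'r set \<Rightarrow> ('r, 'v) colorful_face set" where
  "colorful_faces G \<kappa> R =
     insert Least_Face {Face C X | C X. C \<subseteq> R \<and> X \<in> fst G // color_rel G \<kappa> C}"

definition colorful_polytope ::
    "'v ugraph \<Rightarrow> ('v set \<Rightarrow> 'r) \<Rightarrow> 'r set \<Rightarrow> ('r, 'v) colorful_face rel" where
  "colorful_polytope G \<kappa> R =
     {(F, F'). F \<in> colorful_faces G \<kappa> R \<and> F' \<in> colorful_faces G \<kappa> R \<and> colorful_le F F'}"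


section \<open>Centrally symmetric polygons and their triangulations\<close>

definition vertices :: "complex set \<Rightarrow> complex set" where
  "vertices K = {v. v extreme_point_of K}"

definition convex_polygon :: "nat \<Rightarrow> complex set \<Rightarrow> bool" where
  "convex_polygon m K \<longleftrightarrow> polytope K \<and> aff_dim K = 2 \<and> card (vertices K) = m"

definition point_reflection :: "complex \<Rightarrow> complex \<Rightarrow> complex" where
  "point_reflection p x = 2 * p - x"

definition centrally_symmetric :: "complex set \<Rightarrow> complex \<Rightarrow> bool" where
  "centrally_symmetric K p \<longleftrightarrow> point_reflection p ` K = K"

text \<open>Sides and diagonals are segments, that is, sets of points.\<close>

definition diagonals :: "complex set \<Rightarrow> complex set set" where
  "diagonals K = {closed_segment u v | u v.
     u \<in> vertices K \<and> v \<in> vertices K \<and> u \<noteq> v \<and> \<not> closed_segment u v edge_of K}"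

definition central :: "complex \<Rightarrow> complex set \<Rightarrow> bool" where
  "central p d \<longleftrightarrow> p \<in> d"

definition crossing :: "complex set \<Rightarrow> complex set \<Rightarrow> bool" where
  "crossing d e \<longleftrightarrow> d \<noteq> e \<and> rel_interior d \<inter> rel_interior e \<noteq> {}"

text \<open>A triangulation without new vertices is identified with its set of diagonals: a maximal
  set of pairwise non-crossing diagonals.\<close>

definition triangulation_of :: "complex set \<Rightarrow> complex set set \<Rightarrow> bool" where
  "triangulation_of K T \<longleftrightarrow> T \<subseteq> diagonals K \<and>
     (\<forall>d \<in> T. \<forall>e \<in> T. \<not> crossing d e) \<and>
     (\<forall>d \<in> diagonals K - T. \<exists>e \<in> T. crossing d e)"

definition cs_triangulation :: "complex set \<Rightarrow> complex \<Rightarrow> complex set set \<Rightarrow> bool" where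
  "cs_triangulation K p T \<longleftrightarrow> triangulation_of K T \<and> (\<forall>d \<in> T. point_reflection p ` d \<in> T)"

definition triangle_in :: "complex set \<Rightarrow> complex set set \<Rightarrow> complex \<Rightarrow> complex \<Rightarrow> complex \<Rightarrow> bool" where
  "triangle_in K T a b c \<longleftrightarrow>
     {a, b, c} \<subseteq> vertices K \<and> a \<noteq> b \<and> b \<noteq> c \<and> a \<noteq> c \<and>
     (\<forall>s \<in> {closed_segment a b, closed_segment b c, closed_segment a c}. s edge_of K \<or> s \<in> T)"

text \<open>\<open>d\<close> is a diagonal in \<open>T\<close>, its two adjacent triangles form the quadrilateral \<open>a c b e\<close>, and
  \<open>d'\<close> is the other diagonal of this quadrilateral.\<close>

definition opposite_diagonal ::
    "complex set \<Rightarrow> complex set set \<Rightarrow> complex set \<Rightarrow> complex set \<Rightarrow> bool" where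
  "opposite_diagonal K T d d' \<longleftrightarrow> d \<in> T \<and>
     (\<exists>a b c e. c \<noteq> e \<and> triangle_in K T a b c \<and> triangle_in K T a b e \<and>
        d = closed_segment a b \<and> d' = closed_segment c e)"


section \<open>The colorful exchange graph\<close>

text \<open>A colored triangulation is a triangulation \<open>T\<close> together with a partial map \<open>\<gamma>\<close> that assigns
  colors to exactly the non-central diagonals of \<open>T\<close>.\<close>

type_synonym 'c colored_triangulation = "complex set set \<times> (complex set \<rightharpoonup> 'c)"

definition colored_cs_triangulation ::
    "complex set \<Rightarrow> complex \<Rightarrow> 'c set \<Rightarrow> 'c colored_triangulation \<Rightarrow> bool" where
  "colored_cs_triangulation K p C = (\<lambda>(T, \<gamma>).
     cs_triangulation K p T \<and>
     dom \<gamma> = {d \<in> T. \<not> central p d} \<and> ran \<gamma> \<subseteq> C \<and>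
     (\<forall>d \<in> dom \<gamma>. \<gamma> (point_reflection p ` d) = \<gamma> d) \<and>
     (\<forall>d \<in> dom \<gamma>. \<forall>e \<in> dom \<gamma>. \<gamma> d = \<gamma> e \<longrightarrow> e = d \<or> e = point_reflection p ` d))"

text \<open>Edge colors are of type \<open>'c option\<close>: \<open>Some c\<close> for \<open>c \<in> C\<close>, and \<open>None\<close> as the extra color
  of the flips of central diagonals.\<close>

definition central_flip ::
    "complex set \<Rightarrow> complex \<Rightarrow> 'c colored_triangulation \<Rightarrow> 'c colored_triangulation \<Rightarrow> bool" where
  "central_flip K p = (\<lambda>(T, \<gamma>) (T', \<gamma>').
     \<exists>d d'. central p d \<and> opposite_diagonal K T d d' \<and>
       T' = insert d' (T - {d}) \<and> \<gamma>' = \<gamma>)"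

definition pair_flip ::
    "complex set \<Rightarrow> complex \<Rightarrow> 'c \<Rightarrow> 'c colored_triangulation \<Rightarrow> 'c colored_triangulation \<Rightarrow> bool" where
  "pair_flip K p c = (\<lambda>(T, \<gamma>) (T', \<gamma>').
     \<exists>d\<^sub>1 d\<^sub>2 d\<^sub>1' d\<^sub>2'. \<not> central p d\<^sub>1 \<and> d\<^sub>2 = point_reflection p ` d\<^sub>1 \<and> \<gamma> d\<^sub>1 = Some c \<and>
       opposite_diagonal K T d\<^sub>1 d\<^sub>1' \<and> opposite_diagonal K T d\<^sub>2 d\<^sub>2' \<and>
       T' = (T - {d\<^sub>1, d\<^sub>2}) \<union> {d\<^sub>1', d\<^sub>2'} \<and>
       \<gamma>' = (\<gamma>(d\<^sub>1 := None, d\<^sub>2 := None))(d\<^sub>1' := Some c, d\<^sub>2' := Some c))"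

definition colored_flip ::
    "complex set \<Rightarrow> complex \<Rightarrow> 'c set \<Rightarrow> 'c option \<Rightarrow>
     'c colored_triangulation \<Rightarrow> 'c colored_triangulation \<Rightarrow> bool" where
  "colored_flip K p C r v w \<longleftrightarrow>
     colored_cs_triangulation K p C v \<and> colored_cs_triangulation K p C w \<and>
     (case r of None \<Rightarrow> central_flip K p v w | Some c \<Rightarrow> pair_flip K p c v w)"

definition exchange_graph ::
    "complex set \<Rightarrow> complex \<Rightarrow> 'c set \<Rightarrow> 'c colored_triangulation ugraph" where
  "exchange_graph K p C =
     ({v. colored_cs_triangulation K p C v}, {{v, w} | v w. \<exists>r. colored_flip K p C r v w})"

definition exchange_color ::
    "complex set \<Rightarrow> complex \<Rightarrow> 'c set \<Rightarrow> 'c colored_triangulation set \<Rightarrow> 'c option" where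
  "exchange_color K p C e = (THE r. \<exists>v w. e = {v, w} \<and> colored_flip K p C r v w)"

definition exchange_colors :: "'c set \<Rightarrow> 'c option set" where
  "exchange_colors C = insert None (Some ` C)"

definition colorful_cyclohedron ::
    "complex set \<Rightarrow> complex \<Rightarrow> 'c set \<Rightarrow> ('c option, 'c colored_triangulation) colorful_face rel" where
  "colorful_cyclohedron K p C =
     colorful_polytope (exchange_graph K p C) (exchange_color K p C) (exchange_colors C)"

end

theory Submission
  imports Defs
begin

text \<open>
  For any connected properly edge-colored \<open>k\<close>-regular graph with \<open>k\<close> colors, every vertex meets every
  color exactly once. The faces above a face \<open>(D, [x])\<close> are therefore the \<open>(E, [x])\<close> with \<open>D \<subseteq> E\<close>, a Boolean
  lattice, and this gives the polytope axioms, simplicity and the 1-skeleton. It remains to see that the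
  exchange graph is such a graph.

  Orientation is a cyclic order on the vertices of \<open>K\<close>, so these can be numbered periodically modulo \<open>2 * m\<close>,
  \<open>m = n + 2\<close>, such that chords cross iff their indices interleave and the central reflection is
  \<open>i \<mapsto> i + m\<close>. A symmetric triangulation has one central diagonal and \<open>n\<close> pairs of other diagonals, so every
  color occurs and determines a unique flip.

  For connectedness, flips bring every triangulation with central diagonal \<open>(s, s + m)\<close> to the fan at
  \<open>s\<close>. Flipping five times around a pentagon transposes two neighboring colors of the fan, so all
  colorings of the fan are connected, and flipping the central diagonal of the fan replaces \<open>s\<close> by \<open>s - 1\<close>.
\<close>

text \<open>The rank of a face is defined through the largest cardinality of a flag, so every rank
  computation needs that all flags of a section have the same length. This holds in any bounded
  poset with a strictly monotone integer function without gaps, and \<open>colorful_rank\<close> is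
  such a function.

  Diagonals are point sets. Numbering vertices by integers, and not by residues, turns a crossing
  question into linear inequalities inside a window of \<open>2 * m\<close> consecutive indices; the
  window may start anywhere, so it can be adapted to the chord at hand.

  Connectedness asks for more than connectedness of the uncolored flip graph: a walk of flips
  returning to its triangulation may permute the colors, and every permutation has to be realized.
  This is why both the fans and the orders of their colors are followed.

  The fan at \<open>s\<close> moves to \<open>s - 1\<close> because its last diagonal ends at
  \<open>s + m - 1\<close>. So the triangle on the central diagonal has apex
  \<open>s + m - 1\<close>, and the flip produces the chord from there to its antipode, which is the
  vertex \<open>s - 1\<close>.\<close>

section \<open>Ranks in graded posets\<close>

text \<open>A flag misses no rank: around a missing value \<open>r\<close>, its highest element
  below \<open>r\<close> and its lowest element above \<open>r\<close> have ranks at least 2 apart,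
  so \<open>dense\<close> gives an element strictly between them. This is comparable with the whole
  chain, hence in the flag by maximality, a contradiction. So \<open>\<rho>\<close> maps each flag
  bijectively onto the interval from \<open>\<rho> b\<close> to \<open>\<rho> t\<close>.\<close>

lemma graded_poset_flag:
  fixes s :: "'a rel" and \<rho> :: "'a \<Rightarrow> int"
  assumes tr: "trans s" and re: "\<And>x. x \<in> Field s \<Longrightarrow> (x, x) \<in> s"
    and bt: "b \<in> Field s" "t \<in> Field s"
    and bot: "\<And>x. x \<in> Field s \<Longrightarrow> (b, x) \<in> s" and top: "\<And>x. x \<in> Field s \<Longrightarrow> (x, t) \<in> s"
    and strict: "\<And>x y. (x, y) \<in> s \<Longrightarrow> x \<noteq> y \<Longrightarrow> \<rho> x < \<rho> y"
    and dense: "\<And>x y. (x, y) \<in> s \<Longrightarrow> \<rho> x + 1 < \<rho> y \<Longrightarrow>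
      \<exists>z. (x, z) \<in> s \<and> (z, y) \<in> s \<and> \<rho> x < \<rho> z \<and> \<rho> z < \<rho> y"
  shows graded_poset_flag_card: "\<Phi> \<in> flags s \<Longrightarrow> finite \<Phi> \<and> int (card \<Phi>) = \<rho> t - \<rho> b + 1"
    and graded_poset_rank: "poset_rank s = \<rho> t - \<rho> b - 1"
proof -
  have chain_Field: "x \<in> Field s" if "\<Phi> \<in> Chains s" "x \<in> \<Phi>" for x \<Phi>
    using that unfolding Chains_def Field_def by blast
  have chain_le: "(x, y) \<in> s" if "\<Phi> \<in> Chains s" "x \<in> \<Phi>" "y \<in> \<Phi>" "\<rho> x \<le> \<rho> y" for x y \<Phi>
  proof (cases "x = y")
    case True
    then show ?thesis using re chain_Field[OF that(1)] that by simp
  next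
    case False
    have "(x, y) \<in> s \<or> (y, x) \<in> s" using that(1-3) unfolding Chains_def by auto
    then show ?thesis using strict[of y x] that False by auto
  qed
  have inj: "inj_on \<rho> \<Phi>" if "\<Phi> \<in> Chains s" for \<Phi>
  proof (rule inj_onI)
    fix x y assume "x \<in> \<Phi>" "y \<in> \<Phi>" "\<rho> x = \<rho> y"
    then show "x = y"
      using chain_le[OF that, of x y] strict[of x y] by fastforce
  qed
  have mono: "\<rho> x \<le> \<rho> y" if "(x, y) \<in> s" for x y
    using strict[of x y] that by (cases "x = y") auto
  have range: "\<rho> ` \<Phi> \<subseteq> {\<rho> b..\<rho> t}" if "\<Phi> \<in> Chains s" for \<Phi>
    using chain_Field[OF that] bot top mono by fastforce
  have fin: "finite \<Phi>" if "\<Phi> \<in> Chains s" for \<Phi>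
    using inj[OF that] range[OF that] by (meson finite_atLeastAtMost_int finite_imageD finite_subset)
  have bound: "card \<Phi> \<le> card {\<rho> b..\<rho> t}" if "\<Phi> \<in> Chains s" for \<Phi>
    using card_inj_on_le[OF inj[OF that] range[OF that]] by simp
  have full: "\<rho> ` \<Phi> = {\<rho> b..\<rho> t}" if fl: "\<Phi> \<in> flags s" for \<Phi>
  proof -
    have ch: "\<Phi> \<in> Chains s" and mx: "\<And>\<Psi>. \<Psi> \<in> Chains s \<Longrightarrow> \<Phi> \<subseteq> \<Psi> \<Longrightarrow> \<Psi> = \<Phi>"
      using fl unfolding flags_def by auto
    have ins: "z \<in> \<Phi>" if "z \<in> Field s" "\<And>w. w \<in> \<Phi> \<Longrightarrow> (w, z) \<in> s \<or> (z, w) \<in> s" for z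
    proof -
      have "insert z \<Phi> \<in> Chains s"
        using ch that re unfolding Chains_def by auto
      then show ?thesis using mx by blast
    qed
    have bin: "b \<in> \<Phi>" using ins[OF bt(1)] bot chain_Field[OF ch] by blast
    have tin: "t \<in> \<Phi>" using ins[OF bt(2)] top chain_Field[OF ch] by blast
    have "r \<in> \<rho> ` \<Phi>" if r: "\<rho> b \<le> r" "r \<le> \<rho> t" for r
    proof (rule ccontr)
      assume nr: "r \<notin> \<rho> ` \<Phi>"
      define L where "L = {x \<in> \<Phi>. \<rho> x < r}"
      define U where "U = {x \<in> \<Phi>. r < \<rho> x}"
      have LU: "finite L" "finite U" using fin[OF ch] unfolding L_def U_def by auto
      have bL: "b \<in> L" using bin nr r unfolding L_def by force
      have tU: "t \<in> U" using tin nr r unfolding U_def by force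
      obtain x where x: "x \<in> L" "\<And>w. w \<in> L \<Longrightarrow> \<rho> w \<le> \<rho> x"
        using Max_in[of "\<rho> ` L"] Max_ge[of "\<rho> ` L"] LU bL
        by (metis (no_types, opaque_lifting) empty_iff finite_imageI image_iff image_is_empty)
      obtain y where y: "y \<in> U" "\<And>w. w \<in> U \<Longrightarrow> \<rho> y \<le> \<rho> w"
        using Min_in[of "\<rho> ` U"] Min_le[of "\<rho> ` U"] LU tU
        by (metis (no_types, opaque_lifting) empty_iff finite_imageI image_iff image_is_empty)
      have xy: "x \<in> \<Phi>" "y \<in> \<Phi>" "\<rho> x < r" "r < \<rho> y"
        using x y unfolding L_def U_def by auto
      have "(x, y) \<in> s" using chain_le[OF ch] xy by auto
      then obtain z where z: "(x, z) \<in> s" "(z, y) \<in> s" "\<rho> x < \<rho> z" "\<rho> z < \<rho> y"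
        using dense[of x y] xy by auto
      have "z \<in> \<Phi>"
      proof (rule ins)
        show "z \<in> Field s" using z unfolding Field_def by auto
        fix w assume w: "w \<in> \<Phi>"
        show "(w, z) \<in> s \<or> (z, w) \<in> s"
        proof (cases "\<rho> w < r")
          case True
          then have "\<rho> w \<le> \<rho> x" using x(2) w unfolding L_def by blast
          then have "(w, x) \<in> s" using chain_le[OF ch] xy w by blast
          then show ?thesis using z tr by (meson transE)
        next
          case False
          then have "r < \<rho> w" using nr w by (metis image_eqI linorder_neqE_linordered_idom)
          then have "\<rho> y \<le> \<rho> w" using y(2) w unfolding U_def by blast
          then have "(y, w) \<in> s" using chain_le[OF ch] xy w by blast
          then show ?thesis using z tr by (meson transE)
        qed
      qed
      then have "z \<in> L \<or> z \<in> U" using nr unfolding L_def U_def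
        by (metis (mono_tags, lifting) image_eqI linorder_neqE_linordered_idom mem_Collect_eq)
      then show False using x y z by force
    qed
    then show ?thesis using range[OF ch] by auto
  qed
  have bt_le: "\<rho> b \<le> \<rho> t" using mono bot bt by blast
  have crd: "finite \<Phi> \<and> int (card \<Phi>) = \<rho> t - \<rho> b + 1" if "\<Phi> \<in> flags s" for \<Phi>
  proof -
    have ch: "\<Phi> \<in> Chains s" using that unfolding flags_def by auto
    have "card \<Phi> = card (\<rho> ` \<Phi>)" using card_image[OF inj[OF ch]] by simp
    then show ?thesis using full[OF that] fin[OF ch] bt_le by simp
  qed
  then show "\<Phi> \<in> flags s \<Longrightarrow> finite \<Phi> \<and> int (card \<Phi>) = \<rho> t - \<rho> b + 1" .
  \<comment> \<open>The maximum in \<open>poset_rank\<close> needs a flag to exist. Cardinalities of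
    chains are bounded, and a chain of greatest cardinality is a flag.\<close>
  have "{} \<in> Chains s" unfolding Chains_def by simp
  then obtain \<Phi> where \<Phi>: "\<Phi> \<in> Chains s" "\<And>\<Psi>. \<Psi> \<in> Chains s \<Longrightarrow> card \<Psi> \<le> card \<Phi>"
    using ex_has_greatest_nat[of "\<lambda>\<Phi>. \<Phi> \<in> Chains s" "{}" card "Suc (card {\<rho> b..\<rho> t})"] bound
    by (metis le_imp_less_Suc)
  have "\<Phi> \<in> flags s"
    unfolding flags_def using \<Phi> card_seteq[OF fin] by blast
  then have "card ` flags s = {nat (\<rho> t - \<rho> b + 1)}" using crd by force
  then show "poset_rank s = \<rho> t - \<rho> b - 1"
    unfolding poset_rank_def using bt_le by simp
qed

section \<open>The colorful polytope of a properly edge-colored regular graph\<close>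

locale colorful_graph =
  fixes G :: "'v ugraph" and \<kappa> :: "'v set \<Rightarrow> 'r" and R :: "'r set"
  assumes simple: "simple_graph G" and conn: "connected_graph G"
    and reg: "regular_graph (card R) G" and proper: "proper_edge_coloring G \<kappa> R"
    and fin: "finite R"
begin

abbreviation cls :: "'r set \<Rightarrow> 'v \<Rightarrow> 'v set" where
  "cls D x \<equiv> color_rel G \<kappa> D `` {x}"

abbreviation P :: "('r, 'v) colorful_face rel" where
  "P \<equiv> colorful_polytope G \<kappa> R"

lemma color_rel_refl [simp]: "(x, x) \<in> color_rel G \<kappa> D"
  unfolding color_rel_def by simp

lemma color_rel_sym: "(x, y) \<in> color_rel G \<kappa> D \<Longrightarrow> (y, x) \<in> color_rel G \<kappa> D"
proof -
  have "sym {(x, y). {x, y} \<in> snd G \<and> \<kappa> {x, y} \<in> D}"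
    by (auto simp: sym_def insert_commute)
  then show "(x, y) \<in> color_rel G \<kappa> D \<Longrightarrow> (y, x) \<in> color_rel G \<kappa> D"
    unfolding color_rel_def by (rule symD[OF sym_rtrancl])
qed

lemma color_rel_trans:
  "(x, y) \<in> color_rel G \<kappa> D \<Longrightarrow> (y, z) \<in> color_rel G \<kappa> D \<Longrightarrow> (x, z) \<in> color_rel G \<kappa> D"
  unfolding color_rel_def by (rule rtrancl_trans)

lemma color_rel_mono: "D \<subseteq> D' \<Longrightarrow> (x, y) \<in> color_rel G \<kappa> D \<Longrightarrow> (x, y) \<in> color_rel G \<kappa> D'"
proof -
  assume "D \<subseteq> D'"
  then have "color_rel G \<kappa> D \<subseteq> color_rel G \<kappa> D'"
    unfolding color_rel_def by (intro rtrancl_mono) auto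
  then show "(x, y) \<in> color_rel G \<kappa> D \<Longrightarrow> (x, y) \<in> color_rel G \<kappa> D'" by blast
qed

lemma cls_eq_iff: "cls D x = cls D y \<longleftrightarrow> (x, y) \<in> color_rel G \<kappa> D"
proof
  assume "cls D x = cls D y"
  then have "y \<in> cls D x" by simp
  then show "(x, y) \<in> color_rel G \<kappa> D" by simp
next
  assume xy: "(x, y) \<in> color_rel G \<kappa> D"
  have "z \<in> cls D x \<longleftrightarrow> z \<in> cls D y" for z
    using color_rel_trans[OF xy] color_rel_trans[OF color_rel_sym[OF xy]] by auto
  then show "cls D x = cls D y" by blast
qed

lemma edge_vertices: "{x, y} \<in> snd G \<Longrightarrow> x \<in> fst G \<and> y \<in> fst G \<and> x \<noteq> y"
  using simple unfolding simple_graph_def by force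

lemma edgeE:
  assumes "e \<in> snd G" obtains x y where "e = {x, y}" "x \<in> fst G" "y \<in> fst G" "x \<noteq> y"
proof -
  have "card e = 2" "e \<subseteq> fst G" using assms simple unfolding simple_graph_def by auto
  then show thesis using that by (auto simp: card_2_iff)
qed

lemma color_rel_vertices: "(x, y) \<in> color_rel G \<kappa> D \<Longrightarrow> x \<in> fst G \<Longrightarrow> y \<in> fst G"
  unfolding color_rel_def by (induction rule: rtrancl_induct) (auto dest: edge_vertices)

lemma color_rel_all: "x \<in> fst G \<Longrightarrow> y \<in> fst G \<Longrightarrow> (x, y) \<in> color_rel G \<kappa> R"
proof -
  have "{(x, y). {x, y} \<in> snd G \<and> \<kappa> {x, y} \<in> R} = {(x, y). {x, y} \<in> snd G}"
    using proper unfolding proper_edge_coloring_def by auto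
  then show "x \<in> fst G \<Longrightarrow> y \<in> fst G \<Longrightarrow> (x, y) \<in> color_rel G \<kappa> R"
    using conn unfolding connected_graph_def color_rel_def by simp
qed

lemma color_rel_empty: "(x, y) \<in> color_rel G \<kappa> {} \<longleftrightarrow> x = y"
  unfolding color_rel_def by simp

text \<open>The \<open>card R\<close> edges at \<open>x\<close> have distinct colors among
  \<open>card R\<close> colors, so \<open>\<kappa>\<close> is a bijection from them onto
  \<open>R\<close>.\<close>

lemma neighbor:
  assumes "x \<in> fst G" "c \<in> R" shows "\<exists>!y. {x, y} \<in> snd G \<and> \<kappa> {x, y} = c"
proof -
  let ?I = "{e \<in> snd G. x \<in> e}"
  have I: "finite ?I" "card ?I = card R" using reg assms unfolding regular_graph_def by auto
  have inj: "inj_on \<kappa> ?I"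
    using proper unfolding proper_edge_coloring_def inj_on_def by blast
  have sub: "\<kappa> ` ?I \<subseteq> R" using proper unfolding proper_edge_coloring_def by auto
  have "\<kappa> ` ?I = R"
    by (rule card_subset_eq[OF fin sub]) (simp add: card_image[OF inj] I)
  then obtain e where e: "e \<in> snd G" "x \<in> e" "\<kappa> e = c" using assms by auto
  then obtain y where "e = {x, y}" by (metis edgeE insertE insert_commute singletonD)
  moreover have "y = y'" if "{x, y} \<in> snd G" "\<kappa> {x, y} = c" "{x, y'} \<in> snd G" "\<kappa> {x, y'} = c" for y y'
  proof -
    have "{x, y} = {x, y'}" using inj that unfolding inj_on_def by auto
    then show ?thesis by (auto simp: doubleton_eq_iff)
  qed
  ultimately show ?thesis using e by blast
qed

text \<open>Each end of the edge has only one neighbor of color \<open>c\<close>, so a walk with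
  this color goes back and forth along the edge. Thus the edges of the graph reappear as the classes
  of single colors.\<close>

lemma cls_single:
  assumes "{x, y} \<in> snd G" "\<kappa> {x, y} = c" "c \<in> R" shows "cls {c} x = {x, y}"
proof -
  have x: "x \<in> fst G" "y \<in> fst G" using edge_vertices assms by auto
  have "z \<in> {x, y}" if "(x, z) \<in> color_rel G \<kappa> {c}" for z
    using that unfolding color_rel_def
  proof (induction rule: rtrancl_induct)
    case (step z w)
    then show ?case
      using neighbor[OF x(1) assms(3)] neighbor[OF x(2) assms(3)] assms
      by (auto simp: insert_commute)
  qed simp
  moreover have "(x, y) \<in> color_rel G \<kappa> {c}"
    unfolding color_rel_def using assms by auto
  ultimately show ?thesis by auto
qed

section \<open>Faces of the colorful polytope and their order\<close>

lemma Face_in [simp]: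
  "Face D X \<in> colorful_faces G \<kappa> R \<longleftrightarrow> D \<subseteq> R \<and> (\<exists>x \<in> fst G. X = cls D x)"
  unfolding colorful_faces_def quotient_def by auto

lemma Least_in [simp]: "Least_Face \<in> colorful_faces G \<kappa> R"
  unfolding colorful_faces_def by simp

lemma Field_P [simp]: "Field P = colorful_faces G \<kappa> R"
proof -
  have "colorful_le F F" for F :: "('r, 'v) colorful_face" by (cases F) auto
  then show ?thesis unfolding colorful_polytope_def Field_def by blast
qed

lemma P_iff: "(F, F') \<in> P \<longleftrightarrow>
   F \<in> colorful_faces G \<kappa> R \<and> F' \<in> colorful_faces G \<kappa> R \<and> colorful_le F F'"
  unfolding colorful_polytope_def by simp

lemma faces_cases:
  assumes "F \<in> colorful_faces G \<kappa> R"
  obtains "F = Least_Face" | D x where "F = Face D (cls D x)" "D \<subseteq> R" "x \<in> fst G"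
  using assms by (cases F) auto

text \<open>The class of a larger face contains \<open>x\<close>, and a class containing
  \<open>x\<close> is determined by its color set. So one representative of the lower face serves
  for all faces above it, and comparing them amounts to comparing sets of colors.\<close>

lemma above_Face:
  assumes "D \<subseteq> R" "x \<in> fst G"
  shows "(Face D (cls D x), F) \<in> P \<longleftrightarrow> (\<exists>E. D \<subseteq> E \<and> E \<subseteq> R \<and> F = Face E (cls E x))"
proof
  assume a: "(Face D (cls D x), F) \<in> P"
  then obtain E X where F: "F = Face E X" by (cases F) (auto simp: P_iff)
  then obtain y where y: "y \<in> fst G" "X = cls E y" "D \<subseteq> E" "E \<subseteq> R" "cls D x \<subseteq> X"
    using a by (auto simp: P_iff)
  then have "x \<in> cls E y" using color_rel_refl by blast
  then have "(y, x) \<in> color_rel G \<kappa> E" by simp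
  then have "cls E y = cls E x" by (simp add: cls_eq_iff)
  then show "\<exists>E. D \<subseteq> E \<and> E \<subseteq> R \<and> F = Face E (cls E x)" using F y by auto
next
  assume "\<exists>E. D \<subseteq> E \<and> E \<subseteq> R \<and> F = Face E (cls E x)"
  then show "(Face D (cls D x), F) \<in> P" using assms color_rel_mono by (auto simp: P_iff)
qed

lemma above_FaceE:
  assumes "(F, F') \<in> P" "F = Face D (cls D x)" "D \<subseteq> R" "x \<in> fst G"
  obtains E where "D \<subseteq> E" "E \<subseteq> R" "F' = Face E (cls E x)"
  using assms above_Face by auto

lemma P_refl: "F \<in> colorful_faces G \<kappa> R \<Longrightarrow> (F, F) \<in> P"
  by (cases F) (auto simp: P_iff)

lemma P_trans: "trans P"
proof (rule transI)
  fix F F' F'' assume "(F, F') \<in> P" "(F', F'') \<in> P"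
  then show "(F, F'') \<in> P"
    by (cases F; cases F'; cases F'') (auto simp: P_iff)
qed

lemma P_antisym: "antisym P"
proof (rule antisymI)
  fix F F' assume "(F, F') \<in> P" "(F', F) \<in> P"
  then show "F = F'" by (cases F; cases F') (auto simp: P_iff)
qed

lemma P_partial_order: "Partial_order P"
  unfolding partial_order_on_def preorder_on_def
proof (intro conjI)
  show "refl_on (Field P) P" using P_refl by (auto intro!: refl_onI)
qed (use P_trans P_antisym in \<open>auto simp: P_iff\<close>)

section \<open>The rank function and sections\<close>

lemma finite_colors: "D \<subseteq> R \<Longrightarrow> finite D"
  using fin finite_subset by blast

lemma rank_strict: "(F, F') \<in> P \<Longrightarrow> F \<noteq> F' \<Longrightarrow> colorful_rank F < colorful_rank F'"
proof -
  assume a: "(F, F') \<in> P" "F \<noteq> F'"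
  then have Fin: "F \<in> colorful_faces G \<kappa> R" by (simp add: P_iff)
  show "colorful_rank F < colorful_rank F'"
  proof (cases rule: faces_cases[OF Fin, case_names least face])
    case least
    then show ?thesis using a by (cases F'; simp add: P_iff)
  next
    case (face D x)
    then obtain E where "D \<subseteq> E" "E \<subseteq> R" "F' = Face E (cls E x)"
      using above_FaceE[OF a(1) face] by metis
    moreover have "D \<noteq> E" using a calculation face by auto
    ultimately show ?thesis using face psubset_card_mono[OF finite_colors[of E], of D] by auto
  qed
qed

text \<open>A vertex lies strictly between the least face and a face of positive rank. Above a
  proper face, adding one missing color raises the rank by exactly 1.\<close>

lemma rank_dense:
  assumes "(F, F') \<in> P" "colorful_rank F + 1 < colorful_rank F'"
  shows "\<exists>H. (F, H) \<in> P \<and> (H, F') \<in> P \<and> colorful_rank F < colorful_rank H \<and> colorful_rank H < colorful_rank F'"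
proof -
  have Fin: "F \<in> colorful_faces G \<kappa> R" using assms by (simp add: P_iff)
  show ?thesis
  proof (cases rule: faces_cases[OF Fin, case_names least face])
    case least
    have "F' \<in> colorful_faces G \<kappa> R" using assms by (simp add: P_iff)
    then obtain E x where E: "F' = Face E (cls E x)" "E \<subseteq> R" "x \<in> fst G"
      using assms(2) least by (cases rule: faces_cases) auto
    then have "(Face {} (cls {} x), F') \<in> P" by (simp add: above_Face)
    then show ?thesis using least assms E by (intro exI[of _ "Face {} (cls {} x)"]) (auto simp: P_iff)
  next
    case (face D x)
    then obtain E where E: "D \<subseteq> E" "E \<subseteq> R" "F' = Face E (cls E x)"
      using above_FaceE[OF assms(1) face] by metis
    moreover have "\<not> E \<subseteq> D" using assms(2) face E card_mono[OF finite_colors[OF face(2)], of E] by auto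
    ultimately obtain e where e: "e \<in> E" "e \<notin> D" by blast
    let ?H = "Face (insert e D) (cls (insert e D) x)"
    have "(F, ?H) \<in> P" using face E e by (subst face(1), subst above_Face) auto
    moreover have "(?H, F') \<in> P" using face E e by (subst above_Face) auto
    ultimately show ?thesis using face E e assms finite_colors[of D] by (intro exI[of _ ?H]) auto
  qed
qed

lemma section_Field:
  assumes "(F, F') \<in> P"
  shows "Field (poset_section P F F') = {H. (F, H) \<in> P \<and> (H, F') \<in> P}"
proof -
  have "(H, H) \<in> P" if "(F, H) \<in> P" for H using that P_refl by (simp add: P_iff)
  moreover have "(F, F) \<in> P" "(F', F') \<in> P" using assms P_refl by (auto simp: P_iff)
  ultimately show ?thesis unfolding poset_section_def Field_def by blast
qed

text \<open>A section inherits the hypotheses of \<open>graded_poset_flag\<close> from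
  \<open>P\<close>, with \<open>F\<close> and \<open>F'\<close> as its least and greatest
  elements.\<close>

lemma section_props:
  assumes "(F, F') \<in> P"
  shows section_flag: "\<Phi> \<in> flags (poset_section P F F') \<Longrightarrow>
      finite \<Phi> \<and> int (card \<Phi>) = colorful_rank F' - colorful_rank F + 1"
    and section_rank: "poset_rank (poset_section P F F') = colorful_rank F' - colorful_rank F - 1"
proof -
  let ?S = "poset_section P F F'"
  have S_iff: "(x, y) \<in> ?S \<longleftrightarrow> (x, y) \<in> P \<and> (F, x) \<in> P \<and> (x, F') \<in> P \<and> (F, y) \<in> P \<and> (y, F') \<in> P" for x y
    unfolding poset_section_def by auto
  have FF: "(F, F) \<in> P" "(F', F') \<in> P" using assms P_refl by (auto simp: P_iff)
  have tr: "trans ?S" by (rule transI) (use P_trans in \<open>auto simp: S_iff dest: transD\<close>)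
  have re: "(x, x) \<in> ?S" if "x \<in> Field ?S" for x
    using that P_refl by (auto simp: section_Field[OF assms] S_iff P_iff)
  have F1: "F \<in> Field ?S" "F' \<in> Field ?S" using FF assms by (auto simp: section_Field[OF assms])
  have bt: "(F, x) \<in> ?S" "(x, F') \<in> ?S" if "x \<in> Field ?S" for x
    using that FF assms by (auto simp: section_Field[OF assms] S_iff)
  have st: "colorful_rank x < colorful_rank y" if "(x, y) \<in> ?S" "x \<noteq> y" for x y
    using that rank_strict by (auto simp: S_iff)
  have de: "\<exists>z. (x, z) \<in> ?S \<and> (z, y) \<in> ?S \<and> colorful_rank x < colorful_rank z \<and> colorful_rank z < colorful_rank y"
    if a: "(x, y) \<in> ?S" "colorful_rank x + 1 < colorful_rank y" for x y
  proof -
    obtain z where "(x, z) \<in> P" "(z, y) \<in> P" "colorful_rank x < colorful_rank z" "colorful_rank z < colorful_rank y"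
      using rank_dense[of x y] a by (auto simp: S_iff)
    moreover have "(F, z) \<in> P" "(z, F') \<in> P" using a calculation P_trans by (meson S_iff transD)+
    ultimately show ?thesis using a by (auto simp: S_iff)
  qed
  show "\<Phi> \<in> flags ?S \<Longrightarrow> finite \<Phi> \<and> int (card \<Phi>) = colorful_rank F' - colorful_rank F + 1"
    by (rule graded_poset_flag_card[OF tr re F1 bt st de])
  show "poset_rank ?S = colorful_rank F' - colorful_rank F - 1"
    by (rule graded_poset_rank[OF tr re F1 bt st de])
qed

lemma Least_le: "F \<in> colorful_faces G \<kappa> R \<Longrightarrow> (Least_Face, F) \<in> P"
  by (simp add: P_iff)

text \<open>The faces below \<open>F\<close> form the section from \<open>Least_Face\<close> to
  \<open>F\<close>; the rank -1 of \<open>Least_Face\<close> cancels the -1 in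
  \<open>section_rank\<close>.\<close>

lemma face_rank_eq:
  assumes "F \<in> colorful_faces G \<kappa> R" shows "face_rank P F = colorful_rank F"
proof -
  have "Restr P {H. (H, F) \<in> P} = poset_section P Least_Face F"
    unfolding poset_section_def using Least_le by (auto simp: P_iff)
  then show ?thesis
    unfolding face_rank_def using section_rank[OF Least_le[OF assms]] by simp
qed

section \<open>The polytope axioms\<close>

lemma top_face: obtains t where "t \<in> colorful_faces G \<kappa> R"
  "colorful_rank t = card R" "\<And>F. F \<in> colorful_faces G \<kappa> R \<Longrightarrow> (F, t) \<in> P"
proof -
  obtain x where x: "x \<in> fst G" using conn unfolding connected_graph_def by blast
  let ?t = "Face R (cls R x)"
  have "(F, ?t) \<in> P" if "F \<in> colorful_faces G \<kappa> R" for F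
    using that
  proof (cases rule: faces_cases)
    case (2 D y)
    then have "cls R x = cls R y" using x color_rel_all cls_eq_iff by blast
    then show ?thesis using 2 by (simp add: above_Face)
  qed (use x in \<open>auto simp: P_iff\<close>)
  then show thesis using that[of ?t] x by auto
qed

lemma P_flags:
  assumes "\<Phi> \<in> flags P" shows "finite \<Phi> \<and> card \<Phi> = card R + 2"
proof -
  obtain t where t: "t \<in> colorful_faces G \<kappa> R"
    "colorful_rank t = card R" "\<And>F. F \<in> colorful_faces G \<kappa> R \<Longrightarrow> (F, t) \<in> P"
    using top_face by blast
  have "P = poset_section P Least_Face t"
    unfolding poset_section_def using Least_le t by (auto simp: P_iff)
  then show ?thesis using section_flag[OF Least_le[OF t(1)], of \<Phi>] assms t(2) by simp
qed

text \<open>Above the least face, every face is joined to one of its vertices, and a walk in the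
  graph with colors in \<open>D\<close> becomes a path alternating between vertices and edges; these
  edges are proper faces because \<open>D\<close> has at least two colors. Above a proper face the
  section is a Boolean lattice with at least three atoms, so the join of two atoms is still proper
  and connects them.\<close>

lemma P_connected_section:
  assumes le: "(F, F') \<in> P" shows "connected_section P F F'"
proof (cases "colorful_rank F' - colorful_rank F - 1 \<le> 1")
  case True
  then show ?thesis
    unfolding connected_section_def using section_rank[OF le] by (simp add: Let_def)
next
  case False
  let ?S = "poset_section P F F'"
  let ?Q = "{H. (F, H) \<in> P \<and> (H, F') \<in> P} - {F, F'}"
  let ?r = "{(x, y). x \<in> ?Q \<and> y \<in> ?Q \<and> ((x, y) \<in> ?S \<or> (y, x) \<in> ?S)}"
  have r1: "(x, y) \<in> ?r\<^sup>*" if "x \<in> ?Q" "y \<in> ?Q" "(x, y) \<in> P \<or> (y, x) \<in> P" for x y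
    using that unfolding poset_section_def by (intro r_into_rtrancl) auto
  have Fin: "F \<in> colorful_faces G \<kappa> R" using le by (simp add: P_iff)
  have "(A, B) \<in> ?r\<^sup>*" if A: "A \<in> ?Q" and B: "B \<in> ?Q" for A B
  proof (cases rule: faces_cases[OF Fin, case_names least face])
    case least
    have "F' \<in> colorful_faces G \<kappa> R" using le by (simp add: P_iff)
    then obtain D z where D: "F' = Face D (cls D z)" "D \<subseteq> R" "z \<in> fst G"
      using False least by (cases rule: faces_cases) auto
    have cD: "card D \<ge> 2" using False least D by simp
    have vQ: "Face {} (cls {} x) \<in> ?Q" if "x \<in> cls D z" for x
    proof -
      have x: "x \<in> fst G" "cls D x = cls D z"
        using that D color_rel_vertices by (auto simp: cls_eq_iff color_rel_sym)
      then have "(Face {} (cls {} x), F') \<in> P" using D by (auto simp: above_Face)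
      then show ?thesis using least D x cD by (auto simp: P_iff)
    qed
    have ex: "\<exists>x \<in> cls D z. (H, Face {} (cls {} x)) \<in> ?r\<^sup>*" if H: "H \<in> ?Q" for H
    proof -
      have "H \<in> colorful_faces G \<kappa> R" using H by (simp add: P_iff)
      then obtain E x where E: "H = Face E (cls E x)" "E \<subseteq> R" "x \<in> fst G"
        using H least by (cases rule: faces_cases) auto
      then have "(Face E (cls E x), F') \<in> P" using H by simp
      then have "F' = Face D (cls D x)" using above_Face[OF E(2,3)] D by auto
      then have x: "x \<in> cls D z" using D by auto
      moreover have "(Face {} (cls {} x), H) \<in> P" using E by (simp add: above_Face)
      ultimately show ?thesis using r1[OF H vQ[OF x]] by blast
    qed
    have vv: "(Face {} (cls {} z), Face {} (cls {} x)) \<in> ?r\<^sup>*" if "x \<in> cls D z" for x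
    proof -
      from that have "(z, x) \<in> {(x, y). {x, y} \<in> snd G \<and> \<kappa> {x, y} \<in> D}\<^sup>*"
        unfolding color_rel_def by simp
      then show ?thesis
      proof (induction rule: rtrancl_induct)
        case (step x y)
        let ?c = "\<kappa> {x, y}"
        have c: "?c \<in> D" "{x, y} \<in> snd G" using step by auto
        have x: "x \<in> cls D z" using step(1) unfolding color_rel_def by simp
        have y: "y \<in> cls D z"
          using rtrancl_into_rtrancl[OF step(1,2)] unfolding color_rel_def by simp
        have V: "x \<in> fst G" "y \<in> fst G" using c edge_vertices by auto
        let ?e = "Face {?c} (cls {?c} x)"
        have ce: "cls {?c} x = cls {?c} y"
          unfolding cls_eq_iff unfolding color_rel_def using c by (intro r_into_rtrancl) auto
        have xD: "cls D x = cls D z" using x by (simp add: cls_eq_iff color_rel_sym)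
        have "(?e, F') \<in> P" using c D V xD by (subst above_Face) auto
        moreover have "?e \<noteq> F'" using cD D by auto
        ultimately have eQ: "?e \<in> ?Q" using least by (auto simp: P_iff)
        have "(Face {} (cls {} x), ?e) \<in> P" using V c D by (subst above_Face) auto
        moreover have "(Face {} (cls {} y), ?e) \<in> P" using V c D ce by (subst above_Face) auto
        ultimately have "(Face {} (cls {} x), ?e) \<in> ?r\<^sup>*" "(?e, Face {} (cls {} y)) \<in> ?r\<^sup>*"
          using r1[OF vQ[OF x] eQ] r1[OF eQ vQ[OF y]] by auto
        then show ?case using step.IH by (meson rtrancl_trans)
      qed simp
    qed
    have sy: "sym (?r\<^sup>*)" by (rule sym_rtrancl) (auto simp: sym_def)
    obtain a b where ab: "a \<in> cls D z" "(A, Face {} (cls {} a)) \<in> ?r\<^sup>*"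
       "b \<in> cls D z" "(B, Face {} (cls {} b)) \<in> ?r\<^sup>*"
      using ex[OF A] ex[OF B] by blast
    show ?thesis
      using vv[OF ab(1)] vv[OF ab(3)] ab(2,4) sy by (meson rtrancl_trans symD)
  next
    case (face D x)
    then obtain E where E: "D \<subseteq> E" "E \<subseteq> R" "F' = Face E (cls E x)"
      using above_FaceE[OF le face] by metis
    have cD: "card E \<ge> card D + 3" using False face E by simp
    let ?f = "\<lambda>D. Face D (cls D x)"
    have fle: "(?f D1, ?f D2) \<in> P" if "D1 \<subseteq> D2" "D2 \<subseteq> R" for D1 D2
      using that face by (subst above_Face) auto
    have fQ: "?f D1 \<in> ?Q" if "D \<subset> D1" "D1 \<subset> E" for D1
    proof -
      have "(F, ?f D1) \<in> P" "(?f D1, F') \<in> P" using fle[of D D1] fle[of D1 E] that E face by auto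
      then show ?thesis using that face E by auto
    qed
    have Qf: "\<exists>D1. D \<subset> D1 \<and> D1 \<subset> E \<and> H = ?f D1" if "H \<in> ?Q" for H
    proof -
      have "(F, H) \<in> P" using that by simp
      then obtain D1 where D1: "D \<subseteq> D1" "D1 \<subseteq> R" "H = ?f D1"
        using above_FaceE[OF _ face] by metis
      then have "(?f D1, ?f E) \<in> P" using that E by simp
      then have "D1 \<subseteq> E" by (simp add: P_iff)
      then show ?thesis using D1 that face E by auto
    qed
    obtain A1 where A1: "D \<subset> A1" "A1 \<subset> E" "A = ?f A1" using Qf[OF A] by blast
    obtain B1 where B1: "D \<subset> B1" "B1 \<subset> E" "B = ?f B1" using Qf[OF B] by blast
    obtain a b where ab: "a \<in> A1 - D" "b \<in> B1 - D" using A1 B1 by blast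
    have "card (insert a (insert b D)) \<le> card D + 2"
      using finite_colors[OF face(2)] by (simp add: card_insert_if)
    then have "insert a (insert b D) \<noteq> E" "insert a D \<noteq> E" "insert b D \<noteq> E"
      using cD finite_colors[OF face(2)] by (auto simp: card_insert_if split: if_splits)
    moreover have "a \<in> E" "b \<in> E" using ab A1 B1 by auto
    ultimately have ps: "D \<subset> insert a D" "D \<subset> insert b D" "D \<subset> insert a (insert b D)"
      "insert a D \<subset> E" "insert b D \<subset> E" "insert a (insert b D) \<subset> E"
      using ab E(1) by auto
    have q: "?f (insert a D) \<in> ?Q" "?f (insert b D) \<in> ?Q" "?f (insert a (insert b D)) \<in> ?Q"
      using fQ[OF ps(1,4)] fQ[OF ps(2,5)] fQ[OF ps(3,6)] by simp_all
    have R': "insert a (insert b D) \<subseteq> R" "A1 \<subseteq> R" "B1 \<subseteq> R" using ab A1 B1 E by auto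
    have "(?f (insert a D), A) \<in> P" "(?f (insert b D), B) \<in> P"
      "(?f (insert a D), ?f (insert a (insert b D))) \<in> P"
      "(?f (insert b D), ?f (insert a (insert b D))) \<in> P"
      unfolding A1(3) B1(3) by (rule fle; use ab A1 B1 R' in blast)+
    then have "(A, ?f (insert a D)) \<in> ?r\<^sup>*" "(?f (insert a D), ?f (insert a (insert b D))) \<in> ?r\<^sup>*"
      "(?f (insert a (insert b D)), ?f (insert b D)) \<in> ?r\<^sup>*" "(?f (insert b D), B) \<in> ?r\<^sup>*"
      using r1 A B q by simp_all
    then show ?thesis by (meson rtrancl_trans)
  qed
  then show ?thesis
    unfolding connected_section_def section_Field[OF le] Let_def by blast
qed

text \<open>Between the least face and an edge lie the two ends of the edge, the second one being
  the unique neighbor in its color. Between proper faces whose color sets differ by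
  \<open>{a, b}\<close>, the choice is which of the two colors is added first.\<close>

lemma P_diamond:
  assumes le: "(F, F') \<in> P" and rk: "colorful_rank F' = colorful_rank F + 2"
  shows "card {H. (F, H) \<in> P \<and> (H, F') \<in> P \<and> colorful_rank H = colorful_rank F + 1} = 2"
proof -
  have Fin: "F \<in> colorful_faces G \<kappa> R" using le by (simp add: P_iff)
  show ?thesis
  proof (cases rule: faces_cases[OF Fin, case_names least face])
    case least
    have "F' \<in> colorful_faces G \<kappa> R" using le by (simp add: P_iff)
    then obtain D x where D: "F' = Face D (cls D x)" "D \<subseteq> R" "x \<in> fst G"
      using rk least by (cases rule: faces_cases) auto
    then have "card D = 1" using rk least by simp
    then obtain c where c: "D = {c}" by (auto simp: card_1_singleton_iff)
    obtain y where y: "{x, y} \<in> snd G" "\<kappa> {x, y} = c" using neighbor D c by blast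
    then have xy: "x \<noteq> y" "y \<in> fst G" using edge_vertices by auto
    have cl: "cls {c} x = {x, y}" using cls_single y D c by simp
    have e0: "cls {} z = {z}" for z by (auto simp: color_rel_empty)
    have "{H. (F, H) \<in> P \<and> (H, F') \<in> P \<and> colorful_rank H = colorful_rank F + 1} = {Face {} {x}, Face {} {y}}"
      (is "?A = ?B")
    proof
      show "?A \<subseteq> ?B"
      proof
        fix H assume H: "H \<in> ?A"
        then have "H \<in> colorful_faces G \<kappa> R" by (simp add: P_iff)
        then show "H \<in> ?B"
        proof (cases rule: faces_cases)
          case (2 E z)
          then have "E = {}" using H \<open>F = Least_Face\<close> finite_colors[of E] by simp
          then show ?thesis using 2 H D c cl e0 by (auto simp: P_iff)
        qed (use H least in auto)
      qed
      show "?B \<subseteq> ?A" using least D c cl xy e0 by (auto simp: P_iff)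
    qed
    then show ?thesis using xy by simp
  next
    case (face D x)
    then obtain E where E: "D \<subseteq> E" "E \<subseteq> R" "F' = Face E (cls E x)"
        using above_FaceE[OF le face] by metis
    have fD: "finite D" "finite E" using finite_colors face E by auto
    have "card E = card D + 2" using rk face E by simp
    then have "card (E - D) = 2" using E fD by (simp add: card_Diff_subset)
    then obtain a b where ab: "E - D = {a, b}" "a \<noteq> b" by (auto simp: card_2_iff)
    let ?f = "\<lambda>D. Face D (cls D x)"
    have "{H. (F, H) \<in> P \<and> (H, F') \<in> P \<and> colorful_rank H = colorful_rank F + 1}
        = {?f (insert a D), ?f (insert b D)}" (is "?A = ?B")
    proof
      show "?A \<subseteq> ?B"
      proof
        fix H assume H: "H \<in> ?A"
        then obtain D1 where D1: "D \<subseteq> D1" "D1 \<subseteq> R" "H = ?f D1" using face above_Face by auto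
        then have "(?f D1, ?f E) \<in> P" using H E by simp
        then have s: "D1 \<subseteq> E" by (simp add: P_iff)
        have "int (card D1) = int (card D) + 1" using H face D1 by simp
        then have "card (D1 - D) = 1" using D1 fD by (simp add: card_Diff_subset)
        then obtain e where e: "D1 - D = {e}" by (auto simp: card_1_singleton_iff)
        then have "e \<in> {a, b}" "D1 = insert e D" using ab s D1 by auto
        then show "H \<in> ?B" using D1 by auto
      qed
      have "?f (insert e D) \<in> ?A" if "e \<in> E - D" for e
      proof -
        have "(?f D, ?f (insert e D)) \<in> P" using that face(2,3) E(1,2) by (subst above_Face) auto
        moreover have "(?f (insert e D), ?f E) \<in> P" using that face(2,3) E(1,2) by (subst above_Face) auto
        ultimately show ?thesis using that face E fD by simp
      qed
      then show "?B \<subseteq> ?A" using ab by blast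
    qed
    moreover have "?f (insert a D) \<noteq> ?f (insert b D)" using ab by auto
    ultimately show ?thesis by simp
  qed
qed

lemma P_abstract_polytope: "abstract_polytope (card R) P"
  unfolding abstract_polytope_def
proof (intro conjI)
  show "\<exists>b \<in> Field P. \<forall>F \<in> Field P. (b, F) \<in> P" using Least_le Field_P Least_in by metis
  show "\<exists>t \<in> Field P. \<forall>F \<in> Field P. (F, t) \<in> P" using top_face Field_P by metis
  show "\<forall>(F, F') \<in> P. face_rank P F' = face_rank P F + 2 \<longrightarrow>
        card {H. face_rank P H = face_rank P F + 1 \<and> (F, H) \<in> P \<and> (H, F') \<in> P} = 2"
  proof (clarify)
    fix F F' assume a: "(F, F') \<in> P" "face_rank P F' = face_rank P F + 2"
    have F: "F \<in> colorful_faces G \<kappa> R" "F' \<in> colorful_faces G \<kappa> R" using a by (auto simp: P_iff)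
    have "{H. face_rank P H = face_rank P F + 1 \<and> (F, H) \<in> P \<and> (H, F') \<in> P} =
      {H. (F, H) \<in> P \<and> (H, F') \<in> P \<and> colorful_rank H = colorful_rank F + 1}"
      using F by (auto simp: face_rank_eq P_iff)
    then show "card {H. face_rank P H = face_rank P F + 1 \<and> (F, H) \<in> P \<and> (H, F') \<in> P} = 2"
      using P_diamond[OF a(1)] a(2) F by (simp add: face_rank_eq)
  qed
qed (use P_partial_order P_flags P_connected_section in auto)

section \<open>Vertices, vertex figures and the 1-skeleton\<close>

lemma rank_0_iff: "F \<in> colorful_faces G \<kappa> R \<and> colorful_rank F = 0 \<longleftrightarrow> (\<exists>x \<in> fst G. F = Face {} {x})"
proof
  assume a: "F \<in> colorful_faces G \<kappa> R \<and> colorful_rank F = 0"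
  then have "F \<in> colorful_faces G \<kappa> R" by simp
  then show "\<exists>x \<in> fst G. F = Face {} {x}"
  proof (cases rule: faces_cases)
    case (2 D x)
    then have "D = {}" using a finite_colors[of D] by simp
    then show ?thesis using 2 by (auto simp: color_rel_empty)
  qed (use a in auto)
next
  assume "\<exists>x \<in> fst G. F = Face {} {x}"
  moreover have "{x} = cls {} x" for x by (auto simp: color_rel_empty)
  ultimately show "F \<in> colorful_faces G \<kappa> R \<and> colorful_rank F = 0" by auto
qed

lemma rank_0_face: "{v \<in> Field P. face_rank P v = 0} = (\<lambda>v. Face {} {v}) ` fst G"
proof -
  have "{v \<in> Field P. face_rank P v = 0} = {v. v \<in> colorful_faces G \<kappa> R \<and> colorful_rank v = 0}"
    using face_rank_eq by auto
  then show ?thesis unfolding rank_0_iff by blast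
qed

lemma P_simple_polytope: "simple_polytope (card R) P"
  unfolding simple_polytope_def
proof (intro conjI P_abstract_polytope ballI impI)
  fix F assume F: "F \<in> Field P" "face_rank P F = 0"
  then obtain x where x: "x \<in> fst G" "F = Face {} {x}" using rank_0_face by blast
  then have Fx: "F = Face {} (cls {} x)" by (auto simp: color_rel_empty)
  obtain h where h: "bij_betw h R {..<card R}"
    using ex_bij_betw_finite_nat[OF fin] atLeast0LessThan by metis
  let ?f = "\<lambda>D. Face D (cls D x)"
  have up: "{H. (F, H) \<in> P} = ?f ` Pow R" unfolding Fx using above_Face[of "{}" x] x by auto
  have V_iff: "(A, B) \<in> vertex_figure P F \<longleftrightarrow> A \<in> ?f ` Pow R \<and> B \<in> ?f ` Pow R \<and> (A, B) \<in> P" for A B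
    unfolding vertex_figure_def up by auto
  have f_iff: "(?f A, ?f B) \<in> vertex_figure P F \<longleftrightarrow> A \<subseteq> B \<and> B \<subseteq> R" for A B
  proof
    assume "(?f A, ?f B) \<in> vertex_figure P F"
    then show "A \<subseteq> B \<and> B \<subseteq> R" by (auto simp: V_iff P_iff)
  next
    assume "A \<subseteq> B \<and> B \<subseteq> R"
    then have "(?f A, ?f B) \<in> P" "A \<in> Pow R" "B \<in> Pow R" using x by (auto simp: above_Face)
    then show "(?f A, ?f B) \<in> vertex_figure P F" unfolding V_iff by (intro conjI imageI)
  qed
  have FV: "Field (vertex_figure P F) = ?f ` Pow R"
  proof
    show "Field (vertex_figure P F) \<subseteq> ?f ` Pow R" unfolding Field_def by (auto simp: V_iff)
    show "?f ` Pow R \<subseteq> Field (vertex_figure P F)"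
    proof
      fix H assume "H \<in> ?f ` Pow R"
      then have "(H, H) \<in> vertex_figure P F" using f_iff by auto
      then show "H \<in> Field (vertex_figure P F)" unfolding Field_def by blast
    qed
  qed
  have FS: "Field (simplex_on (card R)) = Pow {..<card R}"
    unfolding simplex_on_def Field_def by auto
  \<comment> \<open>A face of the vertex figure goes to the set of numbers of its colors.
    \<open>Least_Face\<close> is not in the vertex figure; its value is a dummy.\<close>
  let ?col = "\<lambda>H. case H of Face D X \<Rightarrow> h ` D | Least_Face \<Rightarrow> {}"
  have hP: "bij_betw (image h) (Pow R) (Pow {..<card R})" using bij_betw_Pow[OF h] .
  have "bij_betw (?col \<circ> ?f) (Pow R) (Pow {..<card R})" using hP by (simp add: o_def)
  moreover have "bij_betw ?f (Pow R) (?f ` Pow R)" by (auto simp: bij_betw_def inj_on_def)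
  ultimately have "bij_betw ?col (?f ` Pow R) (Pow {..<card R})"
    using bij_betw_comp_iff[of ?f "Pow R" "?f ` Pow R" ?col "Pow {..<card R}"] by blast
  moreover have "(?f A, ?f B) \<in> vertex_figure P F \<longleftrightarrow> (?col (?f A), ?col (?f B)) \<in> simplex_on (card R)"
    if "A \<in> Pow R" "B \<in> Pow R" for A B
  proof -
    have "inj_on h R" "h ` R = {..<card R}" using h by (auto simp: bij_betw_def)
    then have "h ` A \<subseteq> h ` B \<longleftrightarrow> A \<subseteq> B" "h ` B \<subseteq> {..<card R}"
      using that inj_on_image_subset_iff[of h R A B] by auto
    then show ?thesis using f_iff that by (simp add: simplex_on_def)
  qed
  ultimately show "poset_isomorphic (vertex_figure P F) (simplex_on (card R))"
    unfolding poset_isomorphic_def FV FS by (intro exI[of _ ?col]) blast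
qed

text \<open>A rank 1 face has a single color, so by \<open>cls_single\<close> its class is an edge
  of the graph; conversely an edge is a class of its own color. The vertices below a face are the
  singletons of elements of its class, which makes the two edge sets correspond.\<close>

lemma P_one_skeleton: "graph_isomorphism (\<lambda>v. Face {} {v}) G (one_skeleton P)"
proof -
  have vert: "{v \<in> Field P. face_rank P v = 0} = (\<lambda>v. Face {} {v}) ` fst G"
    by (rule rank_0_face)
  have below: "{v \<in> Field P. face_rank P v = 0 \<and> (v, e) \<in> P} = (\<lambda>v. Face {} {v}) ` X"
    if "e \<in> Field P" "e = Face D X" for e D X
  proof -
    have "X \<subseteq> fst G" using that color_rel_vertices by auto
    moreover have "{v \<in> Field P. face_rank P v = 0 \<and> (v, e) \<in> P} =
        {v \<in> {v \<in> Field P. face_rank P v = 0}. (v, e) \<in> P}" by auto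
    then have "{v \<in> Field P. face_rank P v = 0 \<and> (v, e) \<in> P} =
        (\<lambda>v. Face {} {v}) ` {x \<in> fst G. (Face {} {x}, e) \<in> P}"
      unfolding vert by auto
    moreover have "(Face {} {x}, e) \<in> P \<longleftrightarrow> x \<in> X" if "x \<in> fst G" for x
    proof -
      have "{x} = cls {} x" by (auto simp: color_rel_empty)
      then have "Face {} {x} \<in> colorful_faces G \<kappa> R" using that by (subst Face_in) auto
      then show ?thesis using \<open>e \<in> Field P\<close> \<open>e = Face D X\<close> by (auto simp: P_iff)
    qed
    moreover have "{x \<in> fst G. (Face {} {x}, e) \<in> P} = X" using calculation by auto
    ultimately show ?thesis by simp
  qed
  have edge: "(\<exists>D X. e = Face D X \<and> X \<in> snd G)" if "e \<in> Field P" "face_rank P e = 1" for e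
  proof -
    have e: "e \<in> colorful_faces G \<kappa> R" "colorful_rank e = 1" using that face_rank_eq by auto
    from e(1) show ?thesis
    proof (cases rule: faces_cases)
      case (2 D x)
      then obtain c where c: "D = {c}" using e by (auto simp: card_1_singleton_iff)
      then obtain y where "{x, y} \<in> snd G" "\<kappa> {x, y} = c" using 2 neighbor by blast
      then show ?thesis using 2 c cls_single[of x y c] by auto
    qed (use e in auto)
  qed
  have edge': "\<exists>D. Face D X \<in> Field P \<and> face_rank P (Face D X) = 1" if XG: "X \<in> snd G" for X
  proof -
    obtain x y where xy: "X = {x, y}" "x \<in> fst G" "y \<in> fst G" "x \<noteq> y" using edgeE[OF XG] by blast
    let ?c = "\<kappa> X"
    have c: "?c \<in> R" using proper XG unfolding proper_edge_coloring_def by auto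
    have X: "X = cls {?c} x" using cls_single[of x y ?c] xy c XG by simp
    have "{?c} \<subseteq> R" using c by simp
    then have "Face {?c} X \<in> colorful_faces G \<kappa> R"
      unfolding Face_in by (intro conjI bexI[of _ x] X xy(2))
    then have "Face {?c} X \<in> Field P" "face_rank P (Face {?c} X) = 1"
      by (simp_all only: Field_P face_rank_eq colorful_rank.simps) simp
    then show ?thesis by blast
  qed
  show ?thesis
    unfolding graph_isomorphism_def one_skeleton_def fst_conv snd_conv vert
  proof (intro conjI)
    show "bij_betw (\<lambda>v. Face {} {v}) (fst G) ((\<lambda>v. Face {} {v}) ` fst G)"
      by (auto simp: bij_betw_def inj_on_def)
    show "(image (\<lambda>v. Face {} {v})) ` snd G =
      {{v \<in> Field P. face_rank P v = 0 \<and> (v, e) \<in> P} |e. e \<in> Field P \<and> face_rank P e = 1}"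
      (is "?A = ?B")
    proof
      show "?A \<subseteq> ?B"
      proof
        fix Z assume "Z \<in> ?A"
        then obtain X where X: "X \<in> snd G" "Z = (\<lambda>v. Face {} {v}) ` X" by auto
        then obtain D where D: "Face D X \<in> Field P" "face_rank P (Face D X) = 1" using edge' by blast
        then show "Z \<in> ?B" using below[OF D(1) refl] X(2) by blast
      qed
      show "?B \<subseteq> ?A"
      proof
        fix Z assume "Z \<in> ?B"
        then obtain e where e: "e \<in> Field P" "face_rank P e = 1"
          "Z = {v \<in> Field P. face_rank P v = 0 \<and> (v, e) \<in> P}" by auto
        then obtain D X where "e = Face D X" "X \<in> snd G" using edge by blast
        then show "Z \<in> ?A" using below[OF e(1)] e(3) by auto
      qed
    qed
  qed
qed

end

section \<open>Orientation\<close>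

text \<open>Twice the signed area of the triangle \<open>a b c\<close>, positive if it is traversed
  counterclockwise.\<close>

definition orient :: "complex \<Rightarrow> complex \<Rightarrow> complex \<Rightarrow> real" where
  "orient a b c = (Re b - Re a) * (Im c - Im a) - (Im b - Im a) * (Re c - Re a)"

lemma orient_rotate: "orient b c a = orient a b c"
  unfolding orient_def by (simp add: algebra_simps)

lemma orient_swap: "orient b a c = - orient a b c" "orient a c b = - orient a b c"
  unfolding orient_def by (simp_all add: algebra_simps)

lemma orient_degenerate [simp]: "orient a a b = 0" "orient a b a = 0" "orient b a a = 0"
  unfolding orient_def by simp_all

lemma orient_affine:
  "orient a b ((1 - t) *\<^sub>R x + t *\<^sub>R y) = (1 - t) * orient a b x + t * orient a b y"
  unfolding orient_def by (simp add: algebra_simps)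

lemma orient_eq_0E:
  assumes "orient a b c = 0" "a \<noteq> b" obtains s where "c = (1 - s) *\<^sub>R a + s *\<^sub>R b"
proof (cases "Re a = Re b")
  case True
  then have ne: "Im a \<noteq> Im b" using assms by (auto simp: complex_eq_iff)
  then have re: "Re c = Re a" using assms True unfolding orient_def by auto
  define s where "s = (Im c - Im a) / (Im b - Im a)"
  have "s * (Im b - Im a) = Im c - Im a" using ne unfolding s_def by simp
  then have "Im c = (1 - s) * Im a + s * Im b" by (simp add: algebra_simps)
  then show thesis using True re by (intro that[of s]) (auto simp: complex_eq_iff algebra_simps)
next
  case False
  define s where "s = (Re c - Re a) / (Re b - Re a)"
  have s: "s * (Re b - Re a) = Re c - Re a" using False unfolding s_def by simp
  have "(Re b - Re a) * (Im c - Im a) = (Im b - Im a) * (Re c - Re a)"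
    using assms unfolding orient_def by simp
  then have "(Re b - Re a) * (Im c - Im a) = (Re b - Re a) * (s * (Im b - Im a))"
    unfolding s[symmetric] by (simp add: mult_ac)
  then have "Im c - Im a = s * (Im b - Im a)" using False by simp
  then have "Im c = (1 - s) * Im a + s * Im b" "Re c = (1 - s) * Re a + s * Re b"
    using s by (auto simp: algebra_simps)
  then show thesis by (intro that[of s]) (simp add: complex_eq_iff)
qed

lemma orient_in_segment:
  assumes "x \<in> closed_segment a b" shows "orient a b x = 0"
  using assms by (auto simp: closed_segment_def orient_affine)

text \<open>\<open>orient a b\<close> is affine and changes sign along the segment from
  \<open>c\<close> to \<open>d\<close>; it vanishes at parameter \<open>t\<close>, so that point
  \<open>x\<close> is on the line through \<open>a\<close> and \<open>b\<close>. The opposite signs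
  of \<open>a\<close> and \<open>b\<close> with respect to the line through \<open>c\<close> and
  \<open>d\<close> force the parameter \<open>s\<close> of \<open>x\<close> strictly between 0 and
  1.\<close>

lemma open_segments_meet:
  assumes "orient a b c < 0" "orient a b d > 0" "orient c d a > 0" "orient c d b < 0"
  shows "open_segment a b \<inter> open_segment c d \<noteq> {}"
proof -
  have ne: "a \<noteq> b" "c \<noteq> d" using assms by auto
  define t where "t = orient a b c / (orient a b c - orient a b d)"
  define x where "x = (1 - t) *\<^sub>R c + t *\<^sub>R d"
  have t: "0 < t" "t < 1" using assms unfolding t_def by (auto simp: divide_simps)
  have "orient a b x = 0"
    using assms unfolding x_def orient_affine t_def by (simp add: divide_simps)
  then obtain s where s: "x = (1 - s) *\<^sub>R a + s *\<^sub>R b" using ne orient_eq_0E by blast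
  have "x \<in> closed_segment c d" unfolding closed_segment_def x_def using t by auto
  then have "orient c d x = 0" by (rule orient_in_segment)
  then have z: "(1 - s) * orient c d a + s * orient c d b = 0" unfolding s orient_affine by simp
  have "0 < s"
  proof (rule ccontr)
    assume "\<not> 0 < s"
    then have "s * orient c d b \<ge> 0" "(1 - s) * orient c d a > 0"
      using assms by (auto simp: mult_nonpos_nonpos)
    then show False using z by linarith
  qed
  moreover have "s < 1"
  proof (rule ccontr)
    assume "\<not> s < 1"
    then have "s * orient c d b < 0" "(1 - s) * orient c d a \<le> 0"
      using assms by (auto simp: mult_pos_neg mult_nonpos_nonneg)
    then show False using z by linarith
  qed
  ultimately have "x \<in> open_segment a b" unfolding in_segment using ne s by blast
  moreover have "x \<in> open_segment c d" unfolding in_segment using ne t x_def by blast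
  ultimately show ?thesis by blast
qed

text \<open>Barycentric coordinates: the weight of a corner of \<open>b c d\<close> is the area of
  the triangle formed by \<open>a\<close> and the opposite side, divided by the total
  \<open>s\<close>.\<close>

lemma orient_inside_triangle:
  assumes "orient a b c > 0" "orient a c d > 0" "orient a d b > 0"
  shows "a \<in> convex hull {b, c, d}"
proof -
  define s where "s = orient a c d + orient a d b + orient a b c"
  have s: "s > 0" using assms unfolding s_def by simp
  have *: "s *\<^sub>R a = orient a c d *\<^sub>R b + orient a d b *\<^sub>R c + orient a b c *\<^sub>R d"
    unfolding s_def orient_def complex_eq_iff by (simp add: algebra_simps)
  have "a = (1 / s) *\<^sub>R (s *\<^sub>R a)" using s by simp
  also have "\<dots> = (orient a c d / s) *\<^sub>R b + (orient a d b / s) *\<^sub>R c + (orient a b c / s) *\<^sub>R d"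
    unfolding * by (simp add: scaleR_right_distrib)
  finally have "a = (orient a c d / s) *\<^sub>R b + (orient a d b / s) *\<^sub>R c + (orient a b c / s) *\<^sub>R d" .
  moreover have "orient a c d / s + orient a d b / s + orient a b c / s = 1"
    using s unfolding s_def by (simp add: add_divide_distrib[symmetric])
  moreover have "orient a c d / s \<ge> 0" "orient a d b / s \<ge> 0" "orient a b c / s \<ge> 0"
    using assms s by auto
  ultimately show ?thesis unfolding convex_hull_3 by blast
qed

section \<open>Enumerating a finite cyclic order\<close>

text \<open>Cutting the cyclic order at a point \<open>w\<close> gives a linear order
  \<open>lt\<close> with least element \<open>w\<close>. Its ranks number \<open>W\<close> from
  \<open>0\<close> to \<open>N - 1\<close>, and this numbering is continued periodically.\<close>

lemma cyclic_order_enumeration: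
  fixes cc :: "'a \<Rightarrow> 'a \<Rightarrow> 'a \<Rightarrow> bool"
  assumes fin: "finite W" and N: "int (card W) = N" "N > 0"
    and cyc: "\<And>a b c. cc a b c \<Longrightarrow> cc b c a"
    and asym: "\<And>a b c. cc a b c \<Longrightarrow> \<not> cc a c b"
    and tr: "\<And>a b c d. {a, b, c, d} \<subseteq> W \<Longrightarrow> cc a b c \<Longrightarrow> cc a c d \<Longrightarrow> cc a b d"
    and total: "\<And>a b c. {a, b, c} \<subseteq> W \<Longrightarrow> a \<noteq> b \<Longrightarrow> b \<noteq> c \<Longrightarrow> a \<noteq> c \<Longrightarrow> cc a b c \<or> cc a c b"
  obtains u :: "int \<Rightarrow> 'a" where "range u = W" "\<And>i j. u i = u j \<longleftrightarrow> i mod N = j mod N"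
    "\<And>i j k. i < j \<Longrightarrow> j < k \<Longrightarrow> k < i + N \<Longrightarrow> cc (u i) (u j) (u k)"
proof -
  have "W \<noteq> {}" using N by auto
  then obtain w where w: "w \<in> W" by blast
  define lt where "lt y x \<longleftrightarrow> (y = w \<and> x \<noteq> w) \<or> cc w y x" for x y
  have irr: "\<not> cc a b b" "\<not> cc a a b" "\<not> cc a b a" for a b using asym cyc by blast+
  have lt_irr: "\<not> lt x x" for x using irr by (auto simp: lt_def)
  have lt_tr: "lt x z" if "lt x y" "lt y z" "{x, y, z} \<subseteq> W" for x y z
    using that irr tr[of w x y z] w by (auto simp: lt_def)
  have lt_tot: "lt x y \<or> lt y x" if "x \<noteq> y" "x \<in> W" "y \<in> W" for x y
    using that total[of w x y] w by (auto simp: lt_def)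
  have lt_cc: "cc x y z" if a: "lt x y" "lt y z" "{x, y, z} \<subseteq> W" for x y z
  proof (cases "x = w")
    case True then show ?thesis using a irr by (auto simp: lt_def)
  next
    case False
    then have c: "cc w x y" "cc w y z" using a irr by (auto simp: lt_def)
    have ne: "x \<noteq> y" "y \<noteq> z" using lt_irr a by auto
    have "x \<noteq> z" using asym c by blast
    show ?thesis
    proof (rule ccontr)
      assume "\<not> cc x y z"
      then have "cc x z y" using total[of x y z] a ne \<open>x \<noteq> z\<close> by auto
      \<comment> \<open>Seen from \<open>y\<close>, the order would be \<open>w\<close>,
        \<open>x\<close>, \<open>z\<close>, whereas \<open>cc w y z\<close> puts \<open>z\<close>
        before \<open>w\<close>.\<close>
      then have "cc y w x" "cc y x z" using c cyc by blast+
      then have "cc y w z" using tr[of y w x z] a w by auto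
      then have "cc w z y" using cyc by blast
      then show False using asym c by blast
    qed
  qed
  define rk where "rk x = card {y \<in> W. lt y x}" for x
  have rk_less: "rk x < rk y" if "lt x y" "x \<in> W" "y \<in> W" for x y
    unfolding rk_def
  proof (rule psubset_card_mono)
    show "{z \<in> W. lt z x} \<subset> {z \<in> W. lt z y}" using that lt_tr[of _ x y] lt_irr by auto
  qed (use fin in auto)
  have inj: "inj_on rk W"
  proof (rule inj_onI)
    fix x y assume "x \<in> W" "y \<in> W" "rk x = rk y"
    then show "x = y" using lt_tot[of x y] rk_less[of x y] rk_less[of y x] by auto
  qed
  have "rk x < card W" if "x \<in> W" for x
    unfolding rk_def by (rule psubset_card_mono[OF fin]) (use that lt_irr in auto)
  then have img: "rk ` W = {..<card W}"
    by (intro card_subset_eq) (auto simp: card_image[OF inj])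
  define f where "f = inv_into W rk"
  have f: "f k \<in> W" "rk (f k) = k" if "k < card W" for k
    using that img unfolding f_def by (auto intro: inv_into_into f_inv_into_f)
  have f_rk: "f (rk x) = x" if "x \<in> W" for x using that inj unfolding f_def by simp
  have f_lt: "lt (f i) (f j)" if "i < j" "j < card W" for i j
  proof -
    have "f i \<noteq> f j" using f[of i] f[of j] that by auto
    then show ?thesis using lt_tot[of "f i" "f j"] rk_less[of "f j" "f i"] f[of i] f[of j] that by auto
  qed
  have f_cc: "cc (f i) (f j) (f k)" if "i < j" "j < k" "k < card W" for i j k
    using lt_cc[of "f i" "f j" "f k"] f_lt[of i j] f_lt[of j k] f[of i] f[of j] f[of k] that by auto
  define u where "u i = f (nat (i mod N))" for i
  have modN: "0 \<le> i mod N" "i mod N < N" "nat (i mod N) < card W" for i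
    using N by (auto simp: nat_less_iff)
  have uW: "u i \<in> W" for i unfolding u_def using f modN by auto
  have 1: "range u = W"
  proof
    show "W \<subseteq> range u"
    proof
      fix x assume x: "x \<in> W"
      then have "rk x < card W" using img by auto
      then have "u (int (rk x)) = x" unfolding u_def using f_rk x N by simp
      then show "x \<in> range u" by (metis rangeI)
    qed
  qed (use uW in auto)
  have 2: "u i = u j \<longleftrightarrow> i mod N = j mod N" for i j
  proof
    assume "u i = u j"
    then have "nat (i mod N) = nat (j mod N)" using f(2) modN(3) unfolding u_def by metis
    then show "i mod N = j mod N" using modN by (simp add: eq_nat_nat_iff)
  qed (simp add: u_def)
  have 3: "cc (u i) (u j) (u k)" if a: "i < j" "j < k" "k < i + N" for i j k
  proof -
    \<comment> \<open>\<open>q\<close> starts the period containing \<open>i\<close>. The indices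
      \<open>j\<close> and \<open>k\<close> lie in this period or in the next one, so the residues
      increase up to a rotation of the triple.\<close>
    define q where "q = N * (i div N)"
    have "q + i mod N = i" unfolding q_def by simp
    then have q: "q \<le> i" "i < q + N" "i mod N = i - q" using modN[of i] by linarith+
    have r: "x mod N = (if x < q + N then x - q else x - q - N)" if "q \<le> x" "x < q + 2 * N" for x
    proof -
      have "x mod N = (x - q) mod N" unfolding q_def by (simp add: mod_eq_dvd_iff)
      also have "\<dots> = (if x < q + N then x - q else x - q - N)"
        using that mod_pos_pos_trivial[of "x - q" N] mod_pos_pos_trivial[of "x - q - N" N]
        by (auto simp: minus_mod_self2[of "x - q" N])
      finally show ?thesis .
    qed
    have ri: "i mod N = i - q" using q by simp
    have rj: "j mod N = (if j < q + N then j - q else j - q - N)" by (rule r) (use a q in auto)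
    have rk': "k mod N = (if k < q + N then k - q else k - q - N)" by (rule r) (use a q in auto)
    have m: "nat (x mod N) < nat (y mod N)" if "x mod N < y mod N" for x y :: int
      using that modN by (simp add: nat_mono_iff zless_nat_eq_int_zless)
    consider "i mod N < j mod N" "j mod N < k mod N" | "j mod N < k mod N" "k mod N < i mod N"
      | "k mod N < i mod N" "i mod N < j mod N"
      using ri rj rk' a q by (auto split: if_splits; linarith)
    then show ?thesis
    proof cases
      case 1 then show ?thesis unfolding u_def by (intro f_cc m modN(3))
    next
      case 2
      then have "cc (u j) (u k) (u i)" unfolding u_def by (intro f_cc m modN(3))
      then show ?thesis using cyc by blast
    next
      case 3
      then have "cc (u k) (u i) (u j)" unfolding u_def by (intro f_cc m modN(3))
      then show ?thesis using cyc by blast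
    qed
  qed
  show thesis using that 1 2 3 by blast
qed

section \<open>Centrally symmetric polygons\<close>

lemma point_reflection_involution [simp]: "point_reflection p (point_reflection p x) = x"
  unfolding point_reflection_def by simp

lemma point_reflection_affine:
  "point_reflection p ((1 - t) *\<^sub>R x + t *\<^sub>R y) = (1 - t) *\<^sub>R point_reflection p x + t *\<^sub>R point_reflection p y"
  unfolding point_reflection_def by (simp add: complex_eq_iff algebra_simps)

lemma point_reflection_closed_segment:
  "point_reflection p ` closed_segment a b = closed_segment (point_reflection p a) (point_reflection p b)"
  unfolding closed_segment_def by (auto simp: point_reflection_affine image_iff) (metis point_reflection_affine)+

lemma point_reflection_image [simp]: "point_reflection p ` (point_reflection p ` S) = S"
  by (simp add: image_image)

lemma orient_point_reflection:
  "orient (point_reflection p a) (point_reflection p b) (point_reflection p c) = orient a b c"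
  unfolding orient_def point_reflection_def by (simp add: algebra_simps)

locale cs_polygon =
  fixes K :: "complex set" and p :: complex and m :: int
  assumes polygon: "convex_polygon (nat (2 * m)) K" and symm: "centrally_symmetric K p" and m2: "m \<ge> 2"
begin

abbreviation refl :: "complex \<Rightarrow> complex" where "refl \<equiv> point_reflection p"

lemma card_vertices: "int (card (vertices K)) = 2 * m"
  using polygon m2 unfolding convex_polygon_def by simp

lemma finite_vertices: "finite (vertices K)"
proof (rule ccontr)
  assume "infinite (vertices K)"
  then show False using card_vertices m2 by simp
qed

lemma K_props: "polytope K" "convex K" "compact K"
  using polygon polytope_imp_convex polytope_imp_compact unfolding convex_polygon_def by auto

lemma K_hull: "K = convex hull (vertices K)"
  unfolding vertices_def using Krein_Milman_Minkowski K_props by blast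

lemma vertex_in_K: "v \<in> vertices K \<Longrightarrow> v \<in> K"
  unfolding vertices_def extreme_point_of_def by auto

text \<open>Removing an extreme point from a convex set leaves a convex set, which contains the hull
  of \<open>S\<close>.\<close>

lemma vertex_not_in_hull:
  assumes "v \<in> vertices K" "S \<subseteq> K" "v \<notin> S" shows "v \<notin> convex hull S"
proof -
  have "convex (K - {v})"
    using assms(1) extreme_point_of_stillconvex[OF K_props(2)] unfolding vertices_def by auto
  then have "convex hull S \<subseteq> K - {v}" using assms by (intro hull_minimal) auto
  then show ?thesis by auto
qed

text \<open>Of three collinear points one lies between the other two, which is impossible for
  extreme points; the parameter \<open>s\<close> of \<open>c\<close> on the line through
  \<open>a\<close> and \<open>b\<close> tells which one it is.\<close>

lemma orient_nonzero:
  assumes v: "{a, b, c} \<subseteq> vertices K" and ne: "a \<noteq> b" "b \<noteq> c" "a \<noteq> c"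
  shows "orient a b c \<noteq> 0"
proof
  assume "orient a b c = 0"
  then obtain s where s: "c = (1 - s) *\<^sub>R a + s *\<^sub>R b" using ne orient_eq_0E by blast
  have no: "x \<notin> closed_segment y z" if "{x, y, z} \<subseteq> vertices K" "x \<noteq> y" "x \<noteq> z" for x y z
    unfolding segment_convex_hull using that vertex_in_K by (intro vertex_not_in_hull) auto
  have in_seg: "x \<in> closed_segment y z" if "x = (1 - t) *\<^sub>R y + t *\<^sub>R z" "0 \<le> t" "t \<le> 1" for x y z :: complex and t
    using that unfolding closed_segment_def by auto
  consider "s < 0" | "0 \<le> s" "s \<le> 1" | "s > 1" by linarith
  then show False
  proof cases
    case 1
    have "(1 - s) *\<^sub>R a = c - s *\<^sub>R b" using s by (simp add: algebra_simps)
    moreover have "a = (1 / (1 - s)) *\<^sub>R ((1 - s) *\<^sub>R a)" using 1 by simp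
    ultimately have "a = (1 / (1 - s)) *\<^sub>R (c - s *\<^sub>R b)" by simp
    also have "\<dots> = (1 - (- s / (1 - s))) *\<^sub>R c + (- s / (1 - s)) *\<^sub>R b"
    proof -
      have "1 - (- s / (1 - s)) = 1 / (1 - s)" using 1 by (simp add: field_simps)
      then show ?thesis by (simp add: scaleR_diff_right)
    qed
    finally have "a \<in> closed_segment c b" by (rule in_seg) (use 1 in \<open>auto simp: field_simps\<close>)
    then show False using no[of a c b] v ne by auto
  next
    case 2
    then show False using in_seg[OF s] no[of c a b] v ne by auto
  next
    case 3
    have "s *\<^sub>R b = c - (1 - s) *\<^sub>R a" using s by (simp add: algebra_simps)
    moreover have "b = (1 / s) *\<^sub>R (s *\<^sub>R b)" using 3 by simp
    ultimately have "b = (1 / s) *\<^sub>R (c - (1 - s) *\<^sub>R a)" by simp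
    also have "\<dots> = (1 - (1 / s)) *\<^sub>R a + (1 / s) *\<^sub>R c"
    proof -
      have "(1 / s) * (1 - s) = - (1 - 1 / s)" using 3 by (simp add: field_simps)
      then have "(1 / s) *\<^sub>R ((1 - s) *\<^sub>R a) = - ((1 - 1 / s) *\<^sub>R a)"
        unfolding scaleR_scaleR by (simp only: scaleR_minus_left)
      then show ?thesis by (simp only: scaleR_diff_right) simp
    qed
    finally have "b \<in> closed_segment a c" by (rule in_seg) (use 3 in \<open>auto simp: field_simps\<close>)
    then show False using no[of b a c] v ne by auto
  qed
qed

text \<open>Otherwise \<open>a\<close> would lie in the triangle \<open>b c d\<close>, so orientation is a cyclic order on the vertices.\<close>

lemma orient_trans:
  assumes v: "{a, b, c, d} \<subseteq> vertices K" and o: "orient a b c > 0" "orient a c d > 0"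
  shows "orient a b d > 0"
proof (rule ccontr)
  assume n: "\<not> orient a b d > 0"
  have ne: "a \<noteq> b" "a \<noteq> c" "a \<noteq> d" using o by auto
  have "b \<noteq> d" using o orient_swap(2)[of a b c] by auto
  then have "orient a d b > 0" using orient_nonzero[of a b d] v ne n orient_swap(2)[of a b d] by auto
  then have "a \<in> convex hull {b, c, d}" using o orient_inside_triangle by blast
  then show False using vertex_not_in_hull[of a "{b, c, d}"] v ne vertex_in_K by auto
qed

lemma refl_vertex: "v \<in> vertices K \<Longrightarrow> refl v \<in> vertices K"
proof -
  assume v: "v \<in> vertices K"
  have K: "x \<in> K \<Longrightarrow> refl x \<in> K" for x using symm unfolding centrally_symmetric_def by blast
  have "refl v \<notin> open_segment a b" if ab: "a \<in> K" "b \<in> K" for a b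
  proof
    assume "refl v \<in> open_segment a b"
    then obtain t where t: "a \<noteq> b" "0 < t" "t < 1" "refl v = (1 - t) *\<^sub>R a + t *\<^sub>R b"
      unfolding in_segment by blast
    then have "v = (1 - t) *\<^sub>R refl a + t *\<^sub>R refl b"
      by (metis point_reflection_affine point_reflection_involution)
    moreover have "refl a \<noteq> refl b" using t by (metis point_reflection_involution)
    ultimately have "v \<in> open_segment (refl a) (refl b)" unfolding in_segment using t by blast
    then show False using v K ab unfolding vertices_def extreme_point_of_def by blast
  qed
  then show "refl v \<in> vertices K" using v K unfolding vertices_def extreme_point_of_def by blast
qed

lemma center_in_segment: "p \<in> closed_segment v (refl v)"
proof -
  have "p = (1 - 1 / 2) *\<^sub>R v + (1 / 2) *\<^sub>R refl v"
    unfolding point_reflection_def by (simp add: complex_eq_iff diff_divide_distrib)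
  then show ?thesis unfolding closed_segment_def by (intro CollectI exI[of _ "1 / 2"]) simp
qed

text \<open>A fixed vertex would be the center, hence the midpoint of any other vertex and its
  reflection, and so not extreme.\<close>

lemma refl_neq:
  assumes "v \<in> vertices K" shows "refl v \<noteq> v"
proof
  assume "refl v = v"
  then have vp: "v = p" unfolding point_reflection_def by (simp add: complex_eq_iff)
  have "\<not> vertices K \<subseteq> {v}" using card_vertices m2 card_mono[of "{v}" "vertices K"] by auto
  then obtain w where w: "w \<in> vertices K" "w \<noteq> v" by blast
  have "v \<noteq> refl w" using w vp unfolding point_reflection_def by (auto simp: complex_eq_iff)
  then have "v \<notin> convex hull {w, refl w}"
    using w assms refl_vertex[OF w(1)] vertex_in_K by (intro vertex_not_in_hull) auto
  then show False using center_in_segment[of w] vp unfolding segment_convex_hull by auto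
qed

text \<open>\<open>Q\<close>, the segment with the open half plane to its left, is convex and
  contains the vertices, hence \<open>K\<close>. So \<open>orient a b\<close> is nonnegative on
  \<open>K\<close> and vanishes there only on the segment, as for a supporting line.\<close>

lemma segment_edge_of:
  assumes ab: "a \<in> vertices K" "b \<in> vertices K" "a \<noteq> b"
    and pos: "\<And>w. w \<in> vertices K \<Longrightarrow> w \<noteq> a \<Longrightarrow> w \<noteq> b \<Longrightarrow> orient a b w > 0"
  shows "closed_segment a b edge_of K"
proof -
  let ?s = "closed_segment a b"
  have o0: "orient a b x = 0" if "x \<in> ?s" for x using that by (rule orient_in_segment)
  define Q where "Q = ?s \<union> {x. orient a b x > 0}"
  have Q0: "orient a b x \<ge> 0" if "x \<in> Q" for x using that o0 unfolding Q_def by force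
  have "convex Q"
    unfolding convex_alt
  proof (intro ballI allI impI)
    fix x y and t :: real assume xy: "x \<in> Q" "y \<in> Q" and t: "0 \<le> t \<and> t \<le> 1"
    let ?z = "(1 - t) *\<^sub>R x + t *\<^sub>R y"
    show "?z \<in> Q"
    proof (cases "orient a b ?z > 0")
      case False
      then have "(1 - t) * orient a b x + t * orient a b y \<le> 0" unfolding orient_affine by simp
      moreover have "(1 - t) * orient a b x \<ge> 0" "t * orient a b y \<ge> 0" using Q0 xy t by auto
      ultimately have z: "(1 - t) * orient a b x = 0" "t * orient a b y = 0" by linarith+
      consider "t = 0" | "t = 1" | "orient a b x = 0" "orient a b y = 0" using z by auto
      then show ?thesis
      proof cases
        case 3
        then have "x \<in> ?s" "y \<in> ?s" using xy unfolding Q_def by auto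
        then have "?z \<in> ?s" using convex_closed_segment[of a b] t unfolding convex_alt by blast
        then show ?thesis unfolding Q_def by blast
      qed (use xy in auto)
    qed (simp add: Q_def)
  qed
  moreover have "vertices K \<subseteq> Q" using pos unfolding Q_def by auto
  ultimately have KQ: "K \<subseteq> Q" using K_hull hull_minimal by metis
  have "?s \<subseteq> K" using closed_segment_subset[OF _ _ K_props(2)] ab vertex_in_K by auto
  moreover have "c \<in> ?s \<and> d \<in> ?s" if cd: "c \<in> K" "d \<in> K" "x \<in> ?s" "x \<in> open_segment c d" for c d x
  proof -
    obtain t where t: "0 < t" "t < 1" "x = (1 - t) *\<^sub>R c + t *\<^sub>R d" using cd unfolding in_segment by blast
    have "(1 - t) * orient a b c + t * orient a b d = 0" using o0[OF cd(3)] t orient_affine by metis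
    moreover have "(1 - t) * orient a b c \<ge> 0" "t * orient a b d \<ge> 0" using Q0 KQ cd t by auto
    ultimately have "(1 - t) * orient a b c = 0" "t * orient a b d = 0" by linarith+
    then have "orient a b c = 0" "orient a b d = 0" using t by auto
    then show ?thesis using KQ cd unfolding Q_def by auto
  qed
  ultimately have "?s face_of K" unfolding face_of_def by blast
  moreover have "aff_dim ?s = 1" unfolding segment_convex_hull aff_dim_convex_hull using ab aff_dim_2 by simp
  ultimately show ?thesis unfolding edge_of_def by blast
qed

text \<open>The point reflection preserves the cyclic order, hence commutes with the successor and is a
  rotation \<open>i \<mapsto> i + k\<close>; being an involution without fixed vertices, it has \<open>k = m\<close>.\<close>

lemma vertex_enumeration:
  obtains u :: "int \<Rightarrow> complex" where "range u = vertices K"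
    "\<And>i j. u i = u j \<longleftrightarrow> i mod (2 * m) = j mod (2 * m)"
    "\<And>i j k. i < j \<Longrightarrow> j < k \<Longrightarrow> k < i + 2 * m \<Longrightarrow> orient (u i) (u j) (u k) > 0"
    "\<And>i. refl (u i) = u (i + m)"
proof -
  let ?N = "2 * m"
  have N0: "0 < ?N" using m2 by simp
  have cyc: "orient b c a > 0" if "orient a b c > 0" for a b c using that orient_rotate by simp
  have asym: "\<not> orient a c b > 0" if "orient a b c > 0" for a b c
    using that orient_swap(2)[of a b c] by simp
  have total: "orient a b c > 0 \<or> orient a c b > 0"
    if "{a, b, c} \<subseteq> vertices K" "a \<noteq> b" "b \<noteq> c" "a \<noteq> c" for a b c
    using orient_nonzero[OF that] orient_swap(2)[of a b c] by linarith
  obtain u :: "int \<Rightarrow> complex" where u: "range u = vertices K"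
    "\<And>i j. u i = u j \<longleftrightarrow> i mod ?N = j mod ?N"
    "\<And>i j k. i < j \<Longrightarrow> j < k \<Longrightarrow> k < i + ?N \<Longrightarrow> orient (u i) (u j) (u k) > 0"
    by (rule cyclic_order_enumeration[OF finite_vertices card_vertices N0,
          of "\<lambda>a b c. orient a b c > 0", OF cyc asym orient_trans total]) blast+
  have uV: "u i \<in> vertices K" for i using u(1) by auto
  have window: "\<exists>k. l \<le> k \<and> k < l + ?N \<and> v = u k" if v: "v \<in> vertices K" for v l
  proof -
    obtain i where i: "v = u i" using v u(1) by auto
    let ?k = "l + (i - l) mod ?N"
    have "0 \<le> (i - l) mod ?N" "(i - l) mod ?N < ?N" using m2 by auto
    moreover have "u i = u ?k" unfolding u(2) by (simp add: mod_add_right_eq)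
    ultimately show ?thesis using i by (intro exI[of _ ?k]) auto
  qed
  have window': "\<exists>k. l < k \<and> k < l + ?N \<and> v = u k" if v: "v \<in> vertices K" "v \<noteq> u l" for v l
    using window[OF v(1), of l] v(2) by (metis order_le_less)
  have step: "refl (u (j + 1)) = u (l + 1)" if jl: "refl (u j) = u l" for j l
  proof -
    have "(j + 1) mod ?N \<noteq> j mod ?N"
    proof
      assume "(j + 1) mod ?N = j mod ?N"
      then have "?N dvd 1" by (simp add: mod_eq_dvd_iff)
      then show False using m2 zdvd_imp_le[of ?N 1] by auto
    qed
    then have "u (j + 1) \<noteq> u j" using u(2) by blast
    then have "refl (u (j + 1)) \<noteq> u l" unfolding jl[symmetric] by (metis point_reflection_involution)
    then obtain l' where l': "l < l'" "l' < l + ?N" "refl (u (j + 1)) = u l'"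
      using window' refl_vertex uV by metis
    \<comment> \<open>Otherwise \<open>u (l + 1)\<close> lies strictly between \<open>u l\<close>
      and \<open>u l'\<close>, and its reflection strictly between \<open>u j\<close> and the
      successor \<open>u (j + 1)\<close>.\<close>
    have "l' = l + 1"
    proof (rule ccontr)
      assume n: "l' \<noteq> l + 1"
      then have "orient (u l) (u (l + 1)) (u l') > 0" using l' by (intro u(3)) auto
      then have o: "orient (u j) (refl (u (l + 1))) (u (j + 1)) > 0"
        unfolding jl[symmetric] l'(3)[symmetric]
        by (metis orient_point_reflection point_reflection_involution)
      then have "refl (u (l + 1)) \<noteq> u j" by auto
      then obtain q where q: "j < q" "q < j + ?N" "refl (u (l + 1)) = u q"
        using window' refl_vertex uV by metis
      have "q \<noteq> j + 1" using o q(3) by auto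
      then have "orient (u j) (u (j + 1)) (u q) > 0" using q by (intro u(3)) auto
      then show False using o q(3) orient_swap(2)[of "u j" "u q" "u (j + 1)"] by simp
    qed
    then show ?thesis using l' by simp
  qed
  obtain k where k: "0 \<le> k" "k < ?N" "refl (u 0) = u k" using window[OF refl_vertex[OF uV], of 0 0] by auto
  have shift: "refl (u (int n)) = u (k + int n)" for n
  proof (induction n)
    case (Suc n) then show ?case using step[of "int n" "k + int n"] by (simp add: add.commute add.left_commute)
  qed (use k in simp)
  have shift': "refl (u i) = u (i + k)" for i
  proof -
    have "0 \<le> i mod ?N" using m2 by simp
    then have "refl (u (i mod ?N)) = u (k + i mod ?N)" using shift[of "nat (i mod ?N)"] by simp
    moreover have "u (i mod ?N) = u i" "u (k + i mod ?N) = u (i + k)"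
      unfolding u(2) by (simp_all add: mod_add_right_eq add.commute)
    ultimately show ?thesis by simp
  qed
  have "u (k + k) = u 0" using shift'[of k] k(3) by (metis point_reflection_involution)
  then have "?N dvd 2 * k" unfolding u(2) by (simp add: mod_eq_0_iff_dvd)
  then have mk: "m dvd k" by simp
  have k0: "k \<noteq> 0" using refl_neq[OF uV] k by metis
  have "m dvd k - m" using mk by simp
  then have "k \<noteq> m \<Longrightarrow> m \<le> \<bar>k - m\<bar>" using dvd_imp_le_int[of "k - m" m] m2 by auto
  then have "k = m" using k(1,2) k0 by linarith
  then show thesis using that u shift' by blast
qed

end

locale enum_polygon = cs_polygon +
  fixes u :: "int \<Rightarrow> complex"
  assumes range_u: "range u = vertices K"
    and u_eq_iff: "\<And>i j. u i = u j \<longleftrightarrow> i mod (2 * m) = j mod (2 * m)"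
    and orient_u: "\<And>i j k. i < j \<Longrightarrow> j < k \<Longrightarrow> k < i + 2 * m \<Longrightarrow> orient (u i) (u j) (u k) > 0"
    and refl_u: "\<And>i. refl (u i) = u (i + m)"
begin

text \<open>Chords are compared inside a window of \<open>2 * m\<close> consecutive indices. Since \<open>u\<close> is
  periodic, the two sides of the chord \<open>(i, j)\<close> are the index intervals \<open>[i, j]\<close> and \<open>[j, i + 2 * m]\<close>,
  so statements about one side also cover the other.\<close>

definition ch :: "int \<Rightarrow> int \<Rightarrow> complex set" where
  "ch i j = closed_segment (u i) (u j)"

lemma u_vertex: "u i \<in> vertices K"
  using range_u by auto

lemma u_window_eq: "w \<le> i \<Longrightarrow> i < w + 2 * m \<Longrightarrow> w \<le> j \<Longrightarrow> j < w + 2 * m \<Longrightarrow> u i = u j \<longleftrightarrow> i = j"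
proof -
  assume a: "w \<le> i" "i < w + 2 * m" "w \<le> j" "j < w + 2 * m"
  show ?thesis
  proof
    assume "u i = u j"
    then have d: "2 * m dvd i - j" unfolding u_eq_iff by (simp add: mod_eq_dvd_iff)
    show "i = j"
    proof (rule ccontr)
      assume "i \<noteq> j"
      then have "2 * m \<le> \<bar>i - j\<bar>" using d dvd_imp_le_int[of "i - j" "2 * m"] by simp
      then show False using a by linarith
    qed
  qed simp
qed

lemma u_periodic [simp]: "u (i + 2 * m) = u i" "u (i - 2 * m) = u i"
  unfolding u_eq_iff by simp_all

lemma vertex_window:
  assumes "v \<in> vertices K" obtains k where "w \<le> k" "k < w + 2 * m" "v = u k"
proof -
  obtain i where i: "v = u i" using assms range_u by auto
  let ?k = "w + (i - w) mod (2 * m)"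
  have "0 \<le> (i - w) mod (2 * m)" "(i - w) mod (2 * m) < 2 * m" using m2 by auto
  moreover have "u i = u ?k" unfolding u_eq_iff by (simp add: mod_add_right_eq)
  ultimately show thesis using i by (intro that[of ?k]) auto
qed

lemma ch_commute: "ch i j = ch j i"
  unfolding ch_def by (rule closed_segment_commute)

lemma ch_periodic [simp]: "ch (i + 2 * m) j = ch i j" "ch i (j + 2 * m) = ch i j"
  "ch (i - 2 * m) j = ch i j" "ch i (j - 2 * m) = ch i j"
  unfolding ch_def by simp_all

lemma ch_eq_iff:
  assumes "w \<le> i" "i < j" "j < w + 2 * m" "w \<le> k" "k < l" "l < w + 2 * m"
  shows "ch i j = ch k l \<longleftrightarrow> i = k \<and> j = l"
proof -
  have "ch i j = ch k l \<longleftrightarrow> {u i, u j} = {u k, u l}"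
    unfolding ch_def by (rule closed_segment_eq)
  also have "\<dots> \<longleftrightarrow> i = k \<and> j = l \<or> i = l \<and> j = k"
    unfolding doubleton_eq_iff using assms by (simp add: u_window_eq[of w])
  finally show ?thesis using assms by auto
qed

lemma refl_ch: "refl ` ch i j = ch (i + m) (j + m)"
  unfolding ch_def by (simp add: point_reflection_closed_segment refl_u)

section \<open>Crossing chords, sides and diameters in terms of indices\<close>

lemma orient_window:
  assumes "w \<le> a" "a < b" "b < w + 2 * m" "w \<le> z" "z < w + 2 * m"
  shows "a < z \<Longrightarrow> z < b \<Longrightarrow> orient (u a) (u b) (u z) < 0"
    and "z < a \<or> b < z \<Longrightarrow> orient (u a) (u b) (u z) > 0"
    and "z = a \<or> z = b \<Longrightarrow> orient (u a) (u b) (u z) = 0"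
proof -
  show "orient (u a) (u b) (u z) < 0" if "a < z" "z < b"
    using orient_u[of a z b] orient_swap(2)[of "u a" "u z" "u b"] that assms by simp
  show "orient (u a) (u b) (u z) > 0" if "z < a \<or> b < z"
    using orient_u[of z a b] orient_u[of a b z] orient_rotate[of "u a" "u b" "u z"] that assms by auto
  show "orient (u a) (u b) (u z) = 0" if "z = a \<or> z = b" using that by auto
qed

lemma interleaved_open_segments_meet:
  assumes "a < x" "x < b" "b < y" "y < a + 2 * m"
  shows "open_segment (u a) (u b) \<inter> open_segment (u x) (u y) \<noteq> {}"
  using assms by (intro open_segments_meet orient_window[of a]) auto

text \<open>If the indices do not interleave, both ends of the second chord lie weakly on the same
  side of the first, and one of them strictly because the chords differ. Then no inner point of the
  second chord is on the line of the first.\<close>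

lemma crossing_ch:
  assumes "w \<le> a" "a < b" "b < w + 2 * m" "w \<le> x" "x < y" "y < w + 2 * m"
  shows "crossing (ch a b) (ch x y) \<longleftrightarrow> (a < x \<and> x < b \<and> b < y) \<or> (x < a \<and> a < y \<and> y < b)"
proof -
  have ne: "u a \<noteq> u b" "u x \<noteq> u y" using assms u_window_eq[of w] by auto
  have ri: "rel_interior (ch a b) = open_segment (u a) (u b)" "rel_interior (ch x y) = open_segment (u x) (u y)"
    unfolding ch_def using ne by (simp_all add: rel_interior_closed_segment)
  show ?thesis
  proof
    assume c: "crossing (ch a b) (ch x y)"
    then have "ch a b \<noteq> ch x y" unfolding crossing_def by simp
    then have neq: "\<not> (a = x \<and> b = y)" by auto
    obtain z where z: "z \<in> open_segment (u a) (u b)" "z \<in> open_segment (u x) (u y)"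
      using c unfolding crossing_def ri by blast
    then obtain t where t: "0 < t" "t < 1" "z = (1 - t) *\<^sub>R u x + t *\<^sub>R u y" unfolding in_segment by blast
    have "orient (u a) (u b) z = 0" using z(1)
      by (intro orient_in_segment) (simp add: open_segment_def)
    then have s: "(1 - t) * orient (u a) (u b) (u x) + t * orient (u a) (u b) (u y) = 0"
      unfolding t orient_affine .
    note ow = orient_window[of w a b x] orient_window[of w a b y]
    show "(a < x \<and> x < b \<and> b < y) \<or> (x < a \<and> a < y \<and> y < b)"
    proof (rule ccontr)
      assume n: "\<not> ?thesis"
      consider (inside) "a \<le> x" "y \<le> b" | (outside) "x \<le> a \<or> b \<le> x" "y \<le> a \<or> b \<le> y"
        using n assms by linarith
      then show False
      proof cases
        case inside
        then have "a < x \<or> y < b" using neq by auto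
        then have "orient (u a) (u b) (u x) \<le> 0" "orient (u a) (u b) (u y) \<le> 0"
          "orient (u a) (u b) (u x) < 0 \<or> orient (u a) (u b) (u y) < 0"
          using ow assms inside by (smt (verit))+
        then show False using s t by (smt (verit) mult_pos_neg mult_nonneg_nonpos)
      next
        case outside
        then have "\<not> (x = a \<or> x = b) \<or> \<not> (y = a \<or> y = b)" using neq assms by auto
        then have "orient (u a) (u b) (u x) \<ge> 0" "orient (u a) (u b) (u y) \<ge> 0"
          "orient (u a) (u b) (u x) > 0 \<or> orient (u a) (u b) (u y) > 0"
          using ow assms outside by (smt (verit))+
        then show False using s t by (smt (verit) mult_pos_pos mult_nonneg_nonneg)
      qed
    qed
  next
    assume i: "(a < x \<and> x < b \<and> b < y) \<or> (x < a \<and> a < y \<and> y < b)"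
    then have "open_segment (u a) (u b) \<inter> open_segment (u x) (u y) \<noteq> {}"
      using interleaved_open_segments_meet[of a x b y] interleaved_open_segments_meet[of x a y b] assms by auto
    moreover have "ch a b \<noteq> ch x y" using i assms ch_eq_iff[of w a b x y] by auto
    ultimately show "crossing (ch a b) (ch x y)" unfolding crossing_def ri by simp
  qed
qed

text \<open>If \<open>u i\<close> and \<open>u j\<close> are not neighbors, the chord joining the
  two neighbors of \<open>u i\<close> passes through an inner point of \<open>ch i j\<close>. A face
  containing that point contains the ends of this chord, which would be collinear with
  \<open>u i\<close> and \<open>u j\<close>.\<close>

lemma edge_of_ch:
  assumes "i < j" "j < i + 2 * m"
  shows "ch i j edge_of K \<longleftrightarrow> j = i + 1 \<or> j = i + 2 * m - 1"
proof
  assume e: "ch i j edge_of K"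
  then have f: "ch i j face_of K" unfolding edge_of_def by simp
  show "j = i + 1 \<or> j = i + 2 * m - 1"
  proof (rule ccontr)
    assume n: "\<not> (j = i + 1 \<or> j = i + 2 * m - 1)"
    then obtain x where x: "x \<in> open_segment (u i) (u j)" "x \<in> open_segment (u (i + 1)) (u (i + 2 * m - 1))"
      using interleaved_open_segments_meet[of i "i + 1" j "i + 2 * m - 1"] assms by auto
    then have "u (i + 1) \<in> ch i j"
      using f u_vertex vertex_in_K unfolding face_of_def ch_def open_segment_def by blast
    then have "orient (u i) (u j) (u (i + 1)) = 0" unfolding ch_def by (rule orient_in_segment)
    then show False using orient_window(1)[of i i j "i + 1"] n assms by auto
  qed
next
  assume j: "j = i + 1 \<or> j = i + 2 * m - 1"
  have ne: "u i \<noteq> u j" using u_window_eq[of i i j] assms by auto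
  from j show "ch i j edge_of K"
  proof
    assume j: "j = i + 1"
    show ?thesis
      unfolding ch_def
    proof (rule segment_edge_of)
      fix v assume v: "v \<in> vertices K" "v \<noteq> u i" "v \<noteq> u j"
      obtain k where k: "i \<le> k" "k < i + 2 * m" "v = u k" using vertex_window[OF v(1)] by blast
      then have "k \<noteq> i" "k \<noteq> j" using v by auto
      then show "orient (u i) (u j) v > 0" using k orient_window(2)[of i i j k] assms j by auto
    qed (use ne u_vertex in auto)
  next
    assume j: "j = i + 2 * m - 1"
    show ?thesis
      unfolding ch_commute[of i j] unfolding ch_def
    proof (rule segment_edge_of)
      fix v assume v: "v \<in> vertices K" "v \<noteq> u j" "v \<noteq> u i"
      obtain k where k: "i \<le> k" "k < i + 2 * m" "v = u k" using vertex_window[OF v(1)] by blast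
      then have "k \<noteq> i" "k \<noteq> j" using v by auto
      then have "orient (u i) (u j) v < 0" using k orient_window(1)[of i i j k] assms j by auto
      then show "orient (u j) (u i) v > 0" using orient_swap(1)[of "u i" "u j" v] by simp
    qed (use ne u_vertex in auto)
  qed
qed

text \<open>The center is the midpoint of \<open>u i\<close> and \<open>u (i + m)\<close>, so a
  chord from \<open>u i\<close> through it lies on the line to the antipode, and no three vertices
  are collinear.\<close>

lemma central_ch:
  assumes "i < j" "j < i + 2 * m"
  shows "central p (ch i j) \<longleftrightarrow> j = i + m"
proof
  assume "j = i + m"
  then show "central p (ch i j)" using center_in_segment[of "u i"] unfolding refl_u central_def ch_def by simp
next
  assume "central p (ch i j)"
  then have "orient (u i) (u j) p = 0" unfolding central_def ch_def by (rule orient_in_segment)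
  then have 0: "orient (u i) (u j) (u (i + m)) = 0"
    unfolding refl_u[symmetric] orient_def point_reflection_def by (simp add: algebra_simps)
  show "j = i + m"
  proof (rule ccontr)
    assume "j \<noteq> i + m"
    then have "{u i, u j, u (i + m)} \<subseteq> vertices K" "u i \<noteq> u j" "u j \<noteq> u (i + m)" "u i \<noteq> u (i + m)"
      using u_vertex assms m2 u_window_eq[of i] by auto
    then show False using orient_nonzero 0 by blast
  qed
qed

end

section \<open>Flips of triangulations\<close>

context enum_polygon
begin

text \<open>Sides of \<open>K\<close> and diagonals of \<open>T\<close> are treated alike because
  both occur as sides of the triangles.\<close>

definition adj :: "complex set set \<Rightarrow> int \<Rightarrow> int \<Rightarrow> bool" where
  "adj T i j \<longleftrightarrow> ch i j edge_of K \<or> ch i j \<in> T"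

lemma adj_commute: "adj T i j \<longleftrightarrow> adj T j i"
  unfolding adj_def by (simp add: ch_commute)

lemma adj_periodic [simp]: "adj T (i + 2 * m) j = adj T i j" "adj T i (j + 2 * m) = adj T i j"
  "adj T (i - 2 * m) j = adj T i j" "adj T i (j - 2 * m) = adj T i j"
  unfolding adj_def by simp_all

lemma adj_next [simp]: "adj T i (i + 1)"
  unfolding adj_def using edge_of_ch[of i "i + 1"] m2 by simp

lemma ch_diagonal_iff:
  assumes "i < j" "j < i + 2 * m"
  shows "ch i j \<in> diagonals K \<longleftrightarrow> i + 2 \<le> j \<and> j \<le> i + 2 * m - 2"
proof -
  have "u i \<noteq> u j" using u_window_eq[of i i j] assms by auto
  then have "ch i j \<in> diagonals K \<longleftrightarrow> \<not> ch i j edge_of K"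
    unfolding diagonals_def ch_def using u_vertex by (auto simp: doubleton_eq_iff closed_segment_commute)
  then show ?thesis using edge_of_ch[OF assms] assms by auto
qed

lemma diagonalE:
  assumes "d \<in> diagonals K"
  obtains i j where "w \<le> i" "i + 2 \<le> j" "j < w + 2 * m" "j \<le> i + 2 * m - 2" "d = ch i j"
proof -
  obtain a b where ab: "d = closed_segment a b" "a \<in> vertices K" "b \<in> vertices K" "a \<noteq> b"
    using assms unfolding diagonals_def by blast
  obtain i where i: "w \<le> i" "i < w + 2 * m" "a = u i" using vertex_window[OF ab(2)] by blast
  obtain j where j: "w \<le> j" "j < w + 2 * m" "b = u j" using vertex_window[OF ab(3)] by blast
  have d: "d = ch i j" "d = ch j i" using ab i j ch_commute unfolding ch_def by auto
  show thesis
  proof (cases "i < j")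
    case True
    then show ?thesis using that[of i j] d i j ch_diagonal_iff[of i j] assms by auto
  next
    case False
    then have "j < i" using ab i j by (cases "i = j") auto
    then show ?thesis using that[of j i] d i j ch_diagonal_iff[of j i] assms by auto
  qed
qed

lemma triangulation_memberE:
  assumes "triangulation_of K T" "d \<in> T"
  obtains i j where "w \<le> i" "i + 2 \<le> j" "j < w + 2 * m" "j \<le> i + 2 * m - 2" "d = ch i j"
  using assms diagonalE[of d w] unfolding triangulation_of_def by blast

lemma adj_not_interleaved:
  assumes T: "triangulation_of K T" and a: "adj T a b" "adj T x y"
    and o: "a < x" "x < b" "b < y" "y < a + 2 * m"
  shows False
proof -
  have "\<not> ch a b edge_of K" "\<not> ch x y edge_of K"
    using edge_of_ch[of a b] edge_of_ch[of x y] o by auto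
  then have "ch a b \<in> T" "ch x y \<in> T" using a unfolding adj_def by auto
  then have "\<not> crossing (ch a b) (ch x y)" using T unfolding triangulation_of_def by blast
  then show False using crossing_ch[of a a b x y] o by auto
qed

text \<open>This is the maximality of \<open>T\<close> in terms of indices, as
  \<open>adj_not_interleaved\<close> is its freedom from crossings.\<close>

lemma not_adj_interleaved:
  assumes T: "triangulation_of K T" and n: "\<not> adj T a b" and o: "w \<le> a" "a < b" "b < w + 2 * m"
  obtains x y where "w \<le> x" "x < y" "y < w + 2 * m" "ch x y \<in> T"
    "a < x \<and> x < b \<and> b < y \<or> x < a \<and> a < y \<and> y < b"
proof -
  have "ch a b \<in> diagonals K - T"
    using n edge_of_ch[of a b] ch_diagonal_iff[of a b] o unfolding adj_def by auto
  then obtain e where e: "e \<in> T" "crossing (ch a b) e" using T unfolding triangulation_of_def by blast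
  obtain x y where xy: "w \<le> x" "x + 2 \<le> y" "y < w + 2 * m" "e = ch x y"
    using triangulation_memberE[OF T e(1)] by metis
  then show thesis using that[of x y] e crossing_ch[of w a b x y] o by auto
qed

text \<open>The apex of the triangle on \<open>(i, j)\<close> is the last \<open>k\<close> before
  \<open>j\<close> joined to \<open>i\<close>. A diagonal separating \<open>k\<close> from
  \<open>j\<close> would cross \<open>(i, j)\<close> or \<open>(i, k)\<close>, or it would join
  \<open>i\<close> to a vertex between \<open>k\<close> and \<open>j\<close>.\<close>

lemma inner_apex:
  assumes T: "triangulation_of K T" and a: "adj T i j" and o: "i + 2 \<le> j" "j < i + 2 * m"
  obtains k where "i < k" "k < j" "adj T i k" "adj T k j"
proof -
  let ?S = "{k. i < k \<and> k < j \<and> adj T i k}"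
  have fin: "finite ?S" by (rule finite_subset[of _ "{i..j}"]) auto
  have "i + 1 \<in> ?S" using o by simp
  then have "Max ?S \<in> ?S" using Max_in[OF fin] by blast
  moreover define k where "k = Max ?S"
  ultimately have k: "i < k" "k < j" "adj T i k" by auto
  have mx: "x \<le> k" if "i < x" "x < j" "adj T i x" for x
    unfolding k_def using fin that by (intro Max_ge) auto
  have "adj T k j"
  proof (rule ccontr)
    assume "\<not> adj T k j"
    then obtain x y where xy: "i \<le> x" "x < y" "y < i + 2 * m" "ch x y \<in> T"
      "k < x \<and> x < j \<and> j < y \<or> x < k \<and> k < y \<and> y < j"
      using not_adj_interleaved[OF T, of k j i] k o by auto
    then have axy: "adj T x y" unfolding adj_def by simp
    from xy(5) show False
    proof
      assume "k < x \<and> x < j \<and> j < y"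
      then show False using adj_not_interleaved[OF T a axy] k xy by auto
    next
      assume h: "x < k \<and> k < y \<and> y < j"
      show False
      proof (cases "x = i")
        case True
        then show False using mx[of y] axy h k by auto
      next
        case False
        then show False using adj_not_interleaved[OF T k(3) axy] h xy by auto
      qed
    qed
  qed
  then show thesis using that k by blast
qed

text \<open>For \<open>k < k'\<close> the chords \<open>(i, k')\<close> and \<open>(k, j)\<close>
  interleave.\<close>

lemma inner_apex_unique:
  assumes T: "triangulation_of K T" and o: "i < k" "k < j" "i < k'" "k' < j" "j < i + 2 * m"
    and a: "adj T i k" "adj T k j" "adj T i k'" "adj T k' j"
  shows "k = k'"
proof (rule ccontr)
  assume "k \<noteq> k'"
  then consider "k < k'" | "k' < k" by linarith
  then show False
  proof cases
    case 1 then show False using adj_not_interleaved[OF T a(3,2)] o by auto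
  next
    case 2 then show False using adj_not_interleaved[OF T a(1,4)] o by auto
  qed
qed

text \<open>Only the four sides are required, not a diagonal; so the predicate describes the
  quadrilateral both before a flip and, rotated by one vertex, after it.\<close>

definition quad :: "complex set set \<Rightarrow> int \<Rightarrow> int \<Rightarrow> int \<Rightarrow> int \<Rightarrow> bool" where
  "quad T i k j l \<longleftrightarrow> i < k \<and> k < j \<and> j < l \<and> l < i + 2 * m \<and>
     adj T i k \<and> adj T k j \<and> adj T j l \<and> adj T l i"

lemma quad_rotate: "quad T i k j l \<Longrightarrow> quad T k j l (i + 2 * m)"
  unfolding quad_def by (auto simp: adj_commute)

lemma quad_exists:
  assumes T: "triangulation_of K T" and d: "ch i j \<in> T" and o: "i < j" "j < i + 2 * m"
  obtains k l where "quad T i k j l"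
proof -
  have "ch i j \<in> diagonals K" using T d unfolding triangulation_of_def by blast
  then have o': "i + 2 \<le> j" "j \<le> i + 2 * m - 2" using ch_diagonal_iff[OF o] by auto
  have a: "adj T i j" "adj T j (i + 2 * m)" using d unfolding adj_def by (simp_all add: ch_commute)
  obtain k where "i < k" "k < j" "adj T i k" "adj T k j" using inner_apex[OF T a(1)] o' o by blast
  moreover obtain l where "j < l" "l < i + 2 * m" "adj T j l" "adj T l (i + 2 * m)"
    using inner_apex[OF T a(2)] o' o by force
  ultimately show thesis using that[of k l] unfolding quad_def by simp
qed

lemma quad_unique:
  assumes T: "triangulation_of K T" and q: "quad T i k j l" "quad T i k' j l'"
  shows "k = k'" "l = l'"
proof -
  show "k = k'" using q inner_apex_unique[OF T, of i k j k'] unfolding quad_def by auto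
  show "l = l'" using q inner_apex_unique[OF T, of j l "i + 2 * m" l'] unfolding quad_def by auto
qed

lemma triangle_in_iff:
  assumes "\<not> 2 * m dvd i - j" "\<not> 2 * m dvd i - k" "\<not> 2 * m dvd j - k"
  shows "triangle_in K T (u i) (u j) (u k) \<longleftrightarrow> adj T i j \<and> adj T j k \<and> adj T i k"
proof -
  have "u i \<noteq> u j" "u i \<noteq> u k" "u j \<noteq> u k" using assms unfolding u_eq_iff by (auto simp: mod_eq_dvd_iff)
  then show ?thesis
    unfolding triangle_in_def adj_def ch_def using u_vertex by auto
qed

lemma not_dvd_window:
  "w \<le> i \<Longrightarrow> i < w + 2 * m \<Longrightarrow> w \<le> j \<Longrightarrow> j < w + 2 * m \<Longrightarrow> i \<noteq> j \<Longrightarrow> \<not> 2 * m dvd i - j"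
  using u_window_eq[of w i j] unfolding u_eq_iff by (auto simp: mod_eq_dvd_iff)

lemma opposite_diagonal_quad:
  assumes d: "ch i j \<in> T" and q: "quad T i k j l"
  shows "opposite_diagonal K T (ch i j) (ch k l)"
proof -
  have o: "i < k" "k < j" "j < l" "l < i + 2 * m" using q unfolding quad_def by auto
  have a: "adj T i j" using d unfolding adj_def by simp
  have nd: "\<not> 2 * m dvd i - j" "\<not> 2 * m dvd i - k" "\<not> 2 * m dvd j - k"
    "\<not> 2 * m dvd i - l" "\<not> 2 * m dvd j - l"
    using o by (intro not_dvd_window[of i]; simp)+
  have "triangle_in K T (u i) (u j) (u k)"
    unfolding triangle_in_iff[OF nd(1-3)] using q a unfolding quad_def by (simp add: adj_commute)
  moreover have "triangle_in K T (u i) (u j) (u l)"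
    unfolding triangle_in_iff[OF nd(1,4,5)] using q a unfolding quad_def by (simp add: adj_commute)
  moreover have "u k \<noteq> u l" using u_window_eq[of i k l] o by auto
  ultimately show ?thesis unfolding opposite_diagonal_def ch_def using d[unfolded ch_def] by blast
qed

text \<open>Distinct apexes of triangles on one chord lie on different sides of it, since
  \<open>inner_apex_unique\<close> leaves only one on each side.\<close>

lemma opposite_diagonalE:
  assumes T: "triangulation_of K T" and o: "i < j" "j < i + 2 * m"
    and op: "opposite_diagonal K T (ch i j) d'"
  obtains k l where "quad T i k j l" "d' = ch k l"
proof -
  obtain a b c e where h: "ch i j \<in> T" "c \<noteq> e" "triangle_in K T a b c" "triangle_in K T a b e"
    "ch i j = closed_segment a b" "d' = closed_segment c e"
    using op unfolding opposite_diagonal_def by blast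
  have ab: "{u i, u j} = {a, b}" using h(5) unfolding ch_def closed_segment_eq .
  have sym: "triangle_in K T a b x \<longleftrightarrow> triangle_in K T b a x" for x
    unfolding triangle_in_def by (auto simp: closed_segment_commute)
  have t: "triangle_in K T (u i) (u j) c" "triangle_in K T (u i) (u j) e"
    using ab h(3,4) sym by (auto simp: doubleton_eq_iff)
  have apex: "\<exists>k. i < k \<and> k < i + 2 * m \<and> k \<noteq> j \<and> x = u k \<and> adj T i k \<and> adj T k j"
    if "triangle_in K T (u i) (u j) x" for x
  proof -
    have x: "x \<in> vertices K" "x \<noteq> u i" "x \<noteq> u j" using that unfolding triangle_in_def by auto
    obtain k where k: "i \<le> k" "k < i + 2 * m" "x = u k" using vertex_window[OF x(1)] by blast
    have "k \<noteq> i" "k \<noteq> j" using k x by auto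
    moreover have "adj T i k" "adj T k j"
      using that k unfolding triangle_in_def adj_def ch_def by (auto simp: closed_segment_commute)
    ultimately show ?thesis using k by (intro exI[of _ k]) auto
  qed
  obtain k where k: "i < k" "k < i + 2 * m" "k \<noteq> j" "c = u k" "adj T i k" "adj T k j" using apex[OF t(1)] by blast
  obtain l where l: "i < l" "l < i + 2 * m" "l \<noteq> j" "e = u l" "adj T i l" "adj T l j" using apex[OF t(2)] by blast
  have kl: "k \<noteq> l" using h k l by auto
  consider "k < j" "l < j" | "k < j" "j < l" | "l < j" "j < k" | "j < k" "j < l" using k l by linarith
  then show thesis
  proof cases
    case 1 then show ?thesis using inner_apex_unique[OF T, of i k j l] k l kl o by auto
  next
    case 2
    then show ?thesis using that[of k l] h k l unfolding quad_def ch_def by (auto simp: adj_commute)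
  next
    case 3
    then show ?thesis using that[of l k] h k l unfolding quad_def ch_def by (auto simp: adj_commute closed_segment_commute)
  next
    case 4
    then show ?thesis using inner_apex_unique[OF T, of j k "i + 2 * m" l] k l kl o by (auto simp: adj_commute)
  qed
qed

lemma opposite_diagonal_unique:
  assumes T: "triangulation_of K T" and op: "opposite_diagonal K T d d'" "opposite_diagonal K T d d''"
  shows "d' = d''"
proof -
  have "d \<in> T" using op unfolding opposite_diagonal_def by blast
  then obtain i j where ij: "0 \<le> i" "i + 2 \<le> j" "j < 0 + 2 * m" "j \<le> i + 2 * m - 2" "d = ch i j"
    using triangulation_memberE[OF T, of d 0] by metis
  then have o: "i < j" "j < i + 2 * m" by auto
  show ?thesis
    using opposite_diagonalE[OF T o, of d'] opposite_diagonalE[OF T o, of d''] op quad_unique[OF T] ij(5) by metis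
qed

lemma opposite_diagonal_crossing:
  assumes T: "triangulation_of K T" and op: "opposite_diagonal K T d d'"
  shows "d' \<notin> T" "crossing d d'" "d \<in> T"
proof -
  show d: "d \<in> T" using op unfolding opposite_diagonal_def by blast
  then obtain i j where ij: "0 \<le> i" "i + 2 \<le> j" "j < 0 + 2 * m" "j \<le> i + 2 * m - 2" "d = ch i j"
    using triangulation_memberE[OF T, of d 0] by metis
  then obtain k l where kl: "quad T i k j l" "d' = ch k l"
    using opposite_diagonalE[OF T, of i j d'] op by auto
  then show "crossing d d'" using crossing_ch[of i i j k l] ij(5) unfolding quad_def by auto
  then show "d' \<notin> T" using d T unfolding triangulation_of_def by blast
qed

text \<open>A chord crossing a diagonal of a quadrilateral but none of its sides is the other diagonal.\<close>

lemma quad_diagonals_only: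
  assumes T: "triangulation_of K T" and q: "quad T i k j l"
    and xy: "i \<le> x" "x < y" "y < i + 2 * m"
    and cr: "\<And>a b. ch a b \<in> T \<Longrightarrow> i \<le> a \<Longrightarrow> a < b \<Longrightarrow> b < i + 2 * m \<Longrightarrow> (a, b) \<noteq> (i, j) \<Longrightarrow>
       \<not> (a < x \<and> x < b \<and> b < y \<or> x < a \<and> a < y \<and> y < b)"
    and sep: "(i < x \<and> x < j \<and> j < y) \<or> (k < x \<and> x < l \<and> (y < k \<or> l < y)) \<or> (k < y \<and> y < l \<and> (x < k \<or> l < x))"
  shows "(x, y) = (i, j) \<or> (x, y) = (k, l)"
proof -
  have o: "i < k" "k < j" "j < l" "l < i + 2 * m" using q unfolding quad_def by auto
  have side: "\<not> (a < x \<and> x < b \<and> b < y \<or> x < a \<and> a < y \<and> y < b)"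
    if ab: "adj T a b" "i \<le> a" "a < b" "b < i + 2 * m" "(a, b) \<noteq> (i, j)" for a b
  proof (cases "ch a b edge_of K")
    case True
    then show ?thesis using edge_of_ch[of a b] ab xy by auto
  next
    case False
    then have "ch a b \<in> T" using ab unfolding adj_def by simp
    then show ?thesis using cr ab by blast
  qed
  have s: "adj T i k" "adj T k j" "adj T j l" "adj T i l" using q unfolding quad_def by (auto simp: adj_commute)
  have n: "\<not> (i < x \<and> x < k \<and> k < y \<or> x < i \<and> i < y \<and> y < k)"
    "\<not> (k < x \<and> x < j \<and> j < y \<or> x < k \<and> k < y \<and> y < j)"
    "\<not> (j < x \<and> x < l \<and> l < y \<or> x < j \<and> j < y \<and> y < l)"
    "\<not> (i < x \<and> x < l \<and> l < y \<or> x < i \<and> i < y \<and> y < l)"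
    using side[OF s(1)] side[OF s(2)] side[OF s(3)] side[OF s(4)] o by auto
  consider "i < x" "x < j" "j < y" | "k < x" "x < l" "l < y" | "k < y" "y < l" "x < k"
    using sep xy by linarith
  then show ?thesis
  proof cases
    case 1
    have "x \<le> k" using n(2) 1 o by linarith
    moreover have "k \<le> x" using n(1) 1 o by linarith
    moreover have "l \<le> y" using n(3) 1 o by linarith
    moreover have "y \<le> l" using n(4) 1 o by linarith
    ultimately show ?thesis by simp
  next
    case 2
    then show ?thesis using n(4) o by linarith
  next
    case 3
    have "x \<le> i" using n(1) 3 o by linarith
    moreover have "j \<le> y" using n(2) 3 o by linarith
    moreover have "y \<le> j" using n(3) 3 o by linarith
    ultimately show ?thesis using xy by simp
  qed
qed

text \<open>By \<open>quad_diagonals_only\<close> the new diagonal crosses nothing in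
  \<open>T\<close> but \<open>ch i j\<close>. For maximality, a diagonal \<open>f\<close> crossing
  nothing in the new set must cross a member of \<open>T\<close>, and only \<open>ch i j\<close> is
  left; then \<open>f\<close> is \<open>ch i j\<close> or \<open>ch k l\<close>, which are both
  excluded.\<close>

lemma flip_triangulation:
  assumes T: "triangulation_of K T" and d: "ch i j \<in> T" and q: "quad T i k j l"
  shows "triangulation_of K (insert (ch k l) (T - {ch i j}))"
proof -
  have o: "i < k" "k < j" "j < l" "l < i + 2 * m" using q unfolding quad_def by auto
  have d': "ch k l \<in> diagonals K" using ch_diagonal_iff[of k l] o by auto
  have sub: "T \<subseteq> diagonals K" and nc: "\<And>d e. d \<in> T \<Longrightarrow> e \<in> T \<Longrightarrow> \<not> crossing d e"
    using T unfolding triangulation_of_def by auto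
  have cs: "crossing d e \<longleftrightarrow> crossing e d" for d e unfolding crossing_def by auto
  have cc: "crossing (ch i j) (ch k l)" using crossing_ch[of i i j k l] o by auto
  have no: "\<not> crossing e (ch k l)" if e: "e \<in> T" "e \<noteq> ch i j" for e
  proof
    assume c: "crossing e (ch k l)"
    obtain x y where xy: "i \<le> x" "x + 2 \<le> y" "y < i + 2 * m" "e = ch x y"
      using triangulation_memberE[OF T e(1)] by metis
    have "(x, y) = (i, j) \<or> (x, y) = (k, l)"
    proof (rule quad_diagonals_only[OF T q])
      fix a b assume ab: "ch a b \<in> T" "i \<le> a" "a < b" "b < i + 2 * m"
      show "\<not> (a < x \<and> x < b \<and> b < y \<or> x < a \<and> a < y \<and> y < b)"
        using nc[OF ab(1) e(1)] crossing_ch[of i a b x y] ab xy by auto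
    next
      show "(i < x \<and> x < j \<and> j < y) \<or> (k < x \<and> x < l \<and> (y < k \<or> l < y)) \<or> (k < y \<and> y < l \<and> (x < k \<or> l < x))"
        using c crossing_ch[of i x y k l] o xy by auto
    qed (use xy in auto)
    then show False using e c xy unfolding crossing_def by auto
  qed
  show ?thesis
    unfolding triangulation_of_def
  proof (intro conjI ballI)
    show "insert (ch k l) (T - {ch i j}) \<subseteq> diagonals K" using sub d' by auto
    fix e f assume "e \<in> insert (ch k l) (T - {ch i j})" "f \<in> insert (ch k l) (T - {ch i j})"
    then show "\<not> crossing e f" using nc no cs by (auto simp: crossing_def)
  next
    fix f assume f: "f \<in> diagonals K - insert (ch k l) (T - {ch i j})"
    show "\<exists>e \<in> insert (ch k l) (T - {ch i j}). crossing f e"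
    proof (cases "f = ch i j")
      case True then show ?thesis using cc by auto
    next
      case False
      then have fT: "f \<in> diagonals K - T" using f by auto
      then obtain e0 where e0: "e0 \<in> T" "crossing f e0" using T unfolding triangulation_of_def by blast
      show ?thesis
      proof (rule ccontr)
        assume n: "\<not> ?thesis"
        then have "e0 = ch i j" using e0 by blast
        then have fc: "crossing f (ch i j)" using e0 by simp
        obtain x y where xy: "i \<le> x" "x + 2 \<le> y" "y < i + 2 * m" "f = ch x y"
          using fT diagonalE[of f i] by (metis DiffD1)
        have "(x, y) = (i, j) \<or> (x, y) = (k, l)"
        proof (rule quad_diagonals_only[OF T q])
          fix a b assume ab: "ch a b \<in> T" "i \<le> a" "a < b" "b < i + 2 * m" "(a, b) \<noteq> (i, j)"
          have "ch a b \<noteq> ch i j" using ch_eq_iff[of i a b i j] ab o by auto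
          then have "\<not> crossing f (ch a b)" using n ab by auto
          then show "\<not> (a < x \<and> x < b \<and> b < y \<or> x < a \<and> a < y \<and> y < b)"
            using crossing_ch[of i x y a b] ab xy by auto
        next
          show "(i < x \<and> x < j \<and> j < y) \<or> (k < x \<and> x < l \<and> (y < k \<or> l < y)) \<or> (k < y \<and> y < l \<and> (x < k \<or> l < x))"
            using fc crossing_ch[of i x y i j] o xy by auto
        qed (use xy in auto)
        then show False using f False xy by auto
      qed
    qed
  qed
qed

end

section \<open>Centrally symmetric triangulations\<close>

context enum_polygon
begin

lemma adj_refl:
  assumes "cs_triangulation K p T" "i < j" "j < i + 2 * m" "adj T i j" shows "adj T (i + m) (j + m)"
proof (cases "ch i j \<in> T")
  case True
  then have "ch (i + m) (j + m) \<in> T" using assms(1) refl_ch unfolding cs_triangulation_def by metis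
  then show ?thesis unfolding adj_def by simp
next
  case False
  then show ?thesis using assms edge_of_ch[of i j] edge_of_ch[of "i + m" "j + m"] unfolding adj_def by auto
qed

lemma quad_refl:
  assumes "cs_triangulation K p T" "quad T i k j l" shows "quad T (i + m) (k + m) (j + m) (l + m)"
  using assms adj_refl[OF assms(1), of i k] adj_refl[OF assms(1), of k j] adj_refl[OF assms(1), of j l]
    adj_refl[OF assms(1), of i l] unfolding quad_def by (auto simp: adj_commute)

text \<open>Without a central diagonal, the longest arc of length at most \<open>m\<close> bounds a triangle all of whose
  arcs are shorter than \<open>m\<close>, and the reflection of this triangle crosses it.\<close>

lemma central_diagonal_exists:
  assumes cs: "cs_triangulation K p T" obtains i where "ch i (i + m) \<in> T"
proof -
  have T: "triangulation_of K T" using cs unfolding cs_triangulation_def by simp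
  let ?L = "{l. 1 \<le> l \<and> l \<le> m \<and> (\<exists>i. adj T i (i + l))}"
  have fin: "finite ?L" by (rule finite_subset[of _ "{1..m}"]) auto
  have one: "1 \<in> ?L" using m2 by auto
  define a where "a = Max ?L"
  have "a \<in> ?L" unfolding a_def using Max_in[OF fin] one by blast
  then obtain i where i: "1 \<le> a" "a \<le> m" "adj T i (i + a)" by auto
  have mx: "x - y \<le> a" if "adj T y x" "y < x" "x \<le> y + m" for x y
  proof -
    have "x - y \<in> ?L" using that by (auto intro!: exI[of _ y])
    then show ?thesis unfolding a_def using Max_ge[OF fin] by blast
  qed
  show thesis
  proof (cases "a = m")
    case True
    then have "ch i (i + m) \<in> T" using i edge_of_ch[of i "i + m"] m2 unfolding adj_def by auto
    then show ?thesis using that by blast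
  next
    case False
    then have am: "a < m" using i by simp
    define j where "j = i + a"
    have ij: "adj T i j" "i < j" "j < i + m" using i am unfolding j_def by auto
    then have "adj T j (i + 2 * m)" by (simp add: adj_commute)
    then obtain k where k: "j < k" "k < i + 2 * m" "adj T j k" "adj T k (i + 2 * m)"
      using inner_apex[OF T, of j "i + 2 * m"] ij m2 by auto
    have k': "adj T i k" "adj T k (j + 2 * m)" using k by (simp_all add: adj_commute)
    have "k < j + m"
    proof (rule ccontr)
      assume n: "\<not> k < j + m"
      then show False using mx[OF k(3)] mx[OF k'(2)] k am ij unfolding j_def by linarith
    qed
    moreover have "i + m < k"
    proof (rule ccontr)
      assume n: "\<not> i + m < k"
      then show False using mx[OF k(4)] mx[OF k'(1)] k am ij unfolding j_def by linarith
    qed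
    moreover have "adj T (i + m) (j + m)" using adj_refl[OF cs] ij m2 by simp
    ultimately show ?thesis using adj_not_interleaved[OF T k(3)] ij m2 by force
  qed
qed

text \<open>Two different chords between antipodal vertices interleave.\<close>

lemma central_diagonal_unique:
  assumes T: "triangulation_of K T" and d: "d \<in> T" "central p d" "e \<in> T" "central p e" shows "d = e"
proof -
  obtain i j where ij: "0 \<le> i" "i + 2 \<le> j" "j \<le> i + 2 * m - 2" "d = ch i j"
    using triangulation_memberE[OF T d(1), of 0] by metis
  then have j: "j = i + m" using d central_ch[of i j] by auto
  obtain x y where xy: "i \<le> x" "x + 2 \<le> y" "y < i + 2 * m" "e = ch x y"
    using triangulation_memberE[OF T d(3), of i] by metis
  then have y: "y = x + m" using d central_ch[of x y] by auto
  show ?thesis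
  proof (cases "x = i")
    case False
    then have "crossing d e" using crossing_ch[of i i j x y] ij j xy y m2 by auto
    then show ?thesis using T d unfolding triangulation_of_def by blast
  qed (use ij j xy y in simp)
qed

section \<open>Flips that preserve the symmetry\<close>

lemma ch_endpoint: "ch a b = ch c d \<Longrightarrow> u a = u c \<or> u a = u d"
  unfolding ch_def closed_segment_eq by blast

lemma u_antipode_neq: "u (i + m) \<noteq> u i"
  using refl_neq[OF u_vertex] refl_u by metis

lemma noncentral_antipode:
  assumes "i < j" "j < i + 2 * m" "j \<noteq> i + m" shows "u (i + m) \<noteq> u j" "u (j + m) \<noteq> u i"
proof -
  show 1: "u (i + m) \<noteq> u j" using assms u_window_eq[of i "i + m" j] m2 by auto
  then show "u (j + m) \<noteq> u i" using refl_u by (metis point_reflection_involution)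
qed

lemma refl_ch_neq:
  assumes "i < j" "j < i + 2 * m" "j \<noteq> i + m" shows "ch (i + m) (j + m) \<noteq> ch i j"
  using ch_endpoint[of "i + m" "j + m" i j] noncentral_antipode[OF assms] u_antipode_neq by auto

lemma central_refl: "central p (refl ` d) \<longleftrightarrow> central p d"
proof -
  have "refl p = p" unfolding point_reflection_def by simp
  then show ?thesis unfolding central_def by (metis image_eqI point_reflection_image)
qed

text \<open>The two flips can be made one after the other: each side of the reflected quadrilateral
  has an end at \<open>i + m\<close> or \<open>j + m\<close>, which are not ends of the noncentral
  \<open>ch i j\<close>, so the first flip leaves the reflected quadrilateral intact.\<close>

lemma pair_flip_cs_triangulation:
  assumes cs: "cs_triangulation K p T" and d: "ch i j \<in> T" and o: "i < j" "j < i + 2 * m" "j \<noteq> i + m"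
    and q: "quad T i k j l"
    and T2: "T2 = (T - {ch i j, ch (i + m) (j + m)}) \<union> {ch k l, ch (k + m) (l + m)}"
  shows "cs_triangulation K p T2" "quad T2 k j l (i + 2 * m)"
    "ch k l \<notin> T" "ch (k + m) (l + m) \<notin> T" "\<not> central p (ch k l)"
proof -
  have T: "triangulation_of K T" and sym: "\<And>d. d \<in> T \<Longrightarrow> refl ` d \<in> T"
    using cs unfolding cs_triangulation_def by auto
  have ne: "u (i + m) \<noteq> u j" "u (j + m) \<noteq> u i" "u (i + m) \<noteq> u i" "u (j + m) \<noteq> u j"
    using noncentral_antipode[OF o] u_antipode_neq by auto
  have qo: "i < k" "k < j" "j < l" "l < i + 2 * m" using q unfolding quad_def by auto
  have uk: "u k \<noteq> u i" "u k \<noteq> u j" "u l \<noteq> u i" "u l \<noteq> u j"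
    using qo u_window_eq[of i] by auto
  have d2: "ch (i + m) (j + m) \<in> T" using sym[OF d] refl_ch by simp
  have q2: "quad T (i + m) (k + m) (j + m) (l + m)" using quad_refl[OF cs q] .
  show kl: "ch k l \<notin> T"
    using opposite_diagonal_crossing(1)[OF T opposite_diagonal_quad[OF d q]] .
  show kl2: "ch (k + m) (l + m) \<notin> T"
    using opposite_diagonal_crossing(1)[OF T opposite_diagonal_quad[OF d2 q2]] .
  define T1 where "T1 = insert (ch k l) (T - {ch i j})"
  have T1: "triangulation_of K T1" unfolding T1_def using flip_triangulation[OF T d q] .
  have n2: "ch (i + m) x \<noteq> ch i j" "ch (j + m) x \<noteq> ch i j" for x
    using ch_endpoint ne by metis+
  have keep1: "adj T1 (i + m) x" if "adj T (i + m) x" for x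
    using that n2 unfolding adj_def T1_def by auto
  have keep2: "adj T1 (j + m) x" if "adj T (j + m) x" for x
    using that n2 unfolding adj_def T1_def by auto
  have q1: "quad T1 (i + m) (k + m) (j + m) (l + m)"
    using q2 keep1 keep2 unfolding quad_def by (simp add: adj_commute[of _ "k + m" "j + m"] adj_commute[of _ "l + m" "i + m"])
  have d1: "ch (i + m) (j + m) \<in> T1" unfolding T1_def using d2 n2 by auto
  have "T2 = insert (ch (k + m) (l + m)) (T1 - {ch (i + m) (j + m)})"
  proof -
    have "ch k l \<noteq> ch (i + m) (j + m)" using kl d2 by metis
    then show ?thesis unfolding T2 T1_def by blast
  qed
  then have T2': "triangulation_of K T2" using flip_triangulation[OF T1 d1 q1] by simp
  have "ch (x + m + m) (y + m + m) = ch x y" for x y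
    using ch_periodic(1)[of x "y + m + m"] ch_periodic(2)[of x y] by (simp add: algebra_simps)
  then have r: "refl ` ch k l = ch (k + m) (l + m)" "refl ` ch (k + m) (l + m) = ch k l"
    "refl ` ch i j = ch (i + m) (j + m)" "refl ` ch (i + m) (j + m) = ch i j"
    using refl_ch by metis+
  have "refl ` e \<in> T2" if e: "e \<in> T2" for e
  proof (cases "e = ch k l \<or> e = ch (k + m) (l + m)")
    case True then show ?thesis using r unfolding T2 by auto
  next
    case False
    then have "e \<in> T" "e \<noteq> ch i j" "e \<noteq> ch (i + m) (j + m)" using e unfolding T2 by auto
    moreover then have "refl ` e \<noteq> ch i j" "refl ` e \<noteq> ch (i + m) (j + m)"
      using r by (metis point_reflection_image)+
    ultimately show ?thesis using sym unfolding T2 by auto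
  qed
  then show cs2: "cs_triangulation K p T2" using T2' unfolding cs_triangulation_def by blast
  have n3: "ch k x \<noteq> ch i j" "ch l x \<noteq> ch i j" "ch i x \<noteq> ch (i + m) (j + m)" "ch j x \<noteq> ch (i + m) (j + m)" for x
    using ch_endpoint uk ne by metis+
  have keep: "adj T2 x y" if "adj T x y" "x = k \<or> x = l" "y = i \<or> y = j" for x y
  proof -
    have "ch x y \<noteq> ch i j" "ch x y \<noteq> ch (i + m) (j + m)"
      using n3 ch_commute[of x y] that by metis+
    then show ?thesis using that(1) unfolding adj_def T2 by auto
  qed
  show "quad T2 k j l (i + 2 * m)"
    using q keep[of k j] keep[of l j] keep[of l i] keep[of k i] unfolding quad_def by (auto simp: adj_commute)
  \<comment> \<open>The central diagonal of \<open>T\<close> survives in \<open>T2\<close>, and the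
    new diagonal, which is not in \<open>T\<close>, cannot be a second one.\<close>
  obtain s where s: "ch s (s + m) \<in> T" using central_diagonal_exists[OF cs] by blast
  have cen: "central p (ch s (s + m))" using central_ch[of s "s + m"] m2 by simp
  have ni: "\<not> central p (ch i j)" "\<not> central p (ch (i + m) (j + m))"
    using central_ch[of i j] central_ch[of "i + m" "j + m"] o by auto
  then have "ch s (s + m) \<noteq> ch i j" "ch s (s + m) \<noteq> ch (i + m) (j + m)" using cen by metis+
  then have "ch s (s + m) \<in> T2" using s unfolding T2 by blast
  moreover have "ch k l \<in> T2" unfolding T2 by blast
  ultimately show "\<not> central p (ch k l)"
    using central_diagonal_unique[OF T2' _ cen] s kl by metis
qed

text \<open>Reflection maps the quadrilateral around the central diagonal to a quadrilateral around
  the same diagonal. As this is unique, \<open>k\<close> and \<open>l\<close> are antipodal and the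
  new diagonal is central again.\<close>

lemma central_flip_cs_triangulation:
  assumes cs: "cs_triangulation K p T" and d: "ch i (i + m) \<in> T" and q: "quad T i k (i + m) l"
    and T2: "T2 = insert (ch k l) (T - {ch i (i + m)})"
  shows "l = k + m" "cs_triangulation K p T2" "quad T2 k (i + m) l (i + 2 * m)" "ch k l \<notin> T" "central p (ch k l)"
proof -
  have T: "triangulation_of K T" and sym: "\<And>d. d \<in> T \<Longrightarrow> refl ` d \<in> T"
    using cs unfolding cs_triangulation_def by auto
  have qo: "i < k" "k < i + m" "i + m < l" "l < i + 2 * m" using q unfolding quad_def by auto
  have "quad T (i + m) l (i + 2 * m) (k + 2 * m)" using quad_rotate[OF quad_rotate[OF q]] .
  moreover have "quad T (i + m) (k + m) (i + 2 * m) (l + m)" using quad_refl[OF cs q] by (simp add: algebra_simps)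
  ultimately show l: "l = k + m" using quad_unique[OF T] by blast
  show kl: "ch k l \<notin> T"
    using opposite_diagonal_crossing(1)[OF T opposite_diagonal_quad[OF d q]] .
  show cen: "central p (ch k l)" using central_ch[of k l] qo l by simp
  have cend: "central p (ch i (i + m))" using central_ch[of i "i + m"] m2 by simp
  have T2': "triangulation_of K T2" unfolding T2 using flip_triangulation[OF T d q] .
  have "refl ` e \<in> T2" if e: "e \<in> T2" for e
  proof (cases "e = ch k l")
    case True
    have "refl ` ch k l = ch l (k + 2 * m)" unfolding refl_ch l by (simp add: algebra_simps)
    then have "refl ` ch k l = ch k l" by (simp add: ch_commute)
    then show ?thesis using True T2 by simp
  next
    case False
    then have "e \<in> T" "\<not> central p e" using e central_diagonal_unique[OF T, of e "ch i (i + m)"] d cend unfolding T2 by auto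
    moreover then have "refl ` e \<noteq> ch i (i + m)" using central_refl[of e] cend by metis
    ultimately show ?thesis using sym unfolding T2 by simp
  qed
  then show "cs_triangulation K p T2" using T2' unfolding cs_triangulation_def by blast
  have uk: "u k \<noteq> u i" "u k \<noteq> u (i + m)" "u l \<noteq> u i" "u l \<noteq> u (i + m)"
    using qo u_window_eq[of i] by auto
  have keep: "adj T2 x y" if "adj T x y" "x = k \<or> x = l" for x y
    using that ch_endpoint[of x y i "i + m"] uk unfolding adj_def T2 by auto
  show "quad T2 k (i + m) l (i + 2 * m)"
    using q keep[of k "i + m"] keep[of l "i + m"] keep[of l i] keep[of k i] unfolding quad_def by (auto simp: adj_commute)
qed

text \<open>Induction along the triangle \<open>i k j\<close>: no chord but \<open>(i, j)\<close>
  passes over the apex \<open>k\<close>. For \<open>d = j - i \<ge> 2\<close> the number is that of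
  the \<open>d + 1\<close> sides and \<open>d - 2\<close> diagonals of a triangulated polygon with
  \<open>d + 1\<close> vertices.\<close>

lemma adj_count:
  assumes T: "triangulation_of K T"
  shows "adj T i j \<Longrightarrow> i < j \<Longrightarrow> j < i + 2 * m \<Longrightarrow>
    int (card {(a, b). i \<le> a \<and> a < b \<and> b \<le> j \<and> adj T a b}) = 2 * (j - i) - 1"
proof (induction "nat (j - i)" arbitrary: i j rule: less_induct)
  case less
  let ?S = "\<lambda>i j. {(a, b). i \<le> a \<and> a < b \<and> b \<le> j \<and> adj T a b}"
  have fin: "finite (?S i j)" for i j
    by (rule finite_subset[of _ "{i..j} \<times> {i..j}"]) auto
  show ?case
  proof (cases "j = i + 1")
    case True
    then have "?S i j = {(i, i + 1)}" by auto
    then show ?thesis using True by simp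
  next
    case False
    then have "i + 2 \<le> j" using less.prems by simp
    then obtain k where k: "i < k" "k < j" "adj T i k" "adj T k j"
      using inner_apex[OF T less.prems(1)] less.prems(3) by blast
    have split: "a = i \<and> b = j" if ab: "i \<le> a" "a < b" "b \<le> j" "adj T a b" and akb: "a < k" "k < b" for a b
    proof -
      have "a = i" using adj_not_interleaved[OF T k(3) ab(4)] akb ab less.prems by force
      moreover have "b = j" using adj_not_interleaved[OF T ab(4) k(4)] akb ab less.prems by force
      ultimately show "a = i \<and> b = j" by simp
    qed
    have "?S i j = insert (i, j) (?S i k \<union> ?S k j)"
    proof
      show "?S i j \<subseteq> insert (i, j) (?S i k \<union> ?S k j)" using split by force
      show "insert (i, j) (?S i k \<union> ?S k j) \<subseteq> ?S i j" using k less.prems by auto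
    qed
    moreover have "(i, j) \<notin> ?S i k \<union> ?S k j" using k by auto
    moreover have "?S i k \<inter> ?S k j = {}" by auto
    ultimately have "card (?S i j) = Suc (card (?S i k) + card (?S k j))"
      using fin by (simp add: card_Un_disjoint)
    moreover have "int (card (?S i k)) = 2 * (k - i) - 1" using less k by auto
    moreover have "int (card (?S k j)) = 2 * (j - k) - 1" using less k by auto
    ultimately show ?thesis by simp
  qed
qed

text \<open>The central diagonal is the only chord that belongs to both halves.\<close>

lemma half_refl_neq:
  assumes "s \<le> x" "x < y" "y \<le> s + m" "s \<le> a" "a < b" "b \<le> s + m" "(a, b) \<noteq> (s, s + m)"
  shows "ch x y \<noteq> ch (a + m) (b + m)"
proof
  assume e: "ch x y = ch (a + m) (b + m)"
  show False
  proof (cases "b = s + m")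
    case True
    then have "ch x y = ch s (a + m)" using e ch_periodic(1)[of s "a + m"] by (simp add: ch_commute algebra_simps)
    then show ?thesis using ch_eq_iff[of s x y s "a + m"] assms m2 True by auto
  next
    case False
    then show ?thesis using ch_eq_iff[of s x y "a + m" "b + m"] e assms m2 by auto
  qed
qed

text \<open>If \<open>(s, s + m)\<close> is the central diagonal of a symmetric \<open>T\<close>,
  these represent each symmetric pair once, by its member in the half with the vertices
  \<open>s\<close> to \<open>s + m\<close>.\<close>

definition half_diagonals :: "complex set set \<Rightarrow> int \<Rightarrow> (int \<times> int) set" where
  "half_diagonals T s = {(a, b). s \<le> a \<and> a + 2 \<le> b \<and> b \<le> s + m \<and> (a, b) \<noteq> (s, s + m) \<and> ch a b \<in> T}"

text \<open>Of the \<open>2 * m - 1\<close> chords given by \<open>adj_count\<close>,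
  \<open>m\<close> are sides of \<open>K\<close> and one is the central diagonal.\<close>

lemma half_diagonals_count:
  assumes T: "triangulation_of K T" and s: "ch s (s + m) \<in> T"
  shows "int (card (half_diagonals T s)) = m - 2" "finite (half_diagonals T s)"
proof -
  let ?S = "{(a, b). s \<le> a \<and> a < b \<and> b \<le> s + m \<and> adj T a b}"
  let ?E = "(\<lambda>a. (a, a + 1)) ` {s..<s + m}"
  have S: "int (card ?S) = 2 * m - 1" using adj_count[OF T, of s "s + m"] s m2 unfolding adj_def by simp
  show fin: "finite (half_diagonals T s)"
    unfolding half_diagonals_def by (rule finite_subset[of _ "{s..s + m} \<times> {s..s + m}"]) auto
  have "?S = insert (s, s + m) (?E \<union> half_diagonals T s)"
  proof
    show "?S \<subseteq> insert (s, s + m) (?E \<union> half_diagonals T s)"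
    proof
      fix z assume z: "z \<in> ?S"
      then obtain a b where ab: "z = (a, b)" "s \<le> a" "a < b" "b \<le> s + m" "adj T a b" by blast
      show "z \<in> insert (s, s + m) (?E \<union> half_diagonals T s)"
      proof (cases "b = a + 1")
        case False
        then have "ch a b \<in> T" using edge_of_ch[of a b] ab m2 unfolding adj_def by auto
        then show ?thesis using ab False unfolding half_diagonals_def by auto
      qed (use ab in auto)
    qed
    show "insert (s, s + m) (?E \<union> half_diagonals T s) \<subseteq> ?S"
    proof -
      have "adj T s (s + m)" "\<And>a b. ch a b \<in> T \<Longrightarrow> adj T a b" using s unfolding adj_def by auto
      then show ?thesis using m2 unfolding half_diagonals_def by auto
    qed
  qed
  moreover have "(s, s + m) \<notin> ?E \<union> half_diagonals T s" using m2 unfolding half_diagonals_def by auto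
  moreover have "?E \<inter> half_diagonals T s = {}" unfolding half_diagonals_def by auto
  moreover have "card ?E = nat m" by (subst card_image) (auto simp: inj_on_def)
  ultimately have "card ?S = Suc (nat m + card (half_diagonals T s))"
    using fin by (simp add: card_Un_disjoint)
  then show "int (card (half_diagonals T s)) = m - 2" using S m2 by simp
qed

end

section \<open>Colored flips\<close>

locale colored_polygon = enum_polygon K p m u
  for K :: "complex set" and p :: complex and m :: int and u :: "int \<Rightarrow> complex" +
  fixes C :: "'c set"
  assumes finC: "finite C" and cardC: "int (card C) = m - 2"
begin

abbreviation cct :: "'c colored_triangulation \<Rightarrow> bool" where
  "cct \<equiv> colored_cs_triangulation K p C"

lemma cct_iff: "cct (T, \<gamma>) \<longleftrightarrow> cs_triangulation K p T \<and>
     dom \<gamma> = {d \<in> T. \<not> central p d} \<and> ran \<gamma> \<subseteq> C \<and>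
     (\<forall>d \<in> dom \<gamma>. \<gamma> (refl ` d) = \<gamma> d) \<and>
     (\<forall>d \<in> dom \<gamma>. \<forall>e \<in> dom \<gamma>. \<gamma> d = \<gamma> e \<longrightarrow> e = d \<or> e = refl ` d)"
  unfolding colored_cs_triangulation_def by simp

lemma cctD:
  assumes "cct (T, \<gamma>)"
  shows "cs_triangulation K p T" "triangulation_of K T"
    "\<And>d. \<gamma> d \<noteq> None \<longleftrightarrow> d \<in> T \<and> \<not> central p d" "\<And>d c. \<gamma> d = Some c \<Longrightarrow> c \<in> C"
    "\<And>d. d \<in> T \<Longrightarrow> \<not> central p d \<Longrightarrow> \<gamma> (refl ` d) = \<gamma> d"
    "\<And>d e c. \<gamma> d = Some c \<Longrightarrow> \<gamma> e = Some c \<Longrightarrow> e = d \<or> e = refl ` d"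
proof -
  note v = assms[unfolded cct_iff]
  note a = v[THEN conjunct1] v[THEN conjunct2, THEN conjunct1]
    v[THEN conjunct2, THEN conjunct2, THEN conjunct1]
    v[THEN conjunct2, THEN conjunct2, THEN conjunct2, THEN conjunct1]
    v[THEN conjunct2, THEN conjunct2, THEN conjunct2, THEN conjunct2]
  show "cs_triangulation K p T" "triangulation_of K T"
    using a(1) unfolding cs_triangulation_def by blast+
  show "\<gamma> d \<noteq> None \<longleftrightarrow> d \<in> T \<and> \<not> central p d" for d using a(2) by auto
  show "\<gamma> d = Some c \<Longrightarrow> c \<in> C" for d c using a(3) by (auto simp: ran_def)
  show "d \<in> T \<Longrightarrow> \<not> central p d \<Longrightarrow> \<gamma> (refl ` d) = \<gamma> d" for d using a(2,4) by blast
  show "\<gamma> d = Some c \<Longrightarrow> \<gamma> e = Some c \<Longrightarrow> e = d \<or> e = refl ` d" for d e c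
    using a(5) by (metis domI)
qed

text \<open>The outcome of a pair flip as an explicit value, so that it can be computed with in
  terms of indices.\<close>

definition pair_flip_result ::
    "'c colored_triangulation \<Rightarrow> int \<Rightarrow> int \<Rightarrow> int \<Rightarrow> int \<Rightarrow> 'c \<Rightarrow> 'c colored_triangulation" where
  "pair_flip_result v i k j l c =
     ((fst v - {ch i j, ch (i + m) (j + m)}) \<union> {ch k l, ch (k + m) (l + m)},
      ((snd v)(ch i j := None, ch (i + m) (j + m) := None))(ch k l := Some c, ch (k + m) (l + m) := Some c))"

lemma refl_ch2: "refl ` ch (i + m) (j + m) = ch i j"
  by (metis refl_ch point_reflection_image)

lemma noncentral_index:
  assumes "\<not> central p (ch i j)" "i < j" "j < i + 2 * m" shows "j \<noteq> i + m"
  using assms central_ch by blast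

lemma colored_pair_flip:
  assumes v: "cct v" and q: "quad (fst v) i k j l" and c: "snd v (ch i j) = Some c"
  shows "cct (pair_flip_result v i k j l c)"
    and "pair_flip K p c v (pair_flip_result v i k j l c)"
    and "pair_flip K p c (pair_flip_result v i k j l c) v"
proof -
  obtain T \<gamma> where vT: "v = (T, \<gamma>)" by (cases v)
  note V = cctD[OF v[unfolded vT]]
  have d: "ch i j \<in> T" "\<not> central p (ch i j)" using V(3)[of "ch i j"] c vT by auto
  have qT: "quad T i k j l" using q vT by simp
  then have o: "i < j" "j < i + 2 * m" unfolding quad_def by auto
  have ni: "j \<noteq> i + m" using noncentral_index d o by blast
  define T2 where "T2 = (T - {ch i j, ch (i + m) (j + m)}) \<union> {ch k l, ch (k + m) (l + m)}"
  note F = pair_flip_cs_triangulation[OF V(1) d(1) o ni qT T2_def]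
  define d1 where "d1 = ch i j"
  define d2 where "d2 = ch (i + m) (j + m)"
  define e1 where "e1 = ch k l"
  define e2 where "e2 = ch (k + m) (l + m)"
  have r: "refl ` d1 = d2" "refl ` d2 = d1" "refl ` e1 = e2" "refl ` e2 = e1"
    unfolding d1_def d2_def e1_def e2_def using refl_ch refl_ch2 by auto
  have T2: "T2 = (T - {d1, d2}) \<union> {e1, e2}" unfolding T2_def d1_def d2_def e1_def e2_def ..
  define \<gamma>2 where "\<gamma>2 = (\<gamma>(d1 := None, d2 := None))(e1 := Some c, e2 := Some c)"
  have res: "pair_flip_result v i k j l c = (T2, \<gamma>2)"
    unfolding pair_flip_result_def vT T2 \<gamma>2_def d1_def d2_def e1_def e2_def by simp
  have symT: "\<And>d. d \<in> T \<Longrightarrow> refl ` d \<in> T" using V(1) unfolding cs_triangulation_def by blast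
  have dT: "d1 \<in> T" "d2 \<in> T" using d(1) symT[OF d(1)] unfolding d1_def d2_def refl_ch by auto
  have eT: "e1 \<notin> T" "e2 \<notin> T" unfolding e1_def e2_def using F(3,4) by auto
  have ne: "d1 \<noteq> d2" "e1 \<noteq> d1" "e1 \<noteq> d2" "e2 \<noteq> d1" "e2 \<noteq> d2"
    using refl_ch_neq[OF o ni] dT eT unfolding d1_def d2_def by auto
  have nc: "\<not> central p d1" "\<not> central p d2" "\<not> central p e1" "\<not> central p e2"
    using d(2) F(5) r central_refl unfolding d1_def e1_def by metis+
  have cd: "\<gamma> d1 = Some c" "\<gamma> d2 = Some c" using c V(5)[OF d] r vT unfolding d1_def[symmetric] by auto
  have \<gamma>e: "\<gamma> e1 = None" "\<gamma> e2 = None" using V(3) eT by blast+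
  have cC: "c \<in> C" using V(4) cd by blast
  have \<gamma>2: "\<gamma>2 x = (if x = e1 \<or> x = e2 then Some c else if x = d1 \<or> x = d2 then None else \<gamma> x)" for x
    unfolding \<gamma>2_def by auto
  have only: "x = d1 \<or> x = d2" if "\<gamma> x = Some c" for x using V(6)[OF cd(1) that] r by auto
  show cct2: "cct (pair_flip_result v i k j l c)"
    unfolding res cct_iff
  proof (intro conjI ballI impI)
    show "cs_triangulation K p T2" by (rule F(1))
    show "dom \<gamma>2 = {d \<in> T2. \<not> central p d}"
      unfolding dom_def T2 using V(3) nc by (auto simp: \<gamma>2 split: if_splits)
    show "ran \<gamma>2 \<subseteq> C" unfolding ran_def using V(4) cC by (auto simp: \<gamma>2 split: if_splits)
    fix x assume "x \<in> dom \<gamma>2"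
    then have x: "\<gamma>2 x \<noteq> None" by auto
    show "\<gamma>2 (refl ` x) = \<gamma>2 x"
    proof (cases "x = e1 \<or> x = e2")
      case True
      moreover have "\<gamma>2 e1 = Some c" "\<gamma>2 e2 = Some c" unfolding \<gamma>2 by simp_all
      ultimately show ?thesis using r(3,4) by metis
    next
      case False
      then have xn: "x \<noteq> d1" "x \<noteq> d2" "\<gamma> x \<noteq> None" using x by (auto simp: \<gamma>2 split: if_splits)
      then have xT: "x \<in> T" "\<not> central p x" using V(3) by auto
      then have "refl ` x \<in> T" using symT by blast
      then have "refl ` x \<noteq> e1" "refl ` x \<noteq> e2" using eT by auto
      moreover have "refl ` x \<noteq> d1" "refl ` x \<noteq> d2" using xn r by (metis point_reflection_image)+
      ultimately show ?thesis using V(5)[OF xT] False xn by (simp add: \<gamma>2)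
    qed
    fix y assume "y \<in> dom \<gamma>2" and eq: "\<gamma>2 x = \<gamma>2 y"
    show "y = x \<or> y = refl ` x"
    proof (cases "\<gamma>2 x = Some c")
      case True
      then have "\<gamma>2 y = Some c" using eq by simp
      with True have "x = e1 \<or> x = e2" "y = e1 \<or> y = e2"
        using only[of x] only[of y] unfolding \<gamma>2 by (metis option.distinct(1))+
      then show ?thesis using r(3,4) by metis
    next
      case False
      then have "\<gamma>2 x = \<gamma> x" "\<gamma>2 y = \<gamma> y" using x eq unfolding \<gamma>2 by metis+
      then show ?thesis using x eq V(6)[of x _ y] by auto
    qed
  qed
  have d2': "ch (i + m) (j + m) \<in> T" "e2 = refl ` e1" using dT r d2_def by auto
  have op: "opposite_diagonal K T d1 e1" "opposite_diagonal K T d2 e2"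
    using opposite_diagonal_quad[OF d(1) qT] opposite_diagonal_quad[OF d2'(1) quad_refl[OF V(1) qT]]
    unfolding d1_def d2_def e1_def e2_def by auto
  show "pair_flip K p c v (pair_flip_result v i k j l c)"
    unfolding res unfolding vT pair_flip_def case_prod_conv
    by (intro exI[of _ d1] exI[of _ d2] exI[of _ e1] exI[of _ e2] conjI)
      (fact nc(1) r(1)[symmetric] cd(1) op T2 \<gamma>2_def)+
  have ek: "ch k l \<in> T2" "ch (k + m) (l + m) \<in> T2" unfolding T2_def by auto
  \<comment> \<open>Read from \<open>k\<close>, the flipped quadrilateral is
    \<open>k j l (i + 2 * m)\<close>, and its other diagonal is \<open>ch i j\<close> again.\<close>
  have "opposite_diagonal K T2 e1 (ch j (i + 2 * m))"
    using opposite_diagonal_quad[OF ek(1) F(2)] unfolding e1_def .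
  then have o1: "opposite_diagonal K T2 e1 d1" unfolding d1_def by (simp add: ch_commute)
  have "opposite_diagonal K T2 e2 (ch (j + m) (i + 2 * m + m))"
    using opposite_diagonal_quad[OF ek(2) quad_refl[OF F(1,2)]] unfolding e2_def .
  then have o2: "opposite_diagonal K T2 e2 d2"
    unfolding d2_def by (metis ch_commute ch_periodic(2) add.commute add.left_commute)
  have TT: "T = (T2 - {e1, e2}) \<union> {d1, d2}" unfolding T2 using dT eT by auto
  have GG: "\<gamma> = (\<gamma>2(e1 := None, e2 := None))(d1 := Some c, d2 := Some c)"
    using cd \<gamma>e ne by (auto simp: \<gamma>2 fun_eq_iff)
  have ce: "\<gamma>2 e1 = Some c" by (simp add: \<gamma>2)
  show "pair_flip K p c (pair_flip_result v i k j l c) v"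
    unfolding res unfolding vT pair_flip_def case_prod_conv
    by (intro exI[of _ e1] exI[of _ e2] exI[of _ d1] exI[of _ d2] conjI)
      (fact nc(3) r(3)[symmetric] ce o1 o2 TT GG)+
qed

text \<open>The color determines the pair; only the order of its two diagonals is free, and the
  result does not depend on it.\<close>

lemma pair_flip_unique:
  assumes v: "cct v" and f: "pair_flip K p c v w" "pair_flip K p c v w'" shows "w = w'"
proof -
  obtain T \<gamma> where vT: "v = (T, \<gamma>)" by (cases v)
  note V = cctD[OF v[unfolded vT]]
  obtain d1 d2 e1 e2 where f1: "d2 = refl ` d1" "\<gamma> d1 = Some c"
       "opposite_diagonal K T d1 e1" "opposite_diagonal K T d2 e2"
       "w = ((T - {d1, d2}) \<union> {e1, e2}, (\<gamma>(d1 := None, d2 := None))(e1 := Some c, e2 := Some c))"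
    using f(1) unfolding vT pair_flip_def by (cases w) auto
  obtain d1' d2' e1' e2' where f2: "d2' = refl ` d1'" "\<gamma> d1' = Some c"
       "opposite_diagonal K T d1' e1'" "opposite_diagonal K T d2' e2'"
       "w' = ((T - {d1', d2'}) \<union> {e1', e2'}, (\<gamma>(d1' := None, d2' := None))(e1' := Some c, e2' := Some c))"
    using f(2) unfolding vT pair_flip_def by (cases w') auto
  consider "d1' = d1" "d2' = d2" | "d1' = d2" "d2' = d1" using V(6)[OF f1(2) f2(2)] f1(1) f2(1) by auto
  then show ?thesis
  proof cases
    case 1
    then have "e1' = e1" "e2' = e2" using opposite_diagonal_unique[OF V(2)] f1 f2 by metis+
    then show ?thesis using 1 f1(5) f2(5) by simp
  next
    case 2
    then have "e1' = e2" "e2' = e1" using opposite_diagonal_unique[OF V(2)] f1 f2 by metis+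
    then show ?thesis using 2 f1(5) f2(5) by (auto simp: fun_eq_iff)
  qed
qed

lemma colored_central_flip:
  assumes v: "cct v" and d: "ch i (i + m) \<in> fst v" and q: "quad (fst v) i k (i + m) l"
  defines "w \<equiv> (insert (ch k l) (fst v - {ch i (i + m)}), snd v)"
  shows "cct w" "central_flip K p v w" "central_flip K p w v" "l = k + m"
proof -
  obtain T \<gamma> where vT: "v = (T, \<gamma>)" by (cases v)
  note V = cctD[OF v[unfolded vT]]
  have dT: "ch i (i + m) \<in> T" and qT: "quad T i k (i + m) l" using d q vT by auto
  define T2 where "T2 = insert (ch k l) (T - {ch i (i + m)})"
  note F = central_flip_cs_triangulation[OF V(1) dT qT T2_def]
  have w: "w = (T2, \<gamma>)" unfolding w_def vT T2_def by simp
  have cen: "central p (ch i (i + m))" using central_ch[of i "i + m"] m2 by simp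
  show "cct w" using v F(1,2,5) cen unfolding w vT cct_iff by (auto simp: T2_def)
  show "central_flip K p v w"
    unfolding vT w central_flip_def case_prod_conv
    using cen opposite_diagonal_quad[OF dT qT] T2_def by blast
  have "ch k l \<in> T2" unfolding T2_def by simp
  then have "opposite_diagonal K T2 (ch k l) (ch (i + m) (i + 2 * m))"
    using opposite_diagonal_quad F(3) by blast
  then have "opposite_diagonal K T2 (ch k l) (ch i (i + m))" by (simp add: ch_commute)
  moreover have "T = insert (ch i (i + m)) (T2 - {ch k l})" unfolding T2_def using dT F(4) by auto
  ultimately show "central_flip K p w v"
    unfolding vT w central_flip_def case_prod_conv using F(5) by blast
  show "l = k + m" by (rule F(1))
qed

lemma central_flip_unique:
  assumes v: "cct v" and f: "central_flip K p v w" "central_flip K p v w'" shows "w = w'"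
proof -
  obtain T \<gamma> where vT: "v = (T, \<gamma>)" by (cases v)
  note V = cctD[OF v[unfolded vT]]
  obtain d e where f1: "central p d" "opposite_diagonal K T d e" "w = (insert e (T - {d}), \<gamma>)"
    using f(1) unfolding vT central_flip_def by (cases w) auto
  obtain d' e' where f2: "central p d'" "opposite_diagonal K T d' e'" "w' = (insert e' (T - {d'}), \<gamma>)"
    using f(2) unfolding vT central_flip_def by (cases w') auto
  have "d \<in> T" "d' \<in> T" using f1 f2 opposite_diagonal_crossing(3)[OF V(2)] by auto
  then have "d' = d" using central_diagonal_unique[OF V(2)] f1 f2 by metis
  moreover then have "e' = e" using opposite_diagonal_unique[OF V(2)] f1 f2 by metis
  ultimately show ?thesis using f1 f2 by simp
qed

lemma pair_flip_removed:
  assumes v: "cct (T, \<gamma>)" and f: "pair_flip K p c (T, \<gamma>) (T', \<gamma>')"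
  shows "T - T' \<noteq> {}" "d \<in> T - T' \<Longrightarrow> \<gamma> d = Some c"
proof -
  note V = cctD[OF v]
  obtain d1 d2 e1 e2 where f1: "\<not> central p d1" "d2 = refl ` d1" "\<gamma> d1 = Some c"
       "opposite_diagonal K T d1 e1" "opposite_diagonal K T d2 e2" "T' = (T - {d1, d2}) \<union> {e1, e2}"
    using f unfolding pair_flip_def by auto
  have d: "d1 \<in> T" "e1 \<notin> T" "e2 \<notin> T"
    using opposite_diagonal_crossing[OF V(2) f1(4)] opposite_diagonal_crossing[OF V(2) f1(5)] by auto
  then have "d1 \<in> T - T'" using f1 by auto
  then show "T - T' \<noteq> {}" by blast
  have "\<gamma> d2 = Some c" using V(5)[OF d(1) f1(1)] f1 by simp
  then show "d \<in> T - T' \<Longrightarrow> \<gamma> d = Some c" using f1 by auto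
qed

lemma central_flip_removed:
  assumes v: "cct (T, \<gamma>)" and f: "central_flip K p (T, \<gamma>) (T', \<gamma>')"
  shows "T - T' \<noteq> {}" "d \<in> T - T' \<Longrightarrow> \<gamma> d = None"
proof -
  note V = cctD[OF v]
  obtain d1 e1 where f1: "central p d1" "opposite_diagonal K T d1 e1" "T' = insert e1 (T - {d1})"
    using f unfolding central_flip_def by auto
  have d: "d1 \<in> T" "e1 \<notin> T" using opposite_diagonal_crossing[OF V(2) f1(2)] by auto
  then have "d1 \<in> T - T'" using f1 by auto
  then show "T - T' \<noteq> {}" by blast
  show "d \<in> T - T' \<Longrightarrow> \<gamma> d = None" using f1 V(3)[of d1] by auto
qed

text \<open>The color of a flip is the old color of any diagonal it removes, where
  \<open>None\<close> for the uncolored central diagonal agrees with the extra edge color. So the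
  color can be recovered from the two triangulations, which makes the \<open>THE\<close> in
  \<open>exchange_color\<close> well defined.\<close>

lemma colored_flip_color:
  assumes "colored_flip K p C r v w" "d \<in> fst v - fst w" shows "snd v d = r"
  using assms pair_flip_removed(2) central_flip_removed(2)
  unfolding colored_flip_def by (cases v; cases w; cases r) auto

lemma colored_flip_removes: "colored_flip K p C r v w \<Longrightarrow> fst v - fst w \<noteq> {}"
  using pair_flip_removed(1) central_flip_removed(1)
  unfolding colored_flip_def by (cases v; cases w; cases r) force+

lemma colored_flip_neq: "colored_flip K p C r v w \<Longrightarrow> v \<noteq> w"
  using colored_flip_removes by blast

lemma colored_flip_color_unique:
  assumes "colored_flip K p C r v w" "colored_flip K p C r' v w" shows "r = r'"
  using colored_flip_removes[OF assms(1)] colored_flip_color[OF assms(1)] colored_flip_color[OF assms(2)] by blast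

text \<open>The half of the polygon cut off by the central diagonal has \<open>m - 2 = card C\<close> diagonals, which
  carry distinct colors; hence every color occurs.\<close>

lemma half_color_exists:
  assumes v: "cct (T, \<gamma>)" and s: "ch s (s + m) \<in> T" and c: "c \<in> C"
  obtains i j where "(i, j) \<in> half_diagonals T s" "\<gamma> (ch i j) = Some c"
proof -
  note V = cctD[OF v]
  let ?H = "half_diagonals T s"
  have nc: "\<gamma> (ch a b) \<noteq> None" if "(a, b) \<in> ?H" for a b
    using that central_ch[of a b] m2 unfolding half_diagonals_def V(3) by auto
  have inj: "inj_on (\<lambda>(a, b). \<gamma> (ch a b)) ?H"
  proof (rule inj_onI, clarify)
    fix a b a' b' assume h: "(a, b) \<in> ?H" "(a', b') \<in> ?H" and eq: "\<gamma> (ch a b) = \<gamma> (ch a' b')"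
    have o: "s \<le> a" "a + 2 \<le> b" "b \<le> s + m" "s \<le> a'" "a' + 2 \<le> b'" "b' \<le> s + m"
      "\<not> (a = s \<and> b = s + m)" "\<not> (a' = s \<and> b' = s + m)"
      using h unfolding half_diagonals_def by auto
    obtain c where "\<gamma> (ch a b) = Some c" using nc[OF h(1)] by auto
    then have "ch a' b' = ch a b \<or> ch a' b' = ch (a + m) (b + m)" using V(6) eq refl_ch by metis
    then show "a = a' \<and> b = b'"
    proof
      assume "ch a' b' = ch a b"
      then show ?thesis using ch_eq_iff[of s a' b' a b] o m2 by auto
    next
      assume "ch a' b' = ch (a + m) (b + m)"
      then show ?thesis using half_refl_neq[of s a' b' a b] o by auto
    qed
  qed
  have sub: "(\<lambda>(a, b). \<gamma> (ch a b)) ` ?H \<subseteq> Some ` C" using nc V(4) by force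
  note H = half_diagonals_count[OF V(2) s]
  have "(\<lambda>(a, b). \<gamma> (ch a b)) ` ?H = Some ` C"
  proof (rule card_subset_eq[OF _ sub])
    show "card ((\<lambda>(a, b). \<gamma> (ch a b)) ` ?H) = card (Some ` C)"
      unfolding card_image[OF inj] using H cardC by (simp add: card_image)
  qed (use finC in simp)
  then have "Some c \<in> (\<lambda>(a, b). \<gamma> (ch a b)) ` ?H" using c by auto
  then show thesis using that by (auto split: prod.splits)
qed

lemma colored_flip_exists:
  assumes v: "cct v" and r: "r \<in> exchange_colors C"
  obtains w where "colored_flip K p C r v w"
proof -
  obtain T \<gamma> where vT: "v = (T, \<gamma>)" by (cases v)
  note V = cctD[OF v[unfolded vT]]
  obtain s where s: "ch s (s + m) \<in> T" using central_diagonal_exists[OF V(1)] by blast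
  show thesis
  proof (cases r)
    case None
    obtain k l where "quad T s k (s + m) l" using quad_exists[OF V(2) s] m2 by auto
    then show ?thesis
      using colored_central_flip[OF v, of s k l] s that None v unfolding vT colored_flip_def by fastforce
  next
    case (Some c)
    then have "c \<in> C" using r unfolding exchange_colors_def by auto
    then obtain i j where ij: "(i, j) \<in> half_diagonals T s" "\<gamma> (ch i j) = Some c"
      using half_color_exists[OF v[unfolded vT] s] by blast
    then obtain k l where "quad T i k j l"
      using quad_exists[OF V(2), of i j] m2 unfolding half_diagonals_def by auto
    then show ?thesis
      using colored_pair_flip[OF v, of i k j l c] ij that Some v unfolding vT colored_flip_def by fastforce
  qed
qed

lemma colored_flip_unique:
  "colored_flip K p C r v w \<Longrightarrow> colored_flip K p C r v w' \<Longrightarrow> w = w'"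
proof (cases r)
  case None
  then show "colored_flip K p C r v w \<Longrightarrow> colored_flip K p C r v w' \<Longrightarrow> w = w'"
    using central_flip_unique[of v w w'] unfolding colored_flip_def by simp
next
  case (Some c)
  then show "colored_flip K p C r v w \<Longrightarrow> colored_flip K p C r v w' \<Longrightarrow> w = w'"
    using pair_flip_unique[of v c w w'] unfolding colored_flip_def by simp
qed

text \<open>By uniqueness \<open>w\<close> is the result constructed explicitly from the
  quadrilateral, for which the flip back is known.\<close>

lemma colored_flip_sym:
  assumes f: "colored_flip K p C r v w" shows "colored_flip K p C r w v"
proof -
  have v: "cct v" and w: "cct w" using f unfolding colored_flip_def by auto
  obtain T \<gamma> where vT: "v = (T, \<gamma>)" by (cases v)
  note V = cctD[OF v[unfolded vT]]
  show ?thesis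
  proof (cases r)
    case None
    obtain s where s: "ch s (s + m) \<in> T" using central_diagonal_exists[OF V(1)] by blast
    obtain k l where q: "quad T s k (s + m) l" using quad_exists[OF V(2) s] m2 by auto
    note F = colored_central_flip[OF v, of s k l, unfolded vT fst_conv snd_conv, OF s q]
    have "central_flip K p v w" using f None unfolding colored_flip_def by simp
    then have "w = (insert (ch k l) (T - {ch s (s + m)}), \<gamma>)"
      using central_flip_unique[OF v] F(2) vT by blast
    then show ?thesis using F(3) v w None vT unfolding colored_flip_def by simp
  next
    case (Some c)
    then have pf: "pair_flip K p c v w" using f unfolding colored_flip_def by simp
    then obtain d where d: "\<gamma> d = Some c" unfolding vT pair_flip_def by (cases w) auto
    then have "d \<in> T" using V(3) by blast
    then obtain i j where ij: "0 \<le> i" "i + 2 \<le> j" "j < 0 + 2 * m" "d = ch i j"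
      using triangulation_memberE[OF V(2), of d 0] by metis
    obtain k l where q: "quad T i k j l" using quad_exists[OF V(2), of i j] ij \<open>d \<in> T\<close> by auto
    note F = colored_pair_flip[OF v, of i k j l c, unfolded vT fst_conv snd_conv, OF q d[unfolded ij]]
    have "w = pair_flip_result v i k j l c" using pair_flip_unique[OF v pf] F(2) vT by blast
    then show ?thesis using F(3) v w Some vT unfolding colored_flip_def by simp
  qed
qed

end

section \<open>Connectedness of the exchange graph\<close>

context enum_polygon
begin

lemma half_form:
  assumes T: "triangulation_of K T" and s: "ch s (s + m) \<in> T" and d: "d \<in> T" "\<not> central p d"
  obtains a b where "s \<le> a" "a < b" "b \<le> s + m" "(a, b) \<noteq> (s, s + m)" "d = ch a b \<or> d = refl ` ch a b"
proof -
  obtain x y where xy: "s \<le> x" "x + 2 \<le> y" "y < s + 2 * m" "d = ch x y"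
    using triangulation_memberE[OF T d(1), of s] by metis
  have "\<not> crossing (ch s (s + m)) d" using T s d unfolding triangulation_of_def by blast
  then have nc: "\<not> (s < x \<and> x < s + m \<and> s + m < y)" using crossing_ch[of s s "s + m" x y] xy m2 by auto
  have ny: "y \<noteq> x + m" using d(2) central_ch[of x y] xy by auto
  consider "y \<le> s + m" | "s + m \<le> x" | "x = s" "s + m < y" using nc xy by linarith
  then show thesis
  proof cases
    case 1
    then show ?thesis using that[of x y] xy ny by auto
  next
    case 2
    then show ?thesis using that[of "x - m" "y - m"] xy ny by (auto simp: refl_ch)
  next
    \<comment> \<open>Here the end \<open>s\<close> is read as \<open>s + 2 * m\<close>, the last
      vertex of the other half.\<close>
    case 3
    then have "d = ch y (s + 2 * m)" using xy by (simp add: ch_commute)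
    then have "d = refl ` ch (y - m) (s + m)" by (simp add: refl_ch algebra_simps)
    then show ?thesis using that[of "y - m" "s + m"] 3 xy by auto
  qed
qed

end

text \<open>A colored triangulation with central diagonal \<open>(s, s + m)\<close> is encoded by the partial map \<open>g\<close> of
  colors of the chords \<open>(a, b)\<close> with \<open>s \<le> a < b \<le> s + m\<close>; pair flips become flips of this half.\<close>

definition half_adj :: "int \<Rightarrow> int \<Rightarrow> (int \<times> int \<rightharpoonup> 'c) \<Rightarrow> int \<Rightarrow> int \<Rightarrow> bool" where
  "half_adj m s g a b \<longleftrightarrow> b = a + 1 \<or> (a, b) = (s, s + m) \<or> g (a, b) \<noteq> None"

definition half_flip :: "int \<Rightarrow> int \<Rightarrow> (int \<times> int \<rightharpoonup> 'c) \<Rightarrow> (int \<times> int \<rightharpoonup> 'c) \<Rightarrow> bool" where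
  "half_flip m s g g' \<longleftrightarrow> (\<exists>a b c d col. s \<le> a \<and> a < b \<and> b < c \<and> c < d \<and> d \<le> s + m \<and>
     half_adj m s g a b \<and> half_adj m s g b c \<and> half_adj m s g c d \<and> half_adj m s g a d \<and>
     (g (a, c) = Some col \<and> g' = g((a, c) := None, (b, d) := Some col) \<or>
      g (b, d) = Some col \<and> g' = g((b, d) := None, (a, c) := Some col)))"

text \<open>The shift by 2 starts the list at the shortest fan diagonal \<open>(s, s + 2)\<close>;
  up to \<open>(s, s + m - 1)\<close> there are \<open>m - 2\<close> of them, as many as
  colors.\<close>

definition fan_colors :: "int \<Rightarrow> int \<Rightarrow> 'c list \<Rightarrow> (int \<times> int \<rightharpoonup> 'c)" where
  "fan_colors m s cs = (\<lambda>(a, b). if a = s \<and> s + 2 \<le> b \<and> b \<le> s + m - 1 then Some (cs ! nat (b - s - 2)) else None)"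

text \<open>Five flips inside a pentagon restore the triangulation but exchange the colors of its two diagonals.\<close>

lemma fan_swap:
  assumes len: "int (length (xs @ a # b # ys)) = m - 2"
  shows "(half_flip m s)\<^sup>*\<^sup>* (fan_colors m s (xs @ a # b # ys)) (fan_colors m s (xs @ b # a # ys))"
proof -
  \<comment> \<open>\<open>(s, j)\<close> is the fan diagonal of color \<open>a\<close>, and the
    pentagon has the vertices \<open>s\<close>, \<open>j - 1\<close>, \<open>j\<close>,
    \<open>j + 1\<close>, \<open>j + 2\<close>. The flips below move the colors \<open>a\<close>,
    \<open>b\<close>, \<open>a\<close>, \<open>b\<close>, \<open>a\<close> in turn, so each of them
    ends where the other began.\<close>
  define j where "j = s + 2 + int (length xs)"
  have j: "s + 2 \<le> j" "j + 2 \<le> s + m" using len unfolding j_def by auto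
  define g0 where "g0 = fan_colors m s (xs @ a # b # ys)"
  define g1 where "g1 = g0((s, j) := None, (j - 1, j + 1) := Some a)"
  define g2 where "g2 = g1((s, j + 1) := None, (j - 1, j + 2) := Some b)"
  define g3 where "g3 = g2((j - 1, j + 1) := None, (j, j + 2) := Some a)"
  define g4 where "g4 = g3((j - 1, j + 2) := None, (s, j) := Some b)"
  define g5 where "g5 = g4((j, j + 2) := None, (s, j + 1) := Some a)"
  have g0: "g0 (s, j) = Some a" "g0 (s, j + 1) = Some b"
    using j unfolding g0_def fan_colors_def j_def by (auto simp: nth_append)
  have adj0: "half_adj m s g0 s x" if x: "s < x" "x \<le> s + m" for x
  proof -
    consider "x = s + 1" | "x = s + m" | "s + 2 \<le> x" "x \<le> s + m - 1" using x by linarith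
    then show ?thesis unfolding half_adj_def g0_def fan_colors_def by cases auto
  qed
  have adjs: "half_adj m s g x y" if "half_adj m s g0 x y" "g (x, y) = g0 (x, y)" for g x y
    using that unfolding half_adj_def by auto
  have nx: "half_adj m s g x (x + 1)" "half_adj m s g (x - 1) x" for g :: "int \<times> int \<rightharpoonup> 'a" and x unfolding half_adj_def by auto
  have nx2: "half_adj m s g (x + 1) (x + 2)" for g :: "int \<times> int \<rightharpoonup> 'a" and x unfolding half_adj_def by auto
  have A: "half_adj m s g s (j - 1)" "half_adj m s g s (j + 2)"
    if "g (s, j - 1) = g0 (s, j - 1)" "g (s, j + 2) = g0 (s, j + 2)" for g
    using adjs[OF adj0, of "j - 1" g] adjs[OF adj0, of "j + 2" g] j that by auto
  have "half_flip m s g0 g1"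
    unfolding half_flip_def
    by (rule exI[of _ s], rule exI[of _ "j - 1"], rule exI[of _ j], rule exI[of _ "j + 1"], rule exI[of _ a])
      (use j g0 A[of g0] adj0[of "j + 1"] nx in \<open>auto simp: g1_def\<close>)
  moreover have "half_flip m s g1 g2"
    unfolding half_flip_def
    by (rule exI[of _ s], rule exI[of _ "j - 1"], rule exI[of _ "j + 1"], rule exI[of _ "j + 2"], rule exI[of _ b])
      (use j g0 A[of g1] nx2 in \<open>auto simp: g2_def g1_def half_adj_def\<close>)
  moreover have "half_flip m s g2 g3"
    unfolding half_flip_def
    by (rule exI[of _ "j - 1"], rule exI[of _ j], rule exI[of _ "j + 1"], rule exI[of _ "j + 2"], rule exI[of _ a])
      (use j in \<open>auto simp: g3_def g2_def g1_def half_adj_def\<close>)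
  moreover have "half_flip m s g3 g4"
    unfolding half_flip_def
    by (rule exI[of _ s], rule exI[of _ "j - 1"], rule exI[of _ j], rule exI[of _ "j + 2"], rule exI[of _ b])
      (use j A[of g3] in \<open>auto simp: g4_def g3_def g2_def g1_def half_adj_def\<close>)
  moreover have "half_flip m s g4 g5"
    unfolding half_flip_def
    by (rule exI[of _ s], rule exI[of _ j], rule exI[of _ "j + 1"], rule exI[of _ "j + 2"], rule exI[of _ a])
      (use j A[of g4] in \<open>auto simp: g5_def g4_def g3_def g2_def g1_def half_adj_def\<close>)
  moreover have "g5 = fan_colors m s (xs @ b # a # ys)"
  proof
    fix z :: "int \<times> int"
    obtain x y where z: "z = (x, y)" by (cases z)
    have nth: "(xs @ a # b # ys) ! t = (xs @ b # a # ys) ! t" if "t \<noteq> length xs" "t \<noteq> Suc (length xs)" for t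
      using that by (auto simp: nth_append nth_Cons split: nat.splits)
    have nth': "(xs @ b # a # ys) ! length xs = b" "(xs @ b # a # ys) ! Suc (length xs) = a"
      by (auto simp: nth_append)
    consider "x = s" "y = j" | "x = s" "y = j + 1" | "x = s" "y \<noteq> j" "y \<noteq> j + 1" | "x \<noteq> s" by blast
    then show "g5 z = fan_colors m s (xs @ b # a # ys) z"
    proof cases
      case 1
      have "nat (j - s - 2) = length xs" unfolding j_def by simp
      then show ?thesis using 1 j nth' unfolding z by (simp add: g5_def g4_def fan_colors_def)
    next
      case 2
      have "nat (j + 1 - s - 2) = Suc (length xs)" unfolding j_def by simp
      then show ?thesis using 2 j nth' unfolding z by (simp add: g5_def fan_colors_def)
    next
      case 3
      have "g5 z = g0 z" using 3 j unfolding z g5_def g4_def g3_def g2_def g1_def by auto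
      moreover have "nat (y - s - 2) \<noteq> length xs \<and> nat (y - s - 2) \<noteq> Suc (length xs)" if "s + 2 \<le> y"
        using that 3 unfolding j_def by auto
      ultimately show ?thesis using 3 nth unfolding z g0_def fan_colors_def by auto
    next
      case 4
      then have "g5 z = None" using j unfolding z g5_def g4_def g3_def g2_def g1_def g0_def fan_colors_def by auto
      then show ?thesis using 4 unfolding z fan_colors_def by auto
    qed
  qed
  ultimately show ?thesis unfolding g0_def by (metis (no_types) converse_rtranclp_into_rtranclp rtranclp.rtrancl_refl)
qed

text \<open>Adjacent transpositions generate all permutations: with \<open>ys = us @ x # vs\<close>,
  induction turns the tail into \<open>us @ vs\<close>, and then \<open>x\<close> is moved through
  \<open>us\<close>. The prefix \<open>ps\<close> is there for this induction.\<close>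

lemma rtranclp_permutation:
  assumes swap: "\<And>xs a b ys. length (xs @ a # b # ys) = n \<Longrightarrow> R\<^sup>*\<^sup>* (f (xs @ a # b # ys)) (f (xs @ b # a # ys))"
  shows "mset xs = mset ys \<Longrightarrow> length (ps @ xs) = n \<Longrightarrow> R\<^sup>*\<^sup>* (f (ps @ xs)) (f (ps @ ys))"
proof (induction xs arbitrary: ps ys)
  case (Cons x xs)
  have move: "R\<^sup>*\<^sup>* (f (qs @ x # us @ vs)) (f (qs @ us @ x # vs))" if "length (qs @ x # us @ vs) = n" for qs us vs
    using that
  proof (induction us arbitrary: qs)
    case (Cons z us)
    have "R\<^sup>*\<^sup>* (f (qs @ x # z # us @ vs)) (f (qs @ z # x # us @ vs))" using swap Cons.prems by simp
    moreover have "R\<^sup>*\<^sup>* (f ((qs @ [z]) @ x # us @ vs)) (f ((qs @ [z]) @ us @ x # vs))"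
      by (rule Cons.IH) (use Cons.prems in simp)
    ultimately show ?case by simp
  qed simp
  have "x \<in> set ys" using Cons.prems by (metis list.set_intros(1) set_mset_mset)
  then obtain us vs where ys: "ys = us @ x # vs" by (meson split_list)
  have "R\<^sup>*\<^sup>* (f ((ps @ [x]) @ xs)) (f ((ps @ [x]) @ us @ vs))"
    by (rule Cons.IH) (use Cons.prems ys in simp_all)
  moreover have "R\<^sup>*\<^sup>* (f (ps @ x # us @ vs)) (f (ps @ us @ x # vs))"
  proof (rule move)
    have "length (us @ vs) = length xs" using mset_eq_length[OF Cons.prems(1)] ys by simp
    then show "length (ps @ x # us @ vs) = n" using Cons.prems by simp
  qed
  ultimately show ?case using ys by simp
qed simp

lemma fan_permutation:
  assumes "int (length cs) = m - 2" "mset cs = mset cs'"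
  shows "(half_flip m s)\<^sup>*\<^sup>* (fan_colors m s cs) (fan_colors m s cs')"
proof -
  have "(half_flip m s)\<^sup>*\<^sup>* (fan_colors m s ([] @ cs)) (fan_colors m s ([] @ cs'))"
  proof (rule rtranclp_permutation)
    fix xs a b ys assume "length (xs @ a # b # ys) = length cs"
    then show "(half_flip m s)\<^sup>*\<^sup>* (fan_colors m s (xs @ a # b # ys)) (fan_colors m s (xs @ b # a # ys))"
      using assms(1) by (intro fan_swap) simp
  qed (use assms in simp_all)
  then show ?thesis by simp
qed

section \<open>Realizing flips of the half polygon, and reaching the fans\<close>

context colored_polygon
begin

definition flip_rel :: "('c colored_triangulation \<times> 'c colored_triangulation) set" where
  "flip_rel = {(v, w). \<exists>r. colored_flip K p C r v w}"

definition half_colors :: "'c colored_triangulation \<Rightarrow> int \<Rightarrow> (int \<times> int \<rightharpoonup> 'c)" where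
  "half_colors v s = (\<lambda>(a, b). if s \<le> a \<and> a < b \<and> b \<le> s + m then snd v (ch a b) else None)"

definition central_at :: "int \<Rightarrow> 'c colored_triangulation \<Rightarrow> bool" where
  "central_at s v \<longleftrightarrow> cct v \<and> ch s (s + m) \<in> fst v"

text \<open>Symmetry extends the colors of the half to all of \<open>K\<close>, and the
  triangulation consists of the colored diagonals and the central one.\<close>

lemma half_colors_determine:
  assumes v: "central_at s v" and w: "central_at s w" and h: "half_colors v s = half_colors w s"
  shows "v = w"
proof -
  have le: "snd y x = Some c"
    if v: "central_at s v" and w: "central_at s y" and h: "half_colors v s = half_colors y s" and c: "snd v x = Some c"
    for v y x c
  proof -
    obtain T \<gamma> T' \<gamma>' where vw: "v = (T, \<gamma>)" "y = (T', \<gamma>')" by (cases v; cases y)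
    have cv: "cct (T, \<gamma>)" "ch s (s + m) \<in> T" "cct (T', \<gamma>')" using v w vw unfolding central_at_def by auto
    note V = cctD[OF cv(1)] and W = cctD[OF cv(3)]
    have x: "x \<in> T" "\<not> central p x" using c V(3)[of x] vw by auto
    obtain a b where ab: "s \<le> a" "a < b" "b \<le> s + m" "(a, b) \<noteq> (s, s + m)" "x = ch a b \<or> x = refl ` ch a b"
      using half_form[OF V(2) cv(2) x] by blast
    have "\<gamma> (ch a b) = Some c" using ab(5) c V(5)[OF x] vw by auto
    moreover have "\<gamma>' (ch a b) = \<gamma> (ch a b)"
      using fun_cong[OF h, of "(a, b)"] ab vw unfolding half_colors_def by simp
    ultimately have "\<gamma>' (ch a b) = Some c" by simp
    then show ?thesis using ab(5) W(3)[of "ch a b"] W(5)[of "ch a b"] vw by auto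
  qed
  have "snd v x = snd w x" for x
    using le[OF v w h, of x] le[OF w v h[symmetric], of x] by (cases "snd v x"; cases "snd w x") auto
  then have sn: "snd v = snd w" by blast
  have T: "fst v = insert (ch s (s + m)) (dom (snd v))" if v: "central_at s v" for v
  proof -
    have cv: "cct (fst v, snd v)" "ch s (s + m) \<in> fst v" using v unfolding central_at_def by auto
    note V = cctD[OF cv(1)]
    have cen: "central p (ch s (s + m))" using central_ch[of s "s + m"] m2 by simp
    have "d \<in> fst v \<longleftrightarrow> d = ch s (s + m) \<or> snd v d \<noteq> None" for d
      unfolding V(3) using central_diagonal_unique[OF V(2), of d "ch s (s + m)"] cen cv(2) by blast
    then show ?thesis by auto
  qed
  show ?thesis using T[OF v] T[OF w] sn by (simp add: prod_eq_iff)
qed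

lemma half_adj_iff:
  assumes v: "central_at s v" and o: "s \<le> a" "a < b" "b \<le> s + m"
  shows "half_adj m s (half_colors v s) a b \<longleftrightarrow> adj (fst v) a b"
proof -
  have cv: "cct (fst v, snd v)" "ch s (s + m) \<in> fst v" using v unfolding central_at_def by auto
  note V = cctD[OF cv(1)]
  have "half_colors v s (a, b) \<noteq> None \<longleftrightarrow> ch a b \<in> fst v \<and> b \<noteq> a + m"
    using o V(3)[of "ch a b"] central_ch[of a b] m2 unfolding half_colors_def by simp
  moreover have "ch a b edge_of K \<longleftrightarrow> b = a + 1" using edge_of_ch[of a b] o m2 by auto
  ultimately show ?thesis using cv(2) o unfolding half_adj_def adj_def by auto
qed

lemma half_flip_realized:
  assumes v: "central_at s v" and f: "half_flip m s (half_colors v s) g'"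
  shows "\<exists>w. (v, w) \<in> flip_rel \<and> central_at s w \<and> half_colors w s = g'"
proof -
  let ?g = "half_colors v s"
  have cv: "cct v" "cct (fst v, snd v)" "ch s (s + m) \<in> fst v" using v unfolding central_at_def by auto
  note V = cctD[OF cv(2)]
  obtain a b c d col where o: "s \<le> a" "a < b" "b < c" "c < d" "d \<le> s + m" and
     h: "half_adj m s ?g a b" "half_adj m s ?g b c" "half_adj m s ?g c d" "half_adj m s ?g a d" and
     alt: "?g (a, c) = Some col \<and> g' = ?g((a, c) := None, (b, d) := Some col) \<or>
      ?g (b, d) = Some col \<and> g' = ?g((b, d) := None, (a, c) := Some col)"
    using f unfolding half_flip_def by blast
  have A: "adj (fst v) a b" "adj (fst v) b c" "adj (fst v) c d" "adj (fst v) a d"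
    using h half_adj_iff[OF v] o by auto
  have ne: "(a, c) \<noteq> (s, s + m)" "(b, d) \<noteq> (s, s + m)" using o by auto
  \<comment> \<open>The reflected chords do not occur in the half, so the changes of a pair flip at
    them are invisible to \<open>half_colors\<close>.\<close>
  have eqs: "ch x y = ch a c \<longleftrightarrow> (x, y) = (a, c)" "ch x y = ch b d \<longleftrightarrow> (x, y) = (b, d)"
    "ch x y \<noteq> ch (a + m) (c + m)" "ch x y \<noteq> ch (b + m) (d + m)"
    if "s \<le> x" "x < y" "y \<le> s + m" for x y
    using ch_eq_iff[of s x y a c] ch_eq_iff[of s x y b d] half_refl_neq[OF that _ _ _ ne(1)]
      half_refl_neq[OF that _ _ _ ne(2)] that o m2 by auto
  from alt show ?thesis
  proof
    assume g: "?g (a, c) = Some col \<and> g' = ?g((a, c) := None, (b, d) := Some col)"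
    have q: "quad (fst v) a b c d" using A o m2 unfolding quad_def by (auto simp: adj_commute)
    have c: "snd v (ch a c) = Some col" using g o unfolding half_colors_def by auto
    note F = colored_pair_flip[OF cv(1) q c]
    let ?w = "pair_flip_result v a b c d col"
    have "ch s (s + m) \<in> fst ?w" using cv(3) eqs[of s "s + m"] ne m2 unfolding pair_flip_result_def by auto
    moreover have "half_colors ?w s = g'"
      using eqs o g unfolding half_colors_def pair_flip_result_def by (auto simp: fun_eq_iff)
    ultimately show ?thesis
      using F cv(1) unfolding flip_rel_def central_at_def colored_flip_def
      by (intro exI[of _ ?w]) (auto intro!: exI[of _ "Some col"])
  next
    assume g: "?g (b, d) = Some col \<and> g' = ?g((b, d) := None, (a, c) := Some col)"
    \<comment> \<open>Flipping the other diagonal \<open>(b, d)\<close> means reading the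
      quadrilateral from \<open>b\<close>, with \<open>a\<close> shifted by a period.\<close>
    have q: "quad (fst v) b c d (a + 2 * m)" using A o m2 unfolding quad_def by (auto simp: adj_commute)
    have c: "snd v (ch b d) = Some col" using g o unfolding half_colors_def by auto
    note F = colored_pair_flip[OF cv(1) q c]
    let ?w = "pair_flip_result v b c d (a + 2 * m) col"
    have "a + 2 * m + m = a + m + 2 * m" by simp
    then have e: "ch c (a + 2 * m) = ch a c" "ch (c + m) (a + 2 * m + m) = ch (a + m) (c + m)"
      by (simp_all only: ch_periodic ch_commute[of c a] ch_commute[of "c + m" "a + m"])
    have "ch s (s + m) \<in> fst ?w" using cv(3) eqs[of s "s + m"] ne m2 unfolding pair_flip_result_def by auto
    moreover have "half_colors ?w s = g'"
      using eqs o g unfolding half_colors_def pair_flip_result_def e by (auto simp: fun_eq_iff)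
    ultimately show ?thesis
      using F cv(1) unfolding flip_rel_def central_at_def colored_flip_def
      by (intro exI[of _ ?w]) (auto intro!: exI[of _ "Some col"])
  qed
qed

lemma half_flips_realized:
  assumes "(half_flip m s)\<^sup>*\<^sup>* g g'" "central_at s v" "half_colors v s = g"
  shows "\<exists>w. (v, w) \<in> flip_rel\<^sup>* \<and> central_at s w \<and> half_colors w s = g'"
  using assms
proof (induction rule: rtranclp_induct)
  case (step g' g'')
  then obtain w where w: "(v, w) \<in> flip_rel\<^sup>*" "central_at s w" "half_colors w s = g'" by blast
  then obtain w' where w': "(w, w') \<in> flip_rel" "central_at s w'" "half_colors w' s = g''"
    using half_flip_realized[of s w g''] step.hyps by metis
  have "(v, w') \<in> flip_rel\<^sup>*" using w(1) w'(1) by (rule rtrancl_into_rtrancl)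
  then show ?case using w' by blast
qed blast

definition fan_at :: "int \<Rightarrow> 'c colored_triangulation \<Rightarrow> bool" where
  "fan_at s v \<longleftrightarrow> central_at s v \<and> (\<forall>j. s + 2 \<le> j \<and> j \<le> s + m - 1 \<longrightarrow> half_colors v s (s, j) \<noteq> None)"

text \<open>Induction on the number of missing fan diagonals. If \<open>(s, j)\<close> is missing,
  take the first \<open>l\<close> beyond \<open>j\<close> joined to \<open>s\<close> and the
  triangle \<open>s k l\<close>, where \<open>k < j\<close>. Flipping its side \<open>(k, l)\<close>
  creates a new chord at \<open>s\<close> and destroys none.\<close>

lemma fan_reachable:
  assumes "central_at s v" shows "\<exists>w. (v, w) \<in> flip_rel\<^sup>* \<and> fan_at s w"
  using assms
proof (induction "card {j. s + 2 \<le> j \<and> j \<le> s + m - 1 \<and> half_colors v s (s, j) = None}" arbitrary: v rule: less_induct)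
  case less
  note v = \<open>central_at s v\<close>
  let ?g = "half_colors v s"
  have cv: "cct v" "cct (fst v, snd v)" "ch s (s + m) \<in> fst v" using v unfolding central_at_def by auto
  note V = cctD[OF cv(2)]
  let ?T = "fst v"
  show ?case
  proof (cases "fan_at s v")
    case False
    then obtain j where j: "s + 2 \<le> j" "j \<le> s + m - 1" "?g (s, j) = None" using v unfolding fan_at_def by auto
    have nj: "\<not> adj ?T s j" using half_adj_iff[OF v, of s j] j unfolding half_adj_def by auto
    let ?L = "{l. j < l \<and> l \<le> s + m \<and> adj ?T s l}"
    have finL: "finite ?L" by (rule finite_subset[of _ "{j..s + m}"]) auto
    have "s + m \<in> ?L" using cv(3) j unfolding adj_def by auto
    then have Min: "Min ?L \<in> ?L" using Min_in[OF finL] by blast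
    define l where "l = Min ?L"
    have l: "j < l" "l \<le> s + m" "adj ?T s l" using Min unfolding l_def by auto
    have lmin: "l \<le> y" if "j < y" "y \<le> s + m" "adj ?T s y" for y
      unfolding l_def using finL that by (intro Min_le) auto
    obtain k where k: "s < k" "k < l" "adj ?T s k" "adj ?T k l"
      using inner_apex[OF V(2) l(3)] l j m2 by auto
    have kj: "k < j"
    proof (rule ccontr)
      assume "\<not> k < j"
      then consider "k = j" | "j < k" by linarith
      then show False using nj k lmin[of k] l by cases auto
    qed
    obtain x where x: "k < x" "x < l" "adj ?T k x" "adj ?T x l"
      using inner_apex[OF V(2) k(4)] kj l j k m2 by auto
    have nx: "\<not> adj ?T s x" using adj_not_interleaved[OF V(2) _ k(4), of s x] k x l m2 by auto
    have "half_adj m s ?g k l" using half_adj_iff[OF v, of k l] k l by auto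
    then obtain col where col: "?g (k, l) = Some col" using k l kj j unfolding half_adj_def by auto
    define g' where "g' = ?g((k, l) := None, (s, x) := Some col)"
    have "half_flip m s ?g g'"
      unfolding half_flip_def
      by (rule exI[of _ s], rule exI[of _ k], rule exI[of _ x], rule exI[of _ l], rule exI[of _ col])
        (use k x l col half_adj_iff[OF v] in \<open>auto simp: g'_def\<close>)
    then obtain w where w: "(v, w) \<in> flip_rel" "central_at s w" "half_colors w s = g'"
      using half_flip_realized[OF v] by blast
    let ?N = "\<lambda>g. {j. s + 2 \<le> j \<and> j \<le> s + m - 1 \<and> g (s, j) = None}"
    have "?g (s, x) = None" using nx half_adj_iff[OF v, of s x] k x l unfolding half_adj_def by auto
    then have "x \<in> ?N ?g" using k x l by auto
    moreover have "x \<notin> ?N g'" unfolding g'_def by auto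
    moreover have "?N g' \<subseteq> ?N ?g" using k unfolding g'_def by (auto split: if_splits)
    ultimately have "?N g' \<subset> ?N ?g" by blast
    moreover have "finite (?N ?g)" by (rule finite_subset[of _ "{s..s + m}"]) auto
    ultimately have "card (?N g') < card (?N ?g)" by (rule psubset_card_mono[rotated])
    then obtain w' where "(w, w') \<in> flip_rel\<^sup>*" "fan_at s w'" using less.hyps[of w] w by auto
    then show ?thesis using w(1) by (meson converse_rtrancl_into_rtrancl)
  qed blast
qed

text \<open>A chord \<open>(x, y)\<close> of the half with \<open>x \<noteq> s\<close> would cross
  the fan diagonal to \<open>x + 1\<close>. All colors occur among the \<open>m - 2 = card C\<close>
  entries of \<open>cs\<close>, so none is repeated, and two fans at \<open>s\<close> differ by a
  permutation.\<close>

lemma fan_half_colors: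
  assumes f: "fan_at s v"
  obtains cs where "half_colors v s = fan_colors m s cs" "mset cs = mset_set C" "int (length cs) = m - 2"
proof -
  have v: "central_at s v" using f unfolding fan_at_def by simp
  have cv: "cct v" "cct (fst v, snd v)" "ch s (s + m) \<in> fst v" using v unfolding central_at_def by auto
  note V = cctD[OF cv(2)]
  let ?g = "half_colors v s"
  define cs where "cs = map (\<lambda>t. the (?g (s, s + 2 + int t))) [0..<nat (m - 2)]"
  have some: "\<exists>c. ?g (s, y) = Some c" if "s + 2 \<le> y" "y \<le> s + m - 1" for y
    using f that unfolding fan_at_def by auto
  have nth: "?g (s, y) = Some (cs ! nat (y - s - 2))" if y: "s + 2 \<le> y" "y \<le> s + m - 1" for y
  proof -
    have "nat (y - s - 2) < nat (m - 2)" using y by auto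
    then have "cs ! nat (y - s - 2) = the (?g (s, s + 2 + int (nat (y - s - 2))))" unfolding cs_def by simp
    also have "s + 2 + int (nat (y - s - 2)) = y" using y by simp
    finally show ?thesis using some[OF y] by auto
  qed
  have only: "x = s \<and> s + 2 \<le> y \<and> y \<le> s + m - 1" if "?g (x, y) \<noteq> None" for x y
  proof -
    have xy: "s \<le> x" "x < y" "y \<le> s + m" "snd v (ch x y) \<noteq> None"
      using that unfolding half_colors_def by (auto split: if_splits)
    then have T: "ch x y \<in> fst v" "\<not> central p (ch x y)" using V(3) by auto
    then have "ch x y \<in> diagonals K" using V(2) unfolding triangulation_of_def by blast
    then have y2: "x + 2 \<le> y" using ch_diagonal_iff[of x y] xy m2 by auto
    have nm: "y \<noteq> x + m" using T(2) central_ch[of x y] xy m2 by auto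
    have "x = s"
    proof (rule ccontr)
      assume "x \<noteq> s"
      then have "half_adj m s ?g s (x + 1)" using some[of "x + 1"] xy y2 unfolding half_adj_def by auto
      then have "adj (fst v) s (x + 1)" using half_adj_iff[OF v, of s "x + 1"] xy y2 by auto
      moreover have "adj (fst v) x y" using T unfolding adj_def by simp
      ultimately show False using adj_not_interleaved[OF V(2), of s "x + 1" x y] \<open>x \<noteq> s\<close> xy y2 m2 by auto
    qed
    then show ?thesis using y2 nm xy by auto
  qed
  have g: "?g = fan_colors m s cs"
  proof
    fix z :: "int \<times> int"
    obtain x y where z: "z = (x, y)" by (cases z)
    show "?g z = fan_colors m s cs z"
      using nth[of y] only[of x y] unfolding z fan_colors_def by (cases "?g (x, y)") auto
  qed
  have len: "length cs = nat (m - 2)" unfolding cs_def by simp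
  have "C \<subseteq> set cs"
  proof
    fix c assume "c \<in> C"
    then obtain i j where ij: "(i, j) \<in> half_diagonals (fst v) s" "snd v (ch i j) = Some c"
      using half_color_exists[OF cv(2,3)] by blast
    then have "?g (i, j) = Some c" unfolding half_colors_def half_diagonals_def by auto
    then have "i = s" "s + 2 \<le> j" "j \<le> s + m - 1" "c = cs ! nat (j - s - 2)" using only[of i j] nth[of j] by auto
    then show "c \<in> set cs" using len by auto
  qed
  moreover have "card (set cs) \<le> card C" using card_length[of cs] len cardC by simp
  ultimately have set: "set cs = C" using card_seteq[OF _ \<open>C \<subseteq> set cs\<close>] by auto
  then have "distinct cs" using len cardC by (intro card_distinct) simp
  then have "mset cs = mset_set C" using set mset_set_set by metis
  then show thesis using that[of cs] g len cardC by auto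
qed

lemma flip_rel_sym: "(v, w) \<in> flip_rel\<^sup>* \<Longrightarrow> (w, v) \<in> flip_rel\<^sup>*"
proof -
  have "sym flip_rel" unfolding flip_rel_def sym_def using colored_flip_sym by blast
  then show "(v, w) \<in> flip_rel\<^sup>* \<Longrightarrow> (w, v) \<in> flip_rel\<^sup>*" by (metis sym_rtrancl symD)
qed

lemma central_at_connected:
  assumes "central_at s v" "central_at s w" shows "(v, w) \<in> flip_rel\<^sup>*"
proof -
  obtain v' where v': "(v, v') \<in> flip_rel\<^sup>*" "fan_at s v'" using fan_reachable[OF assms(1)] by blast
  obtain w' where w': "(w, w') \<in> flip_rel\<^sup>*" "fan_at s w'" using fan_reachable[OF assms(2)] by blast
  obtain cs where cs: "half_colors v' s = fan_colors m s cs" "mset cs = mset_set C" "int (length cs) = m - 2"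
    using fan_half_colors[OF v'(2)] by blast
  obtain ds where ds: "half_colors w' s = fan_colors m s ds" "mset ds = mset_set C"
    using fan_half_colors[OF w'(2)] by blast
  have c: "central_at s v'" "central_at s w'" using v' w' unfolding fan_at_def by auto
  have "(half_flip m s)\<^sup>*\<^sup>* (fan_colors m s cs) (fan_colors m s ds)"
    using fan_permutation cs ds by metis
  then obtain x where x: "(v', x) \<in> flip_rel\<^sup>*" "central_at s x" "half_colors x s = fan_colors m s ds"
    using half_flips_realized[OF _ c(1) cs(1)] by blast
  then have "x = w'" using half_colors_determine[OF x(2) c(2)] ds by simp
  then show ?thesis using v' x(1) flip_rel_sym[OF w'(1)] by (meson rtrancl_trans)
qed

lemma central_at_move:
  assumes "central_at s v" shows "\<exists>w. (v, w) \<in> flip_rel\<^sup>* \<and> central_at (s - 1) w"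
proof -
  obtain x where x: "(v, x) \<in> flip_rel\<^sup>*" "fan_at s x" using fan_reachable[OF assms] by blast
  have c: "central_at s x" using x unfolding fan_at_def by simp
  have cx: "cct x" "cct (fst x, snd x)" "ch s (s + m) \<in> fst x" using c unfolding central_at_def by auto
  note X = cctD[OF cx(2)]
  \<comment> \<open>For \<open>m = 2\<close> this chord is a side of \<open>K\<close> and not a fan
    diagonal.\<close>
  have "half_adj m s (half_colors x s) s (s + m - 1)"
    using x(2) m2 unfolding fan_at_def half_adj_def by (cases "m = 2") auto
  then have A: "adj (fst x) s (s + m - 1)" using half_adj_iff[OF c, of s "s + m - 1"] m2 by auto
  obtain k l where q: "quad (fst x) s k (s + m) l" using quad_exists[OF X(2) cx(3)] m2 by auto
  have "k = s + m - 1"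
    using inner_apex_unique[OF X(2), of s k "s + m" "s + m - 1"] q A adj_next[of "fst x" "s + m - 1"] m2
    unfolding quad_def by auto
  note F = colored_central_flip[OF cx(1,3) q]
  have "ch k l = ch (s - 1) (s - 1 + m)"
    unfolding F(4) \<open>k = s + m - 1\<close> using ch_periodic(2)[of "s + m - 1" "s - 1"] by (simp add: ch_commute algebra_simps)
  then have "central_at (s - 1) (insert (ch k l) (fst x - {ch s (s + m)}), snd x)"
    using F(1) unfolding central_at_def by simp
  moreover have "(x, (insert (ch k l) (fst x - {ch s (s + m)}), snd x)) \<in> flip_rel"
    using F(1,2) cx(1) unfolding flip_rel_def colored_flip_def by (auto intro!: exI[of _ None])
  ultimately show ?thesis using x(1) by (meson rtrancl.rtrancl_into_rtrancl)
qed

lemma flip_rel_connected: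
  assumes v: "cct v" and w: "cct w" shows "(v, w) \<in> flip_rel\<^sup>*"
proof -
  have ex: "\<exists>s. central_at s v" if "cct v" for v
    using that central_diagonal_exists[of "fst v"] cctD(1)[of "fst v" "snd v"] unfolding central_at_def by auto
  obtain s s' where s: "central_at s v" "central_at s' w" using ex v w by blast
  \<comment> \<open>A move only decreases the index, so \<open>s'\<close> is reached modulo the
    period.\<close>
  define k where "k = nat ((s - s') mod (2 * m))"
  have "\<exists>x. (v, x) \<in> flip_rel\<^sup>* \<and> central_at (s - int k) x" for k
  proof (induction k)
    case (Suc k)
    then obtain x where x: "(v, x) \<in> flip_rel\<^sup>*" "central_at (s - int k) x" by blast
    obtain y where y: "(x, y) \<in> flip_rel\<^sup>*" "central_at (s - int k - 1) y" using central_at_move[OF x(2)] by blast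
    have "s - int k - 1 = s - int (Suc k)" by simp
    then show ?case using x(1) y by (metis rtrancl_trans)
  next
    case 0
    then show ?case using s(1) by (intro exI[of _ v]) simp
  qed
  then obtain x where x: "(v, x) \<in> flip_rel\<^sup>*" "central_at (s - int k) x" by blast
  have "int k = (s - s') mod (2 * m)" unfolding k_def using m2 by simp
  then have "2 * m dvd (s - int k) - s'"
    by (metis diff_diff_add add.commute dvd_minus_mod)
  then have "u (s - int k) = u s'" "u (s - int k + m) = u (s' + m)"
    unfolding u_eq_iff by (simp_all add: mod_eq_dvd_iff)
  then have "central_at s' x" using x(2) unfolding central_at_def ch_def by simp
  then show ?thesis using central_at_connected[OF _ s(2)] x(1) by (meson rtrancl_trans)
qed

end

section \<open>Existence of a colored triangulation; the exchange graph as a properly colored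
  regular graph\<close>

context colored_polygon
begin

text \<open>The fans at \<open>0\<close> and at its antipode \<open>m\<close>, one in each half of
  the central diagonal \<open>(0, m)\<close>, are exchanged by the reflection. This shows that the
  exchange graph has a vertex.\<close>

lemma colored_triangulation_exists: "\<exists>v. cct v"
proof -
  define T where "T = {ch 0 j | j. 2 \<le> j \<and> j \<le> m} \<union> {ch m j | j. m + 2 \<le> j \<and> j \<le> 2 * m - 1}"
  have T0: "ch 0 j \<in> T" if "2 \<le> j" "j \<le> m" for j using that unfolding T_def by blast
  have Tm: "ch m j \<in> T" if "m + 2 \<le> j" "j \<le> 2 * m - 1" for j using that unfolding T_def by blast
  have TE: "\<exists>x y. d = ch x y \<and> (x = 0 \<and> 2 \<le> y \<and> y \<le> m \<or> x = m \<and> m + 2 \<le> y \<and> y \<le> 2 * m - 1)"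
    if "d \<in> T" for d using that unfolding T_def by blast
  have "triangulation_of K T"
    unfolding triangulation_of_def
  proof (intro conjI ballI subsetI)
    fix d assume "d \<in> T"
    then obtain x y where "d = ch x y" "x = 0 \<and> 2 \<le> y \<and> y \<le> m \<or> x = m \<and> m + 2 \<le> y \<and> y \<le> 2 * m - 1"
      using TE by blast
    then show "d \<in> diagonals K" using ch_diagonal_iff[of x y] m2 by auto
  next
    fix d e assume "d \<in> T" "e \<in> T"
    then obtain x y a b where "d = ch x y" "x = 0 \<and> 2 \<le> y \<and> y \<le> m \<or> x = m \<and> m + 2 \<le> y \<and> y \<le> 2 * m - 1"
        "e = ch a b" "a = 0 \<and> 2 \<le> b \<and> b \<le> m \<or> a = m \<and> m + 2 \<le> b \<and> b \<le> 2 * m - 1"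
      using TE by blast
    then show "\<not> crossing d e" using crossing_ch[of 0 x y a b] m2 by auto
  next
    fix d assume d: "d \<in> diagonals K - T"
    then obtain x y where xy: "0 \<le> x" "x + 2 \<le> y" "y < 0 + 2 * m" "y \<le> x + 2 * m - 2" "d = ch x y"
      using diagonalE[of d 0] by (metis DiffD1)
    have "x = 0 \<Longrightarrow> m < y" "x \<noteq> m" using d xy T0[of y] Tm[of y] by force+
    \<comment> \<open>A chord inside one half is crossed by the fan diagonal to
      \<open>x + 1\<close>, a chord from \<open>0\<close> beyond \<open>m\<close> by the one from
      \<open>m\<close> to \<open>y + 1\<close>, and a chord between the halves by
      \<open>(0, m)\<close>.\<close>
    then consider "x = 0" "m < y" | "0 < x" "x < m" "y \<le> m" | "0 < x" "x < m" "m < y" | "m < x"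
      using xy by linarith
    then show "\<exists>e \<in> T. crossing d e"
    proof cases
      case 1
      then show ?thesis using Tm[of "y + 1"] crossing_ch[of 0 x y m "y + 1"] xy m2 by (intro bexI[of _ "ch m (y + 1)"]) auto
    next
      case 2
      then show ?thesis using T0[of "x + 1"] crossing_ch[of 0 x y 0 "x + 1"] xy m2 by (intro bexI[of _ "ch 0 (x + 1)"]) auto
    next
      case 3
      then show ?thesis using T0[of m] crossing_ch[of 0 x y 0 m] xy m2 by (intro bexI[of _ "ch 0 m"]) auto
    next
      case 4
      then show ?thesis using Tm[of "x + 1"] crossing_ch[of 0 x y m "x + 1"] xy m2 by (intro bexI[of _ "ch m (x + 1)"]) auto
    qed
  qed
  moreover have r0: "refl ` ch 0 j = ch m (j + m)" for j using refl_ch[of 0 j] by simp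
  have rm: "refl ` ch m (j + m) = ch 0 j" for j using r0 by (metis point_reflection_image)
  have self: "ch m (m + m) = ch 0 m" using ch_periodic(2)[of m 0] ch_commute by simp
  have "refl ` d \<in> T" if "d \<in> T" for d
  proof -
    obtain x y where xy: "d = ch x y" "x = 0 \<and> 2 \<le> y \<and> y \<le> m \<or> x = m \<and> m + 2 \<le> y \<and> y \<le> 2 * m - 1"
      using TE \<open>d \<in> T\<close> by blast
    then consider "x = 0" "y = m" | "x = 0" "2 \<le> y" "y \<le> m - 1" | "x = m" "m + 2 \<le> y" "y \<le> 2 * m - 1" by linarith
    then show ?thesis
    proof cases
      case 1 then show ?thesis using xy r0 self T0[of m] m2 by simp
    next
      case 2 then show ?thesis using xy r0 Tm[of "y + m"] by simp
    next
      case 3 then show ?thesis using xy rm[of "y - m"] T0[of "y - m"] by simp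
    qed
  qed
  ultimately have cs: "cs_triangulation K p T" unfolding cs_triangulation_def by blast
  \<comment> \<open>The symmetric pairs are numbered by the end \<open>j\<close> of their member at
    \<open>0\<close>, so the numbers are those from \<open>2\<close> to \<open>m - 1\<close>, as
    many as colors.\<close>
  define J where "J d j \<longleftrightarrow> 2 \<le> j \<and> j \<le> m - 1 \<and> (d = ch 0 j \<or> d = ch m (j + m))" for d j
  have J_unique: "i = j" if "J d i" "J d j" for d i j
    using that ch_eq_iff[of 0 0 i 0 j] ch_eq_iff[of 0 m "i + m" m "j + m"] ch_eq_iff[of 0 0 i m "j + m"]
      ch_eq_iff[of 0 m "i + m" 0 j] m2 unfolding J_def by auto
  have J_refl: "J (refl ` d) j \<longleftrightarrow> J d j" for d j
  proof -
    have "refl ` d = ch m (j + m) \<longleftrightarrow> d = ch 0 j" "refl ` d = ch 0 j \<longleftrightarrow> d = ch m (j + m)"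
      using r0 rm by (metis point_reflection_image)+
    then show ?thesis unfolding J_def by auto
  qed
  have "card {2..m - 1} = card C" using cardC by simp
  then obtain h where h: "bij_betw h {2..m - 1} C"
    using finite_same_card_bij[of "{2..m - 1}" C] finC by auto
  define \<gamma> where "\<gamma> d = (if \<exists>j. J d j then Some (h (THE j. J d j)) else None)" for d
  have \<gamma>_J: "\<gamma> d = Some (h j)" if "J d j" for d j
  proof -
    have "(THE j. J d j) = j" using that J_unique by blast
    then show ?thesis using that unfolding \<gamma>_def by auto
  qed
  have dom: "\<gamma> d \<noteq> None \<longleftrightarrow> (\<exists>j. J d j)" for d unfolding \<gamma>_def by auto
  have J_T: "(\<exists>j. J d j) \<longleftrightarrow> d \<in> T \<and> \<not> central p d" for d
  proof
    assume "\<exists>j. J d j"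
    then obtain j where j: "2 \<le> j" "j \<le> m - 1" "d = ch 0 j \<or> d = ch m (j + m)" unfolding J_def by blast
    then show "d \<in> T \<and> \<not> central p d"
      using T0[of j] Tm[of "j + m"] central_ch[of 0 j] central_ch[of m "j + m"] m2 by auto
  next
    assume a: "d \<in> T \<and> \<not> central p d"
    then obtain x y where xy: "d = ch x y" "x = 0 \<and> 2 \<le> y \<and> y \<le> m \<or> x = m \<and> m + 2 \<le> y \<and> y \<le> 2 * m - 1"
      using TE by blast
    then have "y \<noteq> x + m" using a central_ch[of x y] m2 by auto
    then have "J d (if x = 0 then y else y - m)" using xy m2 unfolding J_def by auto
    then show "\<exists>j. J d j" by blast
  qed
  have "cct (T, \<gamma>)"
    unfolding cct_iff
  proof (intro conjI cs ballI impI)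
    show "dom \<gamma> = {d \<in> T. \<not> central p d}" using dom J_T by auto
    show "ran \<gamma> \<subseteq> C"
    proof
      fix c assume "c \<in> ran \<gamma>"
      then obtain d where d: "\<gamma> d = Some c" unfolding ran_def by blast
      then obtain j where j: "J d j" using dom[of d] by auto
      then have "j \<in> {2..m - 1}" unfolding J_def by auto
      then show "c \<in> C" using h \<gamma>_J[OF j] d bij_betwE by fastforce
    qed
    fix d assume "d \<in> dom \<gamma>"
    then obtain j where j: "J d j" using dom by auto
    show "\<gamma> (refl ` d) = \<gamma> d" using \<gamma>_J[of d j] \<gamma>_J[of "refl ` d" j] J_refl j by simp
    fix e assume "e \<in> dom \<gamma>" "\<gamma> d = \<gamma> e"
    then obtain i where i: "J e i" using dom by auto
    have "h j = h i" using \<gamma>_J[OF i] \<gamma>_J[OF j] \<open>\<gamma> d = \<gamma> e\<close> by simp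
    moreover have "i \<in> {2..m - 1}" "j \<in> {2..m - 1}" using i j unfolding J_def by auto
    ultimately have "i = j" using h unfolding bij_betw_def inj_on_def by blast
    then show "e = d \<or> e = refl ` d" using i j r0 rm unfolding J_def by metis
  qed
  then show ?thesis by blast
qed

abbreviation graph :: "'c colored_triangulation ugraph" where
  "graph \<equiv> exchange_graph K p C"

lemma edge_iff: "{v, w} \<in> snd graph \<longleftrightarrow> (\<exists>r. colored_flip K p C r v w)"
proof
  assume "{v, w} \<in> snd graph"
  then obtain a b r where "{v, w} = {a, b}" "colored_flip K p C r a b" unfolding exchange_graph_def by auto
  then show "\<exists>r. colored_flip K p C r v w" unfolding doubleton_eq_iff using colored_flip_sym by blast
next
  assume "\<exists>r. colored_flip K p C r v w"
  then show "{v, w} \<in> snd graph" unfolding exchange_graph_def snd_conv by blast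
qed

lemma edge_color: "colored_flip K p C r v w \<Longrightarrow> exchange_color K p C {v, w} = r"
  unfolding exchange_color_def
proof (rule the_equality)
  assume a: "colored_flip K p C r v w"
  then show "\<exists>v' w'. {v, w} = {v', w'} \<and> colored_flip K p C r v' w'" by blast
  fix r' assume "\<exists>v' w'. {v, w} = {v', w'} \<and> colored_flip K p C r' v' w'"
  then have "colored_flip K p C r' v w" using colored_flip_sym by (auto simp: doubleton_eq_iff)
  then show "r' = r" using colored_flip_color_unique a by blast
qed

lemma colored_flip_colors: "colored_flip K p C r v w \<Longrightarrow> r \<in> exchange_colors C"
proof -
  assume a: "colored_flip K p C r v w"
  then obtain d where d: "snd v d = r" using colored_flip_removes colored_flip_color by blast
  have "cct (fst v, snd v)" using a unfolding colored_flip_def by simp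
  from cctD(4)[OF this, of d] show ?thesis using d unfolding exchange_colors_def by (cases r) auto
qed

lemma graph_edgeE:
  assumes "e \<in> snd graph" obtains v w r where "e = {v, w}" "colored_flip K p C r v w"
  using assms unfolding exchange_graph_def by auto

lemma card_exchange_colors: "finite (exchange_colors C)" "card (exchange_colors C) = Suc (card C)"
  unfolding exchange_colors_def using finC by (simp_all add: card_image)

lemma colorful_exchange_graph: "colorful_graph graph (exchange_color K p C) (exchange_colors C)"
proof
  show "finite (exchange_colors C)" by (rule card_exchange_colors)
  show "simple_graph graph"
    unfolding simple_graph_def
  proof
    fix e assume "e \<in> snd graph"
    then obtain v w r where e: "e = {v, w}" "colored_flip K p C r v w" by (rule graph_edgeE)
    moreover have "v \<noteq> w" using colored_flip_neq e by blast
    moreover have "cct v" "cct w" using e unfolding colored_flip_def by auto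
    ultimately show "e \<subseteq> fst graph \<and> card e = 2" unfolding exchange_graph_def by simp
  qed
  have "{(x, y). {x, y} \<in> snd graph} = flip_rel" unfolding flip_rel_def edge_iff ..
  then show "connected_graph graph"
    unfolding connected_graph_def using colored_triangulation_exists flip_rel_connected
    by (simp add: exchange_graph_def)
  show "proper_edge_coloring graph (exchange_color K p C) (exchange_colors C)"
    unfolding proper_edge_coloring_def
  proof (intro conjI ballI impI)
    show "exchange_color K p C ` snd graph \<subseteq> exchange_colors C"
    proof
      fix r assume "r \<in> exchange_color K p C ` snd graph"
      then obtain e where e: "e \<in> snd graph" "r = exchange_color K p C e" by blast
      obtain v w r' where "e = {v, w}" "colored_flip K p C r' v w" using graph_edgeE[OF e(1)] by blast
      then show "r \<in> exchange_colors C" using edge_color colored_flip_colors e(2) by simp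
    qed
    fix e e' assume ee: "e \<in> snd graph" "e' \<in> snd graph" "e \<noteq> e' \<and> e \<inter> e' \<noteq> {}"
    have star: "\<exists>w r. e = {x, w} \<and> colored_flip K p C r x w" if ex: "e \<in> snd graph" "x \<in> e" for e x
    proof -
      obtain v w r where e: "e = {v, w}" "colored_flip K p C r v w" using graph_edgeE[OF ex(1)] by blast
      then have "x = v \<or> x = w" "e = {w, v}" using ex(2) by auto
      then show ?thesis using e colored_flip_sym[OF e(2)] by blast
    qed
    obtain x where x: "x \<in> e" "x \<in> e'" using ee(3) by blast
    obtain w r where w: "e = {x, w}" "colored_flip K p C r x w" using star[OF ee(1) x(1)] by blast
    obtain w' r' where w': "e' = {x, w'}" "colored_flip K p C r' x w'" using star[OF ee(2) x(2)] by blast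
    have "w \<noteq> w'" using w(1) w'(1) ee(3) by auto
    then have "r \<noteq> r'" using colored_flip_unique[of r x w w'] w(2) w'(2) by auto
    then show "exchange_color K p C e \<noteq> exchange_color K p C e'"
      using edge_color[OF w(2)] edge_color[OF w'(2)] w(1) w'(1) by simp
  qed
  show "regular_graph (card (exchange_colors C)) graph"
    unfolding regular_graph_def
  proof
    fix v assume "v \<in> fst graph"
    then have v: "cct v" unfolding exchange_graph_def by simp
    have "\<exists>w. colored_flip K p C r v w" if "r \<in> exchange_colors C" for r
      using colored_flip_exists[OF v that] by blast
    \<comment> \<open>As each color gives exactly one flip of \<open>v\<close>, the edges at
      \<open>v\<close> correspond to the colors.\<close>
    then obtain nb where nb: "\<And>r. r \<in> exchange_colors C \<Longrightarrow> colored_flip K p C r v (nb r)" by metis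
    have "{e \<in> snd graph. v \<in> e} = (\<lambda>r. {v, nb r}) ` exchange_colors C"
    proof
      show "(\<lambda>r. {v, nb r}) ` exchange_colors C \<subseteq> {e \<in> snd graph. v \<in> e}" using nb edge_iff by blast
      show "{e \<in> snd graph. v \<in> e} \<subseteq> (\<lambda>r. {v, nb r}) ` exchange_colors C"
      proof
        fix e assume e: "e \<in> {e \<in> snd graph. v \<in> e}"
        then obtain a b r where ab: "e = {a, b}" "colored_flip K p C r a b" using graph_edgeE by blast
        then have "v = a \<or> v = b" "e = {b, a}" using e by auto
        then obtain w where w: "e = {v, w}" "colored_flip K p C r v w"
          using ab colored_flip_sym[OF ab(2)] by blast
        have r: "r \<in> exchange_colors C" using colored_flip_colors[OF w(2)] .
        then have "w = nb r" using colored_flip_unique[OF w(2) nb[OF r]] by simp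
        then show "e \<in> (\<lambda>r. {v, nb r}) ` exchange_colors C" using w(1) r by blast
      qed
    qed
    moreover have "inj_on (\<lambda>r. {v, nb r}) (exchange_colors C)"
    proof (rule inj_onI)
      fix r r' assume r: "r \<in> exchange_colors C" "r' \<in> exchange_colors C" "{v, nb r} = {v, nb r'}"
      show "r = r'"
        using edge_color[OF nb[OF r(1)]] edge_color[OF nb[OF r(2)]] unfolding r(3) by (rule trans[OF sym])
    qed
    ultimately show "finite {e \<in> snd graph. v \<in> e} \<and> card {e \<in> snd graph. v \<in> e} = card (exchange_colors C)"
      using card_exchange_colors(1) by (simp only: card_image finite_imageI)
  qed
qed

end

theorem theorem13:
  fixes n :: nat and K :: "complex set" and p :: complex and C :: "'c set"
  assumes "convex_polygon (2 * n + 4) K"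
    and "centrally_symmetric K p"
    and "finite C" and "card C = n"
  shows "simple_graph (exchange_graph K p C)
    \<and> connected_graph (exchange_graph K p C)
    \<and> regular_graph (n + 1) (exchange_graph K p C)
    \<and> proper_edge_coloring (exchange_graph K p C) (exchange_color K p C) (exchange_colors C)
    \<and> abstract_polytope (n + 1) (colorful_cyclohedron K p C)
    \<and> (\<forall>F \<in> Field (colorful_cyclohedron K p C).
         face_rank (colorful_cyclohedron K p C) F = colorful_rank F)
    \<and> simple_polytope (n + 1) (colorful_cyclohedron K p C)
    \<and> graph_isomorphism (\<lambda>v. Face {} {v})
        (exchange_graph K p C) (one_skeleton (colorful_cyclohedron K p C))"
proof -
  have "nat (2 * (int n + 2)) = 2 * n + 4" by simp
  then interpret cs_polygon K p "int n + 2"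
    using assms by unfold_locales simp_all
  obtain u :: "int \<Rightarrow> complex" where "range u = vertices K"
    "\<And>i j. u i = u j \<longleftrightarrow> i mod (2 * (int n + 2)) = j mod (2 * (int n + 2))"
    "\<And>i j k. i < j \<Longrightarrow> j < k \<Longrightarrow> k < i + 2 * (int n + 2) \<Longrightarrow> orient (u i) (u j) (u k) > 0"
    "\<And>i. point_reflection p (u i) = u (i + (int n + 2))"
    using vertex_enumeration by blast
  then interpret colored_polygon K p "int n + 2" u C
    using assms by unfold_locales simp_all
  interpret colorful_graph "exchange_graph K p C" "exchange_color K p C" "exchange_colors C"
    by (rule colorful_exchange_graph)
  have "card (exchange_colors C) = n + 1" using card_exchange_colors(2) assms by simp
  then show ?thesis
    using simple conn reg proper P_abstract_polytope face_rank_eq P_simple_polytope P_one_skeleton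
    unfolding colorful_cyclohedron_def by simp
qed

end
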